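(* Let $M$ be an odd Poisson supermanifold with odd bracket $\{\ ,\ \}$. For non-degenerate volume forms $\boldsymbol{\rho}$ and $\boldsymbol{\rho}'=e^{\sigma}\boldsymbol{\rho}$ on $M$ (with $\sigma$ an even function), the squares of the odd Laplace operators on functions are related by $$\Delta_{\boldsymbol{\rho}'}^2=\Delta_{\boldsymbol{\rho}}^2-X_{H(\boldsymbol{\rho}',\boldsymbol{\rho})},$$ where $$H(\boldsymbol{\rho}',\boldsymbol{\rho}):=\Delta_{\boldsymbol{\rho}}\sigma-\tfrac12\{\sigma,\sigma\}=2e^{-\sigma/2}\Delta_{\boldsymbol{\rho}}e^{\sigma/2}.$$ The odd functions $H(\boldsymbol{\rho}',\boldsymbol{\rho})$ satisfy the cocycle conditions $$H(\boldsymbol{\rho},\boldsymbol{\rho})=0,\qquad H(\boldsymbol{\rho}',\boldsymbol{\rho})+H(\boldsymbol{\rho},\boldsymbol{\rho}')=0,\qquad H(\boldsymbol{\rho}'',\boldsymbol{\rho})=H(\boldsymbol{\rho}'',\boldsymbol{\rho}')+H(\boldsymbol{\rho}',\boldsymbol{\rho})$$ for all non-degenerate volume forms $\boldsymbol{\rho}$, $\boldsymbol{\rho}'=e^{\sigma}\boldsymbol{\rho}$, $\boldsymbol{\rho}''=e^{\sigma'}\boldsymbol{\rho}'$ with $\sigma,\sigma'$ even functions.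
   Context: Setting. $M$ is a smooth supermanifold with local coordinates $x^a$ of parity $\tilde a$; tilde denotes parity; derivatives are left derivatives. An odd Poisson (Schouten) structure on $M$ is an odd function $\mathfrak{S}=\frac12\mathfrak{S}^{ab}(x)p_bp_a$ on $T^*M$, quadratic in the momenta, with $\mathfrak{S}^{ab}=(-1)^{\tilde a\tilde b}\mathfrak{S}^{ba}$ of parity $\tilde a+\tilde b+1$, satisfying $(\mathfrak{S},\mathfrak{S})=0$ for the canonical even Poisson bracket $(\ ,\ )$ on $T^*M$. The odd bracket is $\{f,g\}=(f,(\mathfrak{S},g))=-(-1)^{\tilde f(\tilde a+1)}\mathfrak{S}^{ab}\frac{\partial f}{\partial x^b}\frac{\partial g}{\partial x^a}$; the condition $(\mathfrak{S},\mathfrak{S})=0$ is equivalent to its graded Jacobi identity. A supermanifold with such a structure is an odd Poisson (= Schouten) manifold. Hamiltonian vector field: $X_f:=(-1)^{\tilde f+1}\{f,\ \}=(-1)^{\tilde a\tilde f}\mathfrak{S}^{ab}\frac{\partial f}{\partial x^b}\frac{\partial}{\partial x^a}$, of parity $\tilde f+1$. A volume form is locally $\boldsymbol{\rho}=\rho\,Dx$, where $Dx$ is the Berezin coordinate volume element (transforming by the Berezinian); non-degenerate means it is a basis element of the module of volume forms ($\rho$ even and invertible). The divergence is $\mathrm{div}_{\boldsymbol{\rho}}X=\frac1\rho(-1)^{\tilde a(\tilde X+1)}\frac{\partial(\rho X^a)}{\partial x^a}$. The odd Laplace operator on functions is $\Delta_{\boldsymbol{\rho}}f:=\mathrm{div}_{\boldsymbol{\rho}}X_f=\frac1\rho\frac{\partial}{\partial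 x^a}\left(\rho\,\mathfrak{S}^{ab}\frac{\partial f}{\partial x^b}\right)$. *)

theory Defs
  imports "HOL-Analysis.Analysis"
begin

section \<open>Real Grassmann algebras\<close>

text \<open>
  The Grassmann algebra on generators \<open>\<theta>\<^sub>a\<close> indexed by a finite, linearly ordered type.
  An element \<open>\<Sum>A. c A * \<theta>\<^sub>A\<close> is given by its coefficients, where \<open>\<theta>\<^sub>A\<close> is the product of the
  \<open>\<theta>\<^sub>a\<close>, \<open>a \<in> A\<close>, in increasing order of the indices.
\<close>

typedef 'i grass = "UNIV :: ('i set \<Rightarrow> real) set"
  morphisms coeff Grass ..

lemma coeff_Grass [simp]: "coeff (Grass c) = c"
  by (simp add: Grass_inverse)

lemma grass_eqI: "(\<And>A. coeff g A = coeff h A) \<Longrightarrow> g = h"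
  by (metis coeff_inject ext)

text \<open>\<open>\<theta>\<^sub>A * \<theta>\<^sub>B = shuffle_sign A B * \<theta>\<^sub>A\<^sub>\<union>\<^sub>B\<close> for disjoint \<open>A\<close> and \<open>B\<close>.\<close>

definition shuffle_sign :: "'i::linorder set \<Rightarrow> 'i set \<Rightarrow> real" where
  "shuffle_sign A B = (-1) ^ card {(a, b). a \<in> A \<and> b \<in> B \<and> b < a}"

lemma shuffle_sign_empty [simp]: "shuffle_sign {} B = 1" "shuffle_sign A {} = 1"
  by (simp_all add: shuffle_sign_def)

lemma shuffle_sign_abs [simp]: "\<bar>shuffle_sign A B\<bar> = 1"
  by (simp add: shuffle_sign_def power_abs)

lemma shuffle_sign_Un_left:
  fixes A B C :: "'i::{finite,linorder} set"
  assumes "A \<inter> B = {}"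
  shows "shuffle_sign (A \<union> B) C = shuffle_sign A C * shuffle_sign B C"
proof -
  have eq: "{(a, b). a \<in> A \<union> B \<and> b \<in> C \<and> b < a} =
      {(a, b). a \<in> A \<and> b \<in> C \<and> b < a} \<union> {(a, b). a \<in> B \<and> b \<in> C \<and> b < a}"
    by auto
  show ?thesis
    unfolding shuffle_sign_def eq power_add [symmetric]
    by (subst card_Un_disjoint) (use assms in \<open>auto intro: finite_subset [OF subset_UNIV]\<close>)
qed

lemma shuffle_sign_Un_right:
  fixes A B C :: "'i::{finite,linorder} set"
  assumes "B \<inter> C = {}"
  shows "shuffle_sign A (B \<union> C) = shuffle_sign A B * shuffle_sign A C"
proof -
  have eq: "{(a, b). a \<in> A \<and> b \<in> B \<union> C \<and> b < a} =
      {(a, b). a \<in> A \<and> b \<in> B \<and> b < a} \<union> {(a, b). a \<in> A \<and> b \<in> C \<and> b < a}"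
    by auto
  show ?thesis
    unfolding shuffle_sign_def eq power_add [symmetric]
    by (subst card_Un_disjoint) (use assms in \<open>auto intro: finite_subset [OF subset_UNIV]\<close>)
qed

instantiation grass :: (type) real_vector
begin

definition "0 = Grass (\<lambda>A. 0)"
definition "g + h = Grass (\<lambda>A. coeff g A + coeff h A)"
definition "- g = Grass (\<lambda>A. - coeff g A)"
definition "g - h = Grass (\<lambda>A. coeff g A - coeff h A)"
definition "r *\<^sub>R g = Grass (\<lambda>A. r * coeff g A)"

instance
  by standard (auto intro!: grass_eqI simp: zero_grass_def plus_grass_def uminus_grass_def
      minus_grass_def scaleR_grass_def algebra_simps)

end

lemma coeff_linear [simp]:
  "coeff 0 A = 0" "coeff (g + h) A = coeff g A + coeff h A" "coeff (- g) A = - coeff g A"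
  "coeff (g - h) A = coeff g A - coeff h A" "coeff (r *\<^sub>R g) A = r * coeff g A"
  by (simp_all add: zero_grass_def plus_grass_def uminus_grass_def minus_grass_def
      scaleR_grass_def)

instantiation grass :: ("{finite,linorder}") real_algebra_1
begin

definition "1 = Grass (\<lambda>A. if A = {} then 1 else 0)"
definition "g * h = Grass (\<lambda>C. \<Sum>A\<in>Pow C. shuffle_sign A (C - A) * coeff g A * coeff h (C - A))"

instance
proof
  fix f g h :: "'a grass" and r :: real
  show "f * g * h = f * (g * h)"
  proof (rule grass_eqI)
    fix C
    have fin: "finite (X :: 'a set)" for X by (rule finite_subset [OF subset_UNIV]) simp
    have "coeff (f * g * h) C = (\<Sum>(A, D)\<in>(SIGMA A:Pow C. Pow A).
        shuffle_sign A (C - A) * (shuffle_sign D (A - D) * coeff f D * coeff g (A - D)) * coeff h (C - A))"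
      by (subst sum.Sigma [symmetric])
        (auto simp: times_grass_def sum_distrib_left sum_distrib_right fin)
    also have "\<dots> = (\<Sum>(D, E)\<in>(SIGMA D:Pow C. Pow (C - D)).
        shuffle_sign D (C - D) * coeff f D * (shuffle_sign E (C - D - E) * coeff g E * coeff h (C - D - E)))"
    proof (rule sum.reindex_bij_witness [where i = "\<lambda>(D, E). (D \<union> E, D)" and j = "\<lambda>(A, D). (D, A - D)"],
        goal_cases)
      case (5 p)
      then obtain A D where p: "p = (A, D)" and sub: "A \<subseteq> C" "D \<subseteq> A" by auto
      have 1: "shuffle_sign A (C - A) = shuffle_sign D (C - A) * shuffle_sign (A - D) (C - A)"
        using shuffle_sign_Un_left [of D "A - D" "C - A"] sub by (simp add: Un_absorb1)
      have "C - D = (A - D) \<union> (C - A)" using sub by auto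
      then have 2: "shuffle_sign D (C - D) = shuffle_sign D (A - D) * shuffle_sign D (C - A)"
        using shuffle_sign_Un_right [of "A - D" "C - A" D] by auto
      have 3: "C - D - (A - D) = C - A" using sub by auto
      show ?case by (simp add: p 1 2 3)
    qed auto
    also have "\<dots> = coeff (f * (g * h)) C"
      by (subst sum.Sigma [symmetric])
        (auto simp: times_grass_def sum_distrib_left fin)
    finally show "coeff (f * g * h) C = coeff (f * (g * h)) C" .
  qed
  show "1 * g = g"
  proof (rule grass_eqI)
    fix C
    have "coeff (1 * g) C = (\<Sum>A\<in>Pow C. if A = {} then coeff g C else 0)"
      unfolding times_grass_def one_grass_def coeff_Grass by (intro sum.cong) auto
    also have "\<dots> = coeff g C"
      by (subst sum.delta) (auto intro: finite_subset [OF subset_UNIV])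
    finally show "coeff (1 * g) C = coeff g C" .
  qed
  show "g * 1 = g"
  proof (rule grass_eqI)
    fix C
    have "coeff (g * 1) C = (\<Sum>A\<in>Pow C. if A = C then coeff g C else 0)"
      unfolding times_grass_def one_grass_def coeff_Grass by (intro sum.cong) auto
    also have "\<dots> = coeff g C"
      by (subst sum.delta) (auto intro: finite_subset [OF subset_UNIV])
    finally show "coeff (g * 1) C = coeff g C" .
  qed
  show "(0::'a grass) \<noteq> 1"
  proof
    assume "(0::'a grass) = 1"
    then have "coeff (0::'a grass) {} = coeff 1 {}" by (rule arg_cong)
    then show False by (simp add: one_grass_def)
  qed
qed (auto intro!: grass_eqI simp: times_grass_def algebra_simps sum.distrib sum_distrib_left)

end

text \<open>
  The \<open>\<ell>\<^sup>1\<close> norm makes the Grassmann algebra a Banach algebra, so that \<^const>\<open>exp\<close> and the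
  derivatives of Grassmann-valued functions are those of the library.
\<close>

instantiation grass :: ("{finite,linorder}") real_normed_algebra_1
begin

definition "norm g = (\<Sum>A\<in>UNIV. \<bar>coeff g A\<bar>)"
definition "sgn g = inverse (norm g) *\<^sub>R (g :: 'a grass)"
definition "dist g h = norm (g - h :: 'a grass)"
definition "uniformity = (INF e\<in>{0<..}. principal {(g, h :: 'a grass). dist g h < e})"
definition "open (U :: 'a grass set) \<longleftrightarrow> (\<forall>g\<in>U. eventually (\<lambda>(g', h). g' = g \<longrightarrow> h \<in> U) uniformity)"

instance
proof
  fix g h :: "'a grass" and r :: real and U :: "'a grass set"
  show "dist g h = norm (g - h)" by (rule dist_grass_def)
  show "sgn g = inverse (norm g) *\<^sub>R g" by (rule sgn_grass_def)
  show "uniformity = (INF e\<in>{0<..}. principal {(g, h :: 'a grass). dist g h < e})"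
    by (rule uniformity_grass_def)
  show "open U \<longleftrightarrow> (\<forall>g\<in>U. eventually (\<lambda>(g', h). g' = g \<longrightarrow> h \<in> U) uniformity)"
    by (rule open_grass_def)
  show "norm g = 0 \<longleftrightarrow> g = 0"
    by (auto simp: norm_grass_def sum_nonneg_eq_0_iff intro: grass_eqI)
  show "norm (g + h) \<le> norm g + norm h"
    by (auto simp: norm_grass_def sum.distrib [symmetric] intro!: sum_mono)
  show "norm (r *\<^sub>R g) = \<bar>r\<bar> * norm g"
    by (simp add: norm_grass_def abs_mult sum_distrib_left)
  show "norm (1 :: 'a grass) = 1"
  proof -
    have "norm (1 :: 'a grass) = (\<Sum>A\<in>UNIV. if A = ({} :: 'a set) then 1 else 0)"
      unfolding norm_grass_def one_grass_def coeff_Grass by (intro sum.cong) auto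
    then show ?thesis by simp
  qed
  show "norm (g * h) \<le> norm g * norm h"
  proof -
    have "norm (g * h) \<le> (\<Sum>C\<in>UNIV. \<Sum>A\<in>Pow C. \<bar>coeff g A\<bar> * \<bar>coeff h (C - A)\<bar>)"
      unfolding norm_grass_def times_grass_def coeff_Grass
      by (intro sum_mono order.trans [OF sum_abs]) (simp add: abs_mult)
    also have "\<dots> = (\<Sum>(C, A)\<in>(SIGMA C:UNIV. Pow C). \<bar>coeff g A\<bar> * \<bar>coeff h (C - A)\<bar>)"
      by (subst sum.Sigma) (auto intro: finite_subset [OF subset_UNIV])
    also have "\<dots> = (\<Sum>(A, B)\<in>{(A, B). A \<inter> B = {}}. \<bar>coeff g A\<bar> * \<bar>coeff h B\<bar>)"
      by (rule sum.reindex_bij_witness [where i = "\<lambda>(A, B). (A \<union> B, A)" and j = "\<lambda>(C, A). (A, C - A)"])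
        auto
    also have "\<dots> \<le> (\<Sum>(A, B)\<in>UNIV \<times> UNIV. \<bar>coeff g A\<bar> * \<bar>coeff h B\<bar>)"
      by (intro sum_mono2) auto
    also have "\<dots> = norm g * norm h"
      by (simp add: norm_grass_def sum_product sum.cartesian_product)
    finally show ?thesis .
  qed
qed

end

lemma abs_coeff_le_norm: "\<bar>coeff g A\<bar> \<le> norm g"
  unfolding norm_grass_def by (rule member_le_sum) auto

instance grass :: ("{finite,linorder}") banach
proof
  fix X :: "nat \<Rightarrow> 'a grass"
  assume X: "Cauchy X"
  have "Cauchy (\<lambda>n. coeff (X n) A)" for A
    unfolding Cauchy_def
  proof (intro allI impI)
    fix e :: real
    assume "e > 0"
    then obtain M where "\<forall>m\<ge>M. \<forall>n\<ge>M. norm (X m - X n) < e"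
      using X by (auto simp: Cauchy_def dist_norm)
    then show "\<exists>M. \<forall>m\<ge>M. \<forall>n\<ge>M. dist (coeff (X m) A) (coeff (X n) A) < e"
      by (metis abs_coeff_le_norm coeff_linear(4) dist_real_def order.strict_trans1)
  qed
  then have lim: "(\<lambda>n. coeff (X n) A) \<longlonglongrightarrow> lim (\<lambda>n. coeff (X n) A)" for A
    using Cauchy_convergent convergent_LIMSEQ_iff by blast
  define L where "L = Grass (\<lambda>A. lim (\<lambda>n. coeff (X n) A))"
  have "(\<lambda>n. norm (X n - L)) \<longlonglongrightarrow> (\<Sum>A\<in>UNIV. \<bar>lim (\<lambda>n. coeff (X n) A) - coeff L A\<bar>)"
    unfolding norm_grass_def coeff_linear by (intro tendsto_intros lim)
  then have "(\<lambda>n. norm (X n - L)) \<longlonglongrightarrow> 0"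
    by (simp add: L_def)
  then have "X \<longlonglongrightarrow> L"
    using LIM_zero_cancel tendsto_norm_zero_iff by blast
  then show "convergent X"
    by (auto simp: convergent_def)
qed

instantiation grass :: ("{finite,linorder}") inverse
begin

definition "inverse (g :: 'a grass) = (THE h. g * h = 1 \<and> h * g = 1)"
definition "g div h = g * inverse (h :: 'a grass)"

instance ..

end

definition theta :: "'i \<Rightarrow> 'i grass" where
  "theta a = Grass (\<lambda>A. if A = {a} then 1 else 0)"

definition body :: "'i grass \<Rightarrow> real" where
  "body g = coeff g {}"

text \<open>Parities are natural numbers, read modulo 2, so that signs are written \<open>(-1) ^ n\<close>.\<close>

definition homogeneous :: "nat \<Rightarrow> 'i grass \<Rightarrow> bool" where
  "homogeneous e g \<longleftrightarrow> (\<forall>A. coeff g A \<noteq> 0 \<longrightarrow> even (card A + e))"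

definition homogeneous_part :: "nat \<Rightarrow> 'i grass \<Rightarrow> 'i grass" where
  "homogeneous_part e g = Grass (\<lambda>A. if even (card A + e) then coeff g A else 0)"

text \<open>The left derivative with respect to \<open>\<theta>\<^sub>a\<close>: move \<open>\<theta>\<^sub>a\<close> to the left and remove it.\<close>

definition dtheta :: "'i::linorder \<Rightarrow> 'i grass \<Rightarrow> 'i grass" where
  "dtheta a g = Grass (\<lambda>A. if a \<in> A then 0 else (-1) ^ card {b\<in>A. b < a} * coeff g (insert a A))"

text \<open>Substitution \<open>\<theta>\<^sub>a \<mapsto> v a\<close>.\<close>

definition grass_subst :: "('i \<Rightarrow> 'j grass) \<Rightarrow> 'i::{finite,linorder} grass \<Rightarrow> 'j::{finite,linorder} grass" where
  "grass_subst v g = (\<Sum>A\<in>UNIV. coeff g A *\<^sub>R prod_list (map v (sorted_list_of_set A)))"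


section \<open>Superdomains\<close>

text \<open>
  The coordinates of a superdomain are indexed by a finite type \<open>'i\<close>; the coordinate \<open>x\<^sup>a\<close> has
  parity \<open>par a\<close> (modulo 2).  Points of the underlying domain are vectors in \<open>real ^ 'i\<close> whose
  components at odd indices vanish.  A superfunction \<open>\<Sum>A. f\<^sub>A(x) \<theta>\<^sub>A\<close>, \<open>A\<close> a set of odd
  indices, is regarded as the function from the points to the Grassmann algebra; its values
  outside the domain are irrelevant.
\<close>

type_synonym 'i point = "real ^ 'i"

type_synonym 'i superfun = "'i point \<Rightarrow> 'i grass"

definition even_space :: "('i::finite \<Rightarrow> nat) \<Rightarrow> 'i point set" where
  "even_space par = {x. \<forall>a. odd (par a) \<longrightarrow> x $ a = 0}"

definition coord :: "('i \<Rightarrow> nat) \<Rightarrow> 'i \<Rightarrow> 'i::{finite,linorder} superfun" where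
  "coord par a = (\<lambda>x. if even (par a) then of_real (x $ a) else theta a)"

text \<open>The left partial derivative \<open>\<partial>/\<partial>x\<^sup>a\<close>.\<close>

definition pd :: "('i \<Rightarrow> nat) \<Rightarrow> 'i \<Rightarrow> 'i::{finite,linorder} superfun \<Rightarrow> 'i superfun" where
  "pd par a f = (\<lambda>x. if even (par a)
     then vector_derivative (\<lambda>t. f (x + t *\<^sub>R axis a 1)) (at 0) else dtheta a (f x))"

text \<open>Smooth superfunctions on \<open>V\<close>, a relatively open subset of \<open>even_space par\<close>.\<close>

definition superfun_on :: "('i \<Rightarrow> nat) \<Rightarrow> 'i point set \<Rightarrow> 'i::{finite,linorder} superfun \<Rightarrow> bool" where
  "superfun_on par V f \<longleftrightarrow>
     (\<forall>x\<in>V. \<forall>A. coeff (f x) A \<noteq> 0 \<longrightarrow> (\<forall>a\<in>A. odd (par a))) \<and>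
     (\<forall>w. (\<forall>a\<in>set w. even (par a)) \<longrightarrow>
        continuous_on V (foldr (pd par) w f) \<and>
        (\<forall>x\<in>V. \<forall>a. even (par a) \<longrightarrow>
           (\<lambda>t. foldr (pd par) w f (x + t *\<^sub>R axis a 1)) differentiable at 0))"

definition hom_superfun_on :: "('i \<Rightarrow> nat) \<Rightarrow> 'i point set \<Rightarrow> nat \<Rightarrow> 'i::{finite,linorder} superfun \<Rightarrow> bool" where
  "hom_superfun_on par V e f \<longleftrightarrow> superfun_on par V f \<and> (\<forall>x\<in>V. homogeneous e (f x))"

text \<open>
  A morphism of superdomains is given by the pullbacks \<open>\<phi> a\<close> of the coordinate functions, of
  parity \<open>par a\<close>.  Pullback of a general superfunction substitutes \<open>\<phi>\<close> for the coordinates, by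
  Taylor expansion in the nilpotent parts of the even \<open>\<phi> a\<close>.  These are even, and a product of
  more than \<open>CARD('i)\<close> of them vanishes.
\<close>

definition body_map :: "('i \<Rightarrow> nat) \<Rightarrow> ('i \<Rightarrow> 'i superfun) \<Rightarrow> 'i point \<Rightarrow> 'i::{finite,linorder} point" where
  "body_map par \<phi> x = (\<chi> a. if even (par a) then body (\<phi> a x) else 0)"

definition pullback :: "('i \<Rightarrow> nat) \<Rightarrow> ('i \<Rightarrow> 'i superfun) \<Rightarrow> 'i superfun \<Rightarrow> 'i::{finite,linorder} superfun" where
  "pullback par \<phi> f x =
     (\<Sum>n\<le>CARD('i). \<Sum>w | length w = n \<and> (\<forall>a\<in>set w. even (par a)).
        (1 / fact n) *\<^sub>R (prod_list (map (\<lambda>a. \<phi> a x - of_real (body (\<phi> a x))) w) *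
          grass_subst (\<lambda>a. \<phi> a x) (foldr (pd par) w f (body_map par \<phi> x))))"

text \<open>
  The Berezinian \<open>det (A - B D\<^sup>-\<^sup>1 C) / det D\<close> of an even supermatrix with blocks
  \<open>A\<close>, \<open>B\<close>, \<open>C\<close>, \<open>D\<close> indexed by even/even, even/odd, odd/even, odd/odd indices.  The two
  determinants have even, hence commuting, entries.
\<close>

definition det_on :: "'i set \<Rightarrow> ('i \<Rightarrow> 'i \<Rightarrow> 'i grass) \<Rightarrow> 'i::{finite,linorder} grass" where
  "det_on K M = (\<Sum>p | p permutes K. of_int (sign p) * prod_list (map (\<lambda>a. M a (p a)) (sorted_list_of_set K)))"

definition is_inverse_on :: "'i set \<Rightarrow> ('i \<Rightarrow> 'i \<Rightarrow> 'i grass) \<Rightarrow> ('i \<Rightarrow> 'i \<Rightarrow> 'i::{finite,linorder} grass) \<Rightarrow> bool" where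
  "is_inverse_on K M N \<longleftrightarrow>
     (\<forall>a\<in>K. \<forall>c\<in>K. (\<Sum>b\<in>K. M a b * N b c) = of_bool (a = c) \<and>
                     (\<Sum>b\<in>K. N a b * M b c) = of_bool (a = c))"

definition Ber :: "('i \<Rightarrow> nat) \<Rightarrow> ('i \<Rightarrow> 'i \<Rightarrow> 'i grass) \<Rightarrow> 'i::{finite,linorder} grass" where
  "Ber par J =
     (let E = {a. even (par a)}; D = {a. odd (par a)}; N = (SOME N. is_inverse_on D J N)
      in det_on E (\<lambda>a b. J a b - (\<Sum>c\<in>D. \<Sum>d\<in>D. J a c * N c d * J d b)) / det_on D J)"


section \<open>Supermanifolds\<close>

text \<open>
  A supermanifold is given by an atlas: charts on the underlying space, together with changes of
  coordinates.  \<open>trans M c d a\<close> is the coordinate \<open>x\<^sup>a\<close> of the chart \<open>d\<close> as a superfunction of the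
  coordinates of the chart \<open>c\<close>.
\<close>

record ('p, 'c, 'i) supermanifold =
  base :: "'p topology"
  parity :: "'i \<Rightarrow> nat"
  charts :: "'c set"
  patch :: "'c \<Rightarrow> 'p set"
  chart :: "'c \<Rightarrow> 'p \<Rightarrow> 'i point"
  trans :: "'c \<Rightarrow> 'c \<Rightarrow> 'i \<Rightarrow> 'i superfun"

definition chart_range :: "('p, 'c, 'i::finite) supermanifold \<Rightarrow> 'c \<Rightarrow> 'i point set" where
  "chart_range M c = chart M c ` patch M c"

definition overlap :: "('p, 'c, 'i::finite) supermanifold \<Rightarrow> 'c \<Rightarrow> 'c \<Rightarrow> 'i point set" where
  "overlap M c d = chart M c ` (patch M c \<inter> patch M d)"

definition is_supermanifold :: "('p, 'c, 'i::{finite,linorder}) supermanifold \<Rightarrow> bool" where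
  "is_supermanifold M \<longleftrightarrow>
     Hausdorff_space (base M) \<and> second_countable (base M) \<and>
     topspace (base M) = (\<Union>c\<in>charts M. patch M c) \<and>
     (\<forall>c\<in>charts M.
        openin (base M) (patch M c) \<and>
        openin (top_of_set (even_space (parity M))) (chart_range M c) \<and>
        homeomorphic_map (subtopology (base M) (patch M c)) (top_of_set (chart_range M c)) (chart M c)) \<and>
     (\<forall>c\<in>charts M. \<forall>d\<in>charts M.
        (\<forall>a. hom_superfun_on (parity M) (overlap M c d) (parity M a) (trans M c d a)) \<and>
        (\<forall>p\<in>patch M c \<inter> patch M d. body_map (parity M) (trans M c d) (chart M c p) = chart M d p)) \<and>
     (\<forall>c\<in>charts M. \<forall>a. \<forall>x\<in>chart_range M c. trans M c c a x = coord (parity M) a x) \<and>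
     (\<forall>c\<in>charts M. \<forall>d\<in>charts M. \<forall>e\<in>charts M. \<forall>a.
        \<forall>x\<in>chart M c ` (patch M c \<inter> patch M d \<inter> patch M e).
          trans M c e a x = pullback (parity M) (trans M c d) (trans M d e a) x)"

text \<open>
  A global object on \<open>M\<close> is the family of its representatives in the charts.  Operators on such
  objects are given by their expressions in local coordinates.
\<close>

type_synonym ('c, 'i) local_family = "'c \<Rightarrow> 'i superfun"

definition agree_on :: "('p, 'c, 'i::{finite,linorder}) supermanifold \<Rightarrow> ('c, 'i) local_family \<Rightarrow> ('c, 'i) local_family \<Rightarrow> bool" where
  "agree_on M f g \<longleftrightarrow> (\<forall>c\<in>charts M. \<forall>x\<in>chart_range M c. f c x = g c x)"

definition is_function :: "('p, 'c, 'i::{finite,linorder}) supermanifold \<Rightarrow> ('c, 'i) local_family \<Rightarrow> bool" where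
  "is_function M f \<longleftrightarrow>
     (\<forall>c\<in>charts M. superfun_on (parity M) (chart_range M c) (f c)) \<and>
     (\<forall>c\<in>charts M. \<forall>d\<in>charts M. \<forall>x\<in>overlap M c d. f c x = pullback (parity M) (trans M c d) (f d) x)"

definition is_even_function :: "('p, 'c, 'i::{finite,linorder}) supermanifold \<Rightarrow> ('c, 'i) local_family \<Rightarrow> bool" where
  "is_even_function M f \<longleftrightarrow>
     is_function M f \<and> (\<forall>c\<in>charts M. \<forall>x\<in>chart_range M c. homogeneous 0 (f c x))"


section \<open>Odd Poisson structures\<close>

text \<open>
  Functions on the cotangent bundle are treated in the coordinates \<open>x\<^sup>a\<close> (index \<open>Pos a\<close>) and
  \<open>p\<^sub>a\<close> (index \<open>Mom a\<close>); \<open>p\<^sub>a\<close> has the parity of \<open>x\<^sup>a\<close>.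
\<close>

datatype 'i phase = Pos 'i | Mom 'i

lemma UNIV_phase: "(UNIV :: 'i phase set) = range Pos \<union> range Mom"
proof -
  have "u \<in> range Pos \<union> range Mom" for u :: "'i phase"
    by (cases u) auto
  then show ?thesis by blast
qed

instance phase :: (finite) finite
  by standard (simp add: UNIV_phase)

instantiation phase :: (linorder) linorder
begin

fun less_eq_phase :: "'a phase \<Rightarrow> 'a phase \<Rightarrow> bool" where
  "Pos a \<le> Pos b \<longleftrightarrow> a \<le> b"
| "Mom a \<le> Mom b \<longleftrightarrow> a \<le> b"
| "Pos a \<le> Mom b \<longleftrightarrow> True"
| "Mom a \<le> Pos b \<longleftrightarrow> False"

definition less_phase :: "'a phase \<Rightarrow> 'a phase \<Rightarrow> bool" where
  "less_phase u v \<longleftrightarrow> u \<le> v \<and> \<not> v \<le> u"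

instance
proof
  fix u v w :: "'a phase"
  show "u < v \<longleftrightarrow> u \<le> v \<and> \<not> v \<le> u" by (rule less_phase_def)
  show "u \<le> u" by (cases u) auto
  show "u \<le> v \<Longrightarrow> v \<le> w \<Longrightarrow> u \<le> w" by (cases u; cases v; cases w) auto
  show "u \<le> v \<Longrightarrow> v \<le> u \<Longrightarrow> u = v" by (cases u; cases v) auto
  show "u \<le> v \<or> v \<le> u" by (cases u; cases v) auto
qed

end

definition cotangent_par :: "('i \<Rightarrow> nat) \<Rightarrow> 'i phase \<Rightarrow> nat" where
  "cotangent_par par = case_phase par par"

definition proj :: "'i phase point \<Rightarrow> 'i::finite point" where
  "proj z = (\<chi> a. z $ Pos a)"

definition cotangent :: "('i \<Rightarrow> nat) \<Rightarrow> 'i point set \<Rightarrow> 'i::finite phase point set" where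
  "cotangent par V = {z\<in>even_space (cotangent_par par). proj z \<in> V}"

text \<open>A superfunction of \<open>x\<close> as a superfunction of \<open>x\<close> and \<open>p\<close>.\<close>

definition lift :: "'i superfun \<Rightarrow> 'i::{finite,linorder} phase superfun" where
  "lift f z = grass_subst (\<lambda>a. theta (Pos a)) (f (proj z))"

text \<open>The function \<open>1/2 S\<^sup>a\<^sup>b p\<^sub>b p\<^sub>a\<close> on the cotangent bundle.\<close>

definition schouten_fun :: "('i \<Rightarrow> nat) \<Rightarrow> ('i \<Rightarrow> 'i \<Rightarrow> 'i superfun) \<Rightarrow> 'i::{finite,linorder} phase superfun" where
  "schouten_fun par S z =
     (1/2) *\<^sub>R (\<Sum>a\<in>UNIV. \<Sum>b\<in>UNIV. lift (S a b) z *
       coord (cotangent_par par) (Mom b) z * coord (cotangent_par par) (Mom a) z)"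

text \<open>
  The canonical even Poisson bracket \<open>(F, G)\<close> for \<open>F\<close> of parity \<open>e\<close>, in the normalization for
  which \<open>(f, (S, g))\<close> is the odd bracket \<open>{f, g}\<close> given below.
\<close>

definition canonical_bracket :: "('i \<Rightarrow> nat) \<Rightarrow> nat \<Rightarrow> 'i phase superfun \<Rightarrow> 'i phase superfun \<Rightarrow> 'i::{finite,linorder} phase superfun" where
  "canonical_bracket par e F G z =
     (\<Sum>a\<in>UNIV.
        (-1) ^ (par a * (e + 1)) * pd (cotangent_par par) (Mom a) F z * pd (cotangent_par par) (Pos a) G z
      - (-1) ^ (par a * e) * pd (cotangent_par par) (Pos a) F z * pd (cotangent_par par) (Mom a) G z)"

text \<open>
  \<open>S c a b\<close> are the components \<open>S\<^sup>a\<^sup>b\<close> in the chart \<open>c\<close>.  Their transformation law expresses that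
  \<open>1/2 S\<^sup>a\<^sup>b p\<^sub>b p\<^sub>a\<close> is invariant under \<open>p\<^sub>a = (\<partial>x'\<^sup>a\<^sup>'/\<partial>x\<^sup>a) p'\<^sub>a\<^sub>'\<close>; the sign comes from
  exchanging \<open>p'\<^sub>b\<^sub>'\<close> with \<open>\<partial>x'\<^sup>a\<^sup>'/\<partial>x\<^sup>a\<close>.
\<close>

definition is_odd_poisson :: "('p, 'c, 'i::{finite,linorder}) supermanifold \<Rightarrow> ('c \<Rightarrow> 'i \<Rightarrow> 'i \<Rightarrow> 'i superfun) \<Rightarrow> bool" where
  "is_odd_poisson M S \<longleftrightarrow>
     (\<forall>c\<in>charts M. \<forall>a b.
        hom_superfun_on (parity M) (chart_range M c) (parity M a + parity M b + 1) (S c a b) \<and>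
        (\<forall>x\<in>chart_range M c. S c a b x = (-1) ^ (parity M a * parity M b) * S c b a x)) \<and>
     (\<forall>c\<in>charts M. \<forall>d\<in>charts M. \<forall>a' b'. \<forall>x\<in>overlap M c d.
        pullback (parity M) (trans M c d) (S d a' b') x =
          (\<Sum>a\<in>UNIV. \<Sum>b\<in>UNIV. (-1) ^ (parity M b' * (parity M a + parity M a')) * S c a b x *
             pd (parity M) b (trans M c d b') x * pd (parity M) a (trans M c d a') x)) \<and>
     (\<forall>c\<in>charts M. \<forall>z\<in>cotangent (parity M) (chart_range M c).
        canonical_bracket (parity M) 1 (schouten_fun (parity M) (S c)) (schouten_fun (parity M) (S c)) z = 0)"

text \<open>The odd bracket \<open>{f, g}\<close> and the Hamiltonian vector field of \<open>f\<close>, for \<open>f\<close> of parity \<open>e\<close>.\<close>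

definition odd_bracket :: "('p, 'c, 'i::{finite,linorder}) supermanifold \<Rightarrow> ('c \<Rightarrow> 'i \<Rightarrow> 'i \<Rightarrow> 'i superfun) \<Rightarrow> nat \<Rightarrow> ('c, 'i) local_family \<Rightarrow> ('c, 'i) local_family \<Rightarrow> ('c, 'i) local_family" where
  "odd_bracket M S e f g c x =
     (\<Sum>a\<in>UNIV. \<Sum>b\<in>UNIV. - ((-1) ^ (e * (parity M a + 1)) * S c a b x *
        pd (parity M) b (f c) x * pd (parity M) a (g c) x))"

definition ham_vf :: "('p, 'c, 'i::{finite,linorder}) supermanifold \<Rightarrow> ('c \<Rightarrow> 'i \<Rightarrow> 'i \<Rightarrow> 'i superfun) \<Rightarrow> nat \<Rightarrow> ('c, 'i) local_family \<Rightarrow> 'c \<Rightarrow> 'i \<Rightarrow> 'i superfun" where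
  "ham_vf M S e f c a x = (\<Sum>b\<in>UNIV. (-1) ^ (parity M a * e) * S c a b x * pd (parity M) b (f c) x)"

text \<open>The action on functions of the vector field with components \<open>X c a\<close> in the chart \<open>c\<close>.\<close>

definition vf_apply :: "('p, 'c, 'i::{finite,linorder}) supermanifold \<Rightarrow> ('c \<Rightarrow> 'i \<Rightarrow> 'i superfun) \<Rightarrow> ('c, 'i) local_family \<Rightarrow> ('c, 'i) local_family" where
  "vf_apply M X f c x = (\<Sum>a\<in>UNIV. X c a x * pd (parity M) a (f c) x)"


section \<open>Volume forms and the odd Laplace operator\<close>

text \<open>
  A volume form is \<open>\<rho> c Dx\<close> in the chart \<open>c\<close>, where \<open>Dx' = Dx Ber(\<partial>x'/\<partial>x)\<close>.
\<close>

definition is_nondeg_volume :: "('p, 'c, 'i::{finite,linorder}) supermanifold \<Rightarrow> ('c, 'i) local_family \<Rightarrow> bool" where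
  "is_nondeg_volume M \<rho> \<longleftrightarrow>
     (\<forall>c\<in>charts M. hom_superfun_on (parity M) (chart_range M c) 0 (\<rho> c) \<and>
        (\<exists>r. superfun_on (parity M) (chart_range M c) r \<and>
           (\<forall>x\<in>chart_range M c. \<rho> c x * r x = 1 \<and> r x * \<rho> c x = 1))) \<and>
     (\<forall>c\<in>charts M. \<forall>d\<in>charts M. \<forall>x\<in>overlap M c d.
        \<rho> c x = pullback (parity M) (trans M c d) (\<rho> d) x *
          Ber (parity M) (\<lambda>a b. pd (parity M) a (trans M c d b) x))"

text \<open>The divergence of the vector field \<open>X\<close> of parity \<open>e\<close>.\<close>

definition divergence :: "('p, 'c, 'i::{finite,linorder}) supermanifold \<Rightarrow> ('c, 'i) local_family \<Rightarrow> nat \<Rightarrow> ('c \<Rightarrow> 'i \<Rightarrow> 'i superfun) \<Rightarrow> ('c, 'i) local_family" where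
  "divergence M \<rho> e X c x =
     1 / \<rho> c x * (\<Sum>a\<in>UNIV. (-1) ^ (parity M a * (e + 1)) * pd (parity M) a (\<lambda>y. \<rho> c y * X c a y) x)"

text \<open>
  \<open>\<Delta>\<^sub>\<rho> f = div\<^sub>\<rho> X\<^sub>f\<close> for homogeneous \<open>f\<close>, extended to all functions by additivity.
  The two signs cancel and give \<open>1/\<rho> \<partial>\<^sub>a (\<rho> S\<^sup>a\<^sup>b \<partial>\<^sub>b f)\<close> in either parity.
\<close>

definition laplace :: "('p, 'c, 'i::{finite,linorder}) supermanifold \<Rightarrow> ('c \<Rightarrow> 'i \<Rightarrow> 'i \<Rightarrow> 'i superfun) \<Rightarrow> ('c, 'i) local_family \<Rightarrow> ('c, 'i) local_family \<Rightarrow> ('c, 'i) local_family" where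
  "laplace M S \<rho> f c x =
     (\<Sum>e\<in>{0, 1}. divergence M \<rho> (e + 1) (ham_vf M S e (\<lambda>c x. homogeneous_part e (f c x))) c x)"

text \<open>\<open>\<rho>' = e\<^sup>\<sigma> \<rho>\<close> with \<open>\<sigma>\<close> an even function.\<close>

definition is_log_ratio :: "('p, 'c, 'i::{finite,linorder}) supermanifold \<Rightarrow> ('c, 'i) local_family \<Rightarrow> ('c, 'i) local_family \<Rightarrow> ('c, 'i) local_family \<Rightarrow> bool" where
  "is_log_ratio M \<rho>' \<rho> \<sigma> \<longleftrightarrow> is_even_function M \<sigma> \<and> agree_on M \<rho>' (\<lambda>c x. exp (\<sigma> c x) * \<rho> c x)"

text \<open>
  \<open>H(\<rho>', \<rho>)\<close> as a function of the pair of volume forms.  The function \<open>\<sigma>\<close> is determined by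
  \<open>\<rho>' = e\<^sup>\<sigma> \<rho>\<close> on the charts (but not by its irrelevant values outside them).
\<close>

definition H_fun :: "('p, 'c, 'i::{finite,linorder}) supermanifold \<Rightarrow> ('c \<Rightarrow> 'i \<Rightarrow> 'i \<Rightarrow> 'i superfun) \<Rightarrow> ('c, 'i) local_family \<Rightarrow> ('c, 'i) local_family \<Rightarrow> ('c, 'i) local_family" where
  "H_fun M S \<rho>' \<rho> =
     (let \<sigma> = (SOME \<sigma>. is_log_ratio M \<rho>' \<rho> \<sigma>)
      in (\<lambda>c x. laplace M S \<rho> \<sigma> c x - (1/2) *\<^sub>R odd_bracket M S 0 \<sigma> \<sigma> c x))"

end

theory Submission
  imports Defs "HOL-Library.Function_Algebras"
begin

text \<open>
  All claims are local in a chart.  By the Leibniz rule \<open>\<Delta>\<^sub>\<rho>\<^sub>' = \<Delta>\<^sub>\<rho> + X\<^sub>\<sigma>\<close>, hence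
  \<open>\<Delta>\<^sub>\<rho>\<^sub>'\<^sup>2 = \<Delta>\<^sub>\<rho>\<^sup>2 + (\<Delta>\<^sub>\<rho> X\<^sub>\<sigma> + X\<^sub>\<sigma> \<Delta>\<^sub>\<rho>) + X\<^sub>\<sigma>\<^sup>2\<close>.  Third derivatives of \<open>(S, S) = 0\<close> along the
  momenta give the Jacobi identity for the components \<open>S\<^sup>a\<^sup>b\<close>, and therefore
  \<open>[X\<^sub>\<sigma>, X\<^sub>f] = X\<^sub>{\<^sub>\<sigma>\<^sub>,\<^sub>f\<^sub>}\<close>.  With \<open>f = \<sigma>\<close> this reads \<open>2 X\<^sub>\<sigma>\<^sup>2 = X\<^sub>{\<^sub>\<sigma>\<^sub>,\<^sub>\<sigma>\<^sub>}\<close>.  The divergence of a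
  commutator \<open>[V, W]\<close> is \<open>V div W - (-1)\<^sup>V\<^sup>W W div V\<close>, so taking divergences gives
  \<open>\<Delta>\<^sub>\<rho> X\<^sub>\<sigma> + X\<^sub>\<sigma> \<Delta>\<^sub>\<rho> = - X\<^sub>h\<close> with \<open>h = \<Delta>\<^sub>\<rho> \<sigma>\<close>.  The cocycle conditions follow from
  \<open>\<Delta>\<^sub>\<rho>\<^sub>' = \<Delta>\<^sub>\<rho> + X\<^sub>\<sigma>\<close> and the symmetry of the bracket of even functions.
\<close>

section \<open>Graded commutative algebras with derivations\<close>

text \<open>The algebra is separated from the analysis: the identities are proved in locales about
  an abstract graded ring with derivations, and a chart instantiates them with superfunctions set to
  zero outside the chart range. This model shapes the locales. Derivatives of functions that are not
  smooth are arbitrary, so linearity, the Leibniz rule and commutation are demanded only on the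
  homogeneous parts \<open>A n\<close>. The constant function 1 need not be a section, so the ring
  has no distinguished unit: signs are the operation \<open>sg\<close> instead of powers of -1, and
  inverse densities are specified by how they act on homogeneous elements. Division by 2 is not part
  of the ring structure, so identities with a factor 1/2 are proved doubled and then cancelled. On
  the cotangent bundle even momenta are real coordinates and odd momenta are generators; derivatives
  along the momenta treat both alike, which is why coefficients are read off by differentiation.
  Since \<open>H_fun\<close> picks a logarithm of the ratio by choice, its values become computable
  only after \<open>exp\<close> is known to be injective on even elements.\<close>

definition sg :: "nat \<Rightarrow> 'a::ab_group_add \<Rightarrow> 'a" where
  "sg n x = (if even n then x else - x)"

lemma sg_simps [simp]:
  "sg 0 x = x" "sg (Suc 0) x = - x" "sg m (sg n x) = sg (m + n) x" "sg n (- x) = - sg n x"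
  "sg n 0 = 0"
  by (auto simp: sg_def)

lemma sg_add: "sg n (x + y) = sg n x + sg n y"
  by (simp add: sg_def)

lemma sg_diff: "sg n (x - y) = sg n x - sg n y"
  by (simp add: sg_def)

lemma sg_sum: "sg n (sum f I) = (\<Sum>i\<in>I. sg n (f i))"
  by (simp add: sg_def sum_negf)

lemma sg_mult [simp]:
  "sg n x * y = sg n (x * y)" "x * sg n y = sg n (x * y)" for x y :: "'a::ring"
  by (auto simp: sg_def)

lemma sg_eq_0_iff [simp]: "sg n x = 0 \<longleftrightarrow> x = 0"
  by (simp add: sg_def)

lemma sg_cong: "even (m + n) \<Longrightarrow> sg m x = sg n x"
  by (auto simp: sg_def)

lemma sg_cong_minus: "odd (m + n) \<Longrightarrow> sg m x = - sg n x"
  by (auto simp: sg_def)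

lemma sg_eq_power: "sg n x = (-1) ^ n * x" for x :: "'a::ring_1"
  by (simp add: sg_def minus_one_power_iff)

text \<open>
  \<open>A n\<close> consists of the elements of parity \<open>n\<close>; nothing is assumed about the elements of the
  ring that are not homogeneous.
\<close>

locale superdiff =
  fixes par :: "'i::finite \<Rightarrow> nat" and A :: "nat \<Rightarrow> 'a::ring set" and D :: "'i \<Rightarrow> 'a \<Rightarrow> 'a"
  assumes A_zero [simp]: "0 \<in> A n"
    and A_add: "f \<in> A n \<Longrightarrow> g \<in> A n \<Longrightarrow> f + g \<in> A n"
    and A_uminus: "f \<in> A n \<Longrightarrow> - f \<in> A n"
    and A_parity: "f \<in> A m \<Longrightarrow> even (m + n) \<Longrightarrow> f \<in> A n"
    and A_mult: "f \<in> A m \<Longrightarrow> g \<in> A n \<Longrightarrow> f * g \<in> A (m + n)"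
    and A_commute: "f \<in> A m \<Longrightarrow> g \<in> A n \<Longrightarrow> f * g = sg (m * n) (g * f)"
    and D_in: "f \<in> A n \<Longrightarrow> D a f \<in> A (n + par a)"
    and D_add: "f \<in> A n \<Longrightarrow> g \<in> A n \<Longrightarrow> D a (f + g) = D a f + D a g"
    and D_mult: "f \<in> A m \<Longrightarrow> g \<in> A n \<Longrightarrow> D a (f * g) = D a f * g + sg (par a * m) (f * D a g)"
    and D_commute: "f \<in> A n \<Longrightarrow> D a (D b f) = sg (par a * par b) (D b (D a f))"
begin

lemma A_sg: "f \<in> A n \<Longrightarrow> sg m f \<in> A n"
  by (simp add: sg_def A_uminus)

lemma A_sum: "(\<And>i. i \<in> I \<Longrightarrow> f i \<in> A n) \<Longrightarrow> sum f I \<in> A n"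
  by (induction I rule: infinite_finite_induct) (auto intro: A_add)

lemma D_zero [simp]: "D a 0 = 0"
  using D_add [of 0 0 0 a] by simp

lemma D_uminus: "f \<in> A n \<Longrightarrow> D a (- f) = - D a f"
  using D_add [of f n "- f" a] by (simp add: A_uminus eq_neg_iff_add_eq_0 add.commute)

lemma D_diff: "f \<in> A n \<Longrightarrow> g \<in> A n \<Longrightarrow> D a (f - g) = D a f - D a g"
  using D_add [of f n "- g" a] D_uminus [of g n a] by (simp add: A_uminus)

lemma D_sg: "f \<in> A n \<Longrightarrow> D a (sg m f) = sg m (D a f)"
  by (simp add: sg_def D_uminus)

lemma D_sum: "(\<And>i. i \<in> I \<Longrightarrow> f i \<in> A n) \<Longrightarrow> D a (sum f I) = (\<Sum>i\<in>I. D a (f i))"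
proof (induction I rule: infinite_finite_induct)
  case (insert i I)
  then show ?case by (simp add: D_add [of _ n] A_sum)
qed auto

definition vf :: "('i \<Rightarrow> 'a) \<Rightarrow> 'a \<Rightarrow> 'a" where
  "vf V f = (\<Sum>a\<in>UNIV. V a * D a f)"

definition is_vf :: "nat \<Rightarrow> ('i \<Rightarrow> 'a) \<Rightarrow> bool" where
  "is_vf v V \<longleftrightarrow> (\<forall>a. V a \<in> A (v + par a))"

text \<open>\<open>V k\<close> and \<open>W k\<close> are the values of the vector fields on the
  k-th coordinate, so this is the k-th component of the graded commutator; the coordinates
  themselves need not be ring elements.\<close>

definition commutator :: "nat \<Rightarrow> nat \<Rightarrow> ('i \<Rightarrow> 'a) \<Rightarrow> ('i \<Rightarrow> 'a) \<Rightarrow> 'i \<Rightarrow> 'a" where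
  "commutator v w V W k = vf V (W k) - sg (v * w) (vf W (V k))"

lemma is_vfD: "is_vf v V \<Longrightarrow> V a \<in> A (v + par a)"
  by (simp add: is_vf_def)

lemma vf_in:
  assumes "is_vf v V" "f \<in> A m"
  shows "vf V f \<in> A (v + m)"
  unfolding vf_def
  by (intro A_sum A_parity [OF A_mult [OF is_vfD [OF assms(1)] D_in [OF assms(2)]]]) auto

lemma vf_add: "f \<in> A m \<Longrightarrow> g \<in> A m \<Longrightarrow> vf V (f + g) = vf V f + vf V g"
  by (simp add: vf_def D_add [of f m g] distrib_left sum.distrib)

lemma vf_uminus: "f \<in> A m \<Longrightarrow> vf V (- f) = - vf V f"
  by (simp add: vf_def D_uminus [of f m] sum_negf)

lemma vf_sg: "f \<in> A m \<Longrightarrow> vf V (sg n f) = sg n (vf V f)"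
  by (simp add: sg_def vf_uminus)

lemma vf_sum: "(\<And>i. i \<in> I \<Longrightarrow> f i \<in> A n) \<Longrightarrow> vf V (sum f I) = (\<Sum>i\<in>I. vf V (f i))"
  unfolding vf_def by (simp add: D_sum [where n = n] sum_distrib_left) (rule sum.swap)

lemma vf_mult:
  assumes "is_vf v V" "f \<in> A m" "g \<in> A n"
  shows "vf V (f * g) = vf V f * g + sg (v * m) (f * vf V g)"
proof -
  have "V a * D a (f * g) = V a * D a f * g + sg (v * m) (f * (V a * D a g))" for a
  proof -
    have "V a * f = sg ((v + par a) * m) (f * V a)"
      by (rule A_commute [OF is_vfD [OF assms(1)] assms(2)])
    then have "V a * (f * D a g) = sg ((v + par a) * m) (f * (V a * D a g))"
      by (metis mult.assoc sg_mult(1))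
    then show ?thesis
      by (simp add: D_mult [OF assms(2,3)] distrib_left mult.assoc) (rule sg_cong, auto)
  qed
  then show ?thesis
    by (simp add: vf_def sum.distrib sum_distrib_left sum_distrib_right sg_sum)
qed

text \<open>Each composition is a first-order part plus second derivatives of \<open>f\<close>.
  Graded symmetry of the second derivatives makes the latter cancel, so only the components of
  \<open>commutator\<close> survive.\<close>

lemma vf_commutator:
  assumes V: "is_vf v V" and W: "is_vf w W" and f: "f \<in> A m"
  shows "vf (commutator v w V W) f = vf V (vf W f) - sg (v * w) (vf W (vf V f))"
proof -
  have *: "vf V (vf W f) = (\<Sum>b\<in>UNIV. vf V (W b) * D b f) +
      (\<Sum>b\<in>UNIV. \<Sum>a\<in>UNIV. sg (v * (w + par b)) (W b * (V a * D a (D b f))))"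
    if V: "is_vf v V" and W: "is_vf w W" for v w V W
  proof -
    have "vf V (vf W f) = (\<Sum>b\<in>UNIV. vf V (W b * D b f))"
      unfolding vf_def [of W]
      by (rule vf_sum, rule A_parity [OF A_mult [OF is_vfD [OF W] D_in [OF f]], where n = "w + m"]) auto
    then show ?thesis
      by (simp add: vf_mult [OF V is_vfD [OF W] D_in [OF f]] sum.distrib)
        (simp add: vf_def sum_distrib_left sg_sum)
  qed
  have eq: "sg (v * w) (sg (w * (v + par a)) (V a * (W b * D b (D a f)))) =
      sg (v * (w + par b)) (W b * (V a * D a (D b f)))" for a b
  proof -
    have "V a * W b = sg ((v + par a) * (w + par b)) (W b * V a)"
      by (rule A_commute [OF is_vfD [OF V] is_vfD [OF W]])
    then have "V a * (W b * D b (D a f)) = sg ((v + par a) * (w + par b)) (W b * (V a * D b (D a f)))"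
      by (metis mult.assoc sg_mult(1))
    then show ?thesis
      by (simp add: D_commute [OF f, of b a]) (rule sg_cong, auto)
  qed
  have "vf (commutator v w V W) f = (\<Sum>b\<in>UNIV. vf V (W b) * D b f) - sg (v * w) (\<Sum>b\<in>UNIV. vf W (V b) * D b f)"
    by (simp add: vf_def [of "commutator v w V W"] commutator_def left_diff_distrib sum_subtractf sg_sum)
  moreover have "sg (v * w) (\<Sum>a\<in>UNIV. \<Sum>b\<in>UNIV. sg (w * (v + par a)) (V a * (W b * D b (D a f)))) =
      (\<Sum>b\<in>UNIV. \<Sum>a\<in>UNIV. sg (v * (w + par b)) (W b * (V a * D a (D b f))))"
    unfolding sg_sum eq by (rule sum.swap)
  ultimately show ?thesis
    unfolding * [OF V W] * [OF W V] sg_add by simp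
qed

section \<open>Divergence in coordinates and its value on a commutator\<close>

definition dvg :: "nat \<Rightarrow> ('i \<Rightarrow> 'a) \<Rightarrow> 'a" where
  "dvg w W = (\<Sum>a\<in>UNIV. sg (par a * (w + 1)) (D a (W a)))"

lemma dvg_in:
  assumes "is_vf w W"
  shows "dvg w W \<in> A w"
  unfolding dvg_def
  by (intro A_sum A_sg A_parity [OF D_in [OF is_vfD [OF assms]]]) auto

text \<open>Differentiating \<open>vf V (W a)\<close> gives second derivatives of \<open>W\<close>,
  which assemble to \<open>V\<close> applied to the divergence of \<open>W\<close>, and crossed
  products of first derivatives. The crossed terms are graded symmetric in \<open>V\<close> and
  \<open>W\<close> and drop out of the difference.\<close>

lemma dvg_commutator:
  assumes V: "is_vf v V" and W: "is_vf w W"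
  shows "dvg (v + w) (commutator v w V W) = vf V (dvg w W) - sg (v * w) (vf W (dvg v V))"
proof -
  have *: "(\<Sum>a\<in>UNIV. sg (par a * (v + w + 1)) (D a (vf V (W a)))) = vf V (dvg w W) +
      (\<Sum>a\<in>UNIV. \<Sum>b\<in>UNIV. sg (par a * (v + w + 1)) (D a (V b) * D b (W a)))"
    if V: "is_vf v V" and W: "is_vf w W" for v w V W
  proof -
    have "D a (V b * D b (W a)) = D a (V b) * D b (W a) + sg (par a * v) (V b * D b (D a (W a)))" for a b
      by (simp add: D_mult [OF is_vfD [OF V] D_in [OF is_vfD [OF W]]] D_commute [OF is_vfD [OF W], of a b])
        (rule sg_cong, auto)
    moreover have "D a (vf V (W a)) = (\<Sum>b\<in>UNIV. D a (V b * D b (W a)))" for a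
      unfolding vf_def
      by (rule D_sum, rule A_parity [OF A_mult [OF is_vfD [OF V] D_in [OF is_vfD [OF W]]], where n = "v + w + par a"]) auto
    ultimately have 1: "sg (par a * (v + w + 1)) (D a (vf V (W a))) =
        (\<Sum>b\<in>UNIV. sg (par a * (v + w + 1)) (D a (V b) * D b (W a))) +
        sg (par a * (w + 1)) (vf V (D a (W a)))" for a
      by (simp add: sum.distrib sg_add sg_sum vf_def) (intro sum.cong refl sg_cong, auto)
    have 2: "vf V (dvg w W) = (\<Sum>a\<in>UNIV. sg (par a * (w + 1)) (vf V (D a (W a))))"
      unfolding dvg_def
      by (subst vf_sum [where n = w])
        (auto intro!: A_sg A_parity [OF D_in [OF is_vfD [OF W]]] simp: vf_sg [OF D_in [OF is_vfD [OF W]]])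
    show ?thesis unfolding 1 2 sum.distrib by (simp add: add.commute)
  qed
  have eq: "sg (v * w) (sg (par b * (w + v + 1)) (D b (W a) * D a (V b))) =
      sg (par a * (v + w + 1)) (D a (V b) * D b (W a))" for a b
    by (subst A_commute [OF D_in [OF is_vfD [OF W]] D_in [OF is_vfD [OF V]]], auto)
      (rule sg_cong, auto)
  have dc: "D a (commutator v w V W a) = D a (vf V (W a)) - sg (v * w) (D a (vf W (V a)))" for a
  proof -
    have 1: "vf V (W a) \<in> A (v + w + par a)" "vf W (V a) \<in> A (v + w + par a)"
      by (rule A_parity [OF vf_in [OF V is_vfD [OF W]]], auto)
        (rule A_parity [OF vf_in [OF W is_vfD [OF V]]], auto)
    show ?thesis
      unfolding commutator_def by (simp add: D_diff [OF 1(1) A_sg [OF 1(2)]] D_sg [OF 1(2)])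
  qed
  have "dvg (v + w) (commutator v w V W) =
      (\<Sum>a\<in>UNIV. sg (par a * (v + w + 1)) (D a (vf V (W a)))) -
      sg (v * w) (\<Sum>a\<in>UNIV. sg (par a * (w + v + 1)) (D a (vf W (V a))))"
    unfolding dvg_def dc sg_diff sum_subtractf sg_sum sg_simps by (simp add: ac_simps)
  moreover have "sg (v * w) (\<Sum>b\<in>UNIV. \<Sum>a\<in>UNIV. sg (par b * (w + v + 1)) (D b (W a) * D a (V b))) =
      (\<Sum>a\<in>UNIV. \<Sum>b\<in>UNIV. sg (par a * (v + w + 1)) (D a (V b) * D b (W a)))"
    unfolding sg_sum eq by (rule sum.swap)
  ultimately show ?thesis
    unfolding * [OF V W] * [OF W V] sg_add by simp
qed

lemma A_commute_even:
  assumes "f \<in> A m" "s \<in> A 0"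
  shows "f * s = s * f"
  using A_commute [OF assms] by simp

end

text \<open>
  \<open>rdvg\<close> is the divergence with respect to \<open>\<rho> Dx\<close>, written as the coordinate divergence plus
  \<open>W(\<rho>) / \<rho>\<close>.
\<close>

locale volume = superdiff +
  fixes \<rho> r
  assumes rho_in: "\<rho> \<in> A 0" and r_in: "r \<in> A 0"
    and r_rho: "f \<in> A n \<Longrightarrow> r * (\<rho> * f) = f"
begin

text \<open>The quotient rule for \<open>1/\<rho>\<close> without a unit in the ring. The element
  \<open>u = r * \<rho>\<close> acts as a unit, so \<open>u * u = u\<close>, and applying
  \<open>V\<close> gives \<open>vf V u = vf V u + vf V u\<close>; hence
  \<open>vf V u = 0\<close>.\<close>

lemma vf_r:
  assumes V: "is_vf v V"
  shows "vf V r = - (r * (r * vf V \<rho>))"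
proof -
  define u where "u = r * \<rho>"
  have u: "u \<in> A 0"
    using A_mult [OF r_in rho_in] by (simp add: u_def)
  have uf: "u * f = f" if "f \<in> A n" for f n
    using r_rho [OF that] by (simp add: u_def mult.assoc)
  have in': "vf V u \<in> A v" "vf V r \<in> A v" "vf V \<rho> \<in> A v"
    using vf_in [OF V u] vf_in [OF V r_in] vf_in [OF V rho_in] by simp_all
  have "vf V u = vf V (u * u)"
    by (simp add: uf [OF u])
  also have "\<dots> = u * vf V u + u * vf V u"
    by (simp add: vf_mult [OF V u u] A_commute [OF in'(1) u])
  also have "\<dots> = vf V u + vf V u"
    by (simp add: uf [OF in'(1)])
  finally have "vf V u = 0" by simp
  moreover have "vf V u = vf V r * \<rho> + r * vf V \<rho>"
    by (simp add: u_def vf_mult [OF V r_in rho_in])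
  ultimately have "vf V r * \<rho> = - (r * vf V \<rho>)"
    by (simp add: eq_neg_iff_add_eq_0)
  then have "r * (vf V r * \<rho>) = - (r * (r * vf V \<rho>))" by simp
  moreover have "vf V r * \<rho> = \<rho> * vf V r"
    by (rule A_commute_even [OF in'(2) rho_in])
  ultimately show ?thesis by (simp add: r_rho [OF in'(2)])
qed

definition rdvg :: "nat \<Rightarrow> ('a \<Rightarrow> 'b) \<Rightarrow> 'b" where
  "rdvg w W = dvg w W + r * vf W \<rho>"

lemma rdvg_in:
  assumes "is_vf w W"
  shows "rdvg w W \<in> A w"
  using A_add [OF dvg_in [OF assms] A_parity [OF A_mult [OF r_in vf_in [OF assms rho_in]], where n = w]]
  by (simp add: rdvg_def)

text \<open>Differentiating the logarithmic term \<open>r * vf W \<rho>\<close> along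
  \<open>V\<close> produces \<open>r * vf V (vf W \<rho>)\<close>, which is handled by
  \<open>vf_commutator\<close>, and a product of \<open>vf V \<rho>\<close> with
  \<open>vf W \<rho>\<close>, which is graded symmetric and cancels.\<close>

lemma rdvg_commutator:
  assumes V: "is_vf v V" and W: "is_vf w W"
  shows "rdvg (v + w) (commutator v w V W) = vf V (rdvg w W) - sg (v * w) (vf W (rdvg v V))"
proof -
  have *: "vf V (rdvg w W) = vf V (dvg w W) - r * (r * (vf V \<rho> * vf W \<rho>)) + r * vf V (vf W \<rho>)"
    if V: "is_vf v V" and W: "is_vf w W" for v w V W
  proof -
    have W\<rho>: "vf W \<rho> \<in> A w"
      using vf_in [OF W rho_in] by simp
    then have "r * vf W \<rho> \<in> A w"
      using A_mult [OF r_in W\<rho>] by simp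
    then have "vf V (rdvg w W) = vf V (dvg w W) + vf V (r * vf W \<rho>)"
      unfolding rdvg_def by (rule vf_add [OF dvg_in [OF W]])
    also have "vf V (r * vf W \<rho>) = - (r * (r * (vf V \<rho> * vf W \<rho>))) + r * vf V (vf W \<rho>)"
      by (simp add: vf_mult [OF V r_in W\<rho>] vf_r [OF V] mult.assoc)
    finally show ?thesis by simp
  qed
  have eq: "sg (v * w) (r * (r * (vf W \<rho> * vf V \<rho>))) = r * (r * (vf V \<rho> * vf W \<rho>))"
    using A_commute [OF vf_in [OF V rho_in] vf_in [OF W rho_in]] by simp
  have "rdvg (v + w) (commutator v w V W) = vf V (dvg w W) - sg (v * w) (vf W (dvg v V)) +
      (r * vf V (vf W \<rho>) - sg (v * w) (r * vf W (vf V \<rho>)))"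
    unfolding rdvg_def dvg_commutator [OF V W] vf_commutator [OF V W rho_in]
    by (simp add: right_diff_distrib)
  then show ?thesis
    unfolding * [OF V W] * [OF W V] sg_diff sg_add eq by simp
qed

end

section \<open>Odd Poisson brackets\<close>

text \<open>
  \<open>vf (S a)\<close> is, up to sign, the bracket with the coordinate \<open>x\<^sup>a\<close>.  The signs in the Jacobi
  identity come from sorting the coefficients of \<open>p\<^sub>a p\<^sub>k p\<^sub>c\<close> in the canonical bracket of the
  Hamiltonian \<open>S\<^sup>a\<^sup>b p\<^sub>b p\<^sub>a\<close> with itself.
\<close>

locale poisson = superdiff +
  fixes S
  assumes S_in: "S a b \<in> A (par a + par b + 1)"
    and S_sym: "S a b = sg (par a * par b) (S b a)"
    and jacobi: "sg (par a * par k + par a * par c + par a + par c * par k) (vf (S a) (S k c)) +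
      sg (par k * par c + par k + par a * par c) (vf (S k) (S a c)) + sg (par c) (vf (S c) (S k a)) = 0"
begin

lemma is_vf_S: "is_vf (par a + 1) (S a)"
  unfolding is_vf_def by (auto intro: A_parity [OF S_in])

lemma P_in: "f \<in> A m \<Longrightarrow> vf (S a) f \<in> A (par a + 1 + m)"
  by (rule vf_in [OF is_vf_S])

text \<open>The first two terms of \<open>jacobi\<close> are the c-th component of the commutator of
  \<open>S a\<close> and \<open>S k\<close>; the third term expresses it through
  \<open>vf (S c) (S k a)\<close>.\<close>

lemma S_commutator:
  assumes "f \<in> A m"
  shows "vf (S a) (vf (S k) f) + sg (par a * par k + par a + par k) (vf (S k) (vf (S a) f)) =
    - (\<Sum>c\<in>UNIV. sg (par a * par k + par k * par c + par a * par c + par a + par c) (vf (S c) (S k a) * D c f))"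
proof -
  have "commutator (par a + 1) (par k + 1) (S a) (S k) c =
      - sg (par a * par k + par k * par c + par a * par c + par a + par c) (vf (S c) (S k a))" for c
    \<comment> \<open>Multiplying by this sign gives \<open>vf (S a) (S k c)\<close> the coefficient
      1 that it has in \<open>commutator\<close>.\<close>
    using arg_cong [OF jacobi [of a k c], of "sg (par a * par k + par a * par c + par a + par c * par k)"]
    by (auto simp: commutator_def sg_def algebra_simps eq_neg_iff_add_eq_0 split: if_splits)
  then have "vf (commutator (par a + 1) (par k + 1) (S a) (S k)) f =
      - (\<Sum>c\<in>UNIV. sg (par a * par k + par k * par c + par a * par c + par a + par c) (vf (S c) (S k a) * D c f))"
    by (simp add: vf_def [of "commutator _ _ _ _"] sum_negf)
  moreover have "vf (commutator (par a + 1) (par k + 1) (S a) (S k)) f =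
      vf (S a) (vf (S k) f) + sg (par a * par k + par a + par k) (vf (S k) (vf (S a) f))"
    unfolding vf_commutator [OF is_vf_S is_vf_S assms]
    by (subst sg_cong_minus [where n = "par a * par k + par a + par k"]) auto
  ultimately show ?thesis by simp
qed

text \<open>The components of the Hamiltonian vector field of \<open>f\<close>, of parity
  \<open>e\<close>; the sum over the second index of \<open>S\<close> is hidden in
  \<open>vf (S a)\<close>.\<close>

definition ham where
  "ham e f a = sg (par a * e) (vf (S a) f)"

lemma is_vf_ham: "f \<in> A e \<Longrightarrow> is_vf (e + 1) (ham e f)"
  unfolding is_vf_def ham_def by (intro allI A_sg A_parity [OF P_in]) auto

text \<open>Graded symmetry of \<open>S\<close> lets the summation indices exchange roles, so that
  the derivatives of \<open>s\<close> stand on the left and all of \<open>S\<close> acts on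
  \<open>f\<close>. Products in this form are ready for the Leibniz rule.\<close>

lemma vf_ham_even:
  assumes s: "s \<in> A 0" and f: "f \<in> A m"
  shows "vf (ham 0 s) f = (\<Sum>a\<in>UNIV. D a s * vf (S a) f)"
proof -
  have "S a b * D b s * D a f = D b s * (S b a * D a f)" for a b
  proof -
    have "S a b * D b s = sg (par a * par b + (par b + par a + 1) * par b) (D b s * S b a)"
      using A_commute [OF S_in D_in [OF s]] S_sym [of a b] by simp
    also have "\<dots> = D b s * S b a"
      by (auto simp: sg_def)
    finally show ?thesis by (simp add: mult.assoc)
  qed
  then show ?thesis
    unfolding vf_def ham_def by (simp add: sum_distrib_left sum_distrib_right) (rule sum.swap)
qed

text \<open>The graded symmetry of the odd bracket when one argument is odd. It turns the field of
  \<open>f\<close> applied to \<open>laplacian s\<close> into the field of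
  \<open>laplacian s\<close> applied to \<open>f\<close>.\<close>

lemma vf_ham_swap:
  assumes h: "h \<in> A 1" and g: "g \<in> A e"
  shows "vf (ham e g) h = sg e (vf (ham 1 h) g)"
proof -
  have "sg (par b * e) (S b a * D a g * D b h) = sg (e + par a) (S a b * D b h * D a g)" for a b
  proof -
    have "D a g * D b h = sg ((e + par a) * (1 + par b)) (D b h * D a g)"
      by (rule A_commute [OF D_in [OF g] D_in [OF h]])
    then show ?thesis
      by (simp add: S_sym [of b a] mult.assoc) (rule sg_cong, auto)
  qed
  then show ?thesis
    unfolding vf_def ham_def by (simp add: sum_distrib_right sg_sum) (rule sum.swap)
qed

text \<open>
  For even \<open>s\<close> the bracket \<open>{s, g}\<close> is \<open>- X\<^sub>s g\<close>, so this says that \<open>[X\<^sub>s, X\<^sub>g]\<close> is the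
  Hamiltonian vector field of \<open>{s, g}\<close>.
\<close>

lemma ham_commutator:
  assumes s: "s \<in> A 0" and g: "g \<in> A e"
  shows "commutator 1 (e + 1) (ham 0 s) (ham e g) k = - ham (e + 1) (vf (ham 0 s) g) k"
proof -
  note Dg = D_in [OF g] and Ds = D_in [OF s]
  \<comment> \<open>Besides two nested applications of \<open>vf (S _)\<close> to \<open>g\<close>,
    the expansion contains only two kinds of terms: \<open>Q\<close>, where a component of
    \<open>S\<close> is differentiated, and \<open>R\<close>, where \<open>s\<close> is
    differentiated twice.\<close>
  define Q where "Q c b a = sg (par a * par k + par k * par c + par a * par c + par a + par c)
      (D a s * (S c b * (D b (S k a) * D c g)))" for a b c
  define R where "R a b = sg (par k) (S k b * D b (D a s) * vf (S a) g)" for a b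
  have t14: "D a s * vf (S a) (vf (S k) g) + sg (par k + par a * (par k + 1)) (D a s * vf (S k) (vf (S a) g)) =
      - (\<Sum>c\<in>UNIV. \<Sum>b\<in>UNIV. Q c b a)" for a
  proof -
    have "D a s * vf (S a) (vf (S k) g) + sg (par k + par a * (par k + 1)) (D a s * vf (S k) (vf (S a) g)) =
        D a s * (vf (S a) (vf (S k) g) + sg (par a * par k + par a + par k) (vf (S k) (vf (S a) g)))"
      by (simp add: distrib_left ac_simps)
    then show ?thesis
      unfolding S_commutator [OF g]
      by (simp add: sum_distrib_left sum_distrib_right vf_def Q_def sg_sum mult.assoc)
  qed
  have t3: "sg (par k) (vf (S k) (D a s) * vf (S a) g) = (\<Sum>b\<in>UNIV. R a b)" for a
    by (simp add: vf_def [of "S k"] R_def sum_distrib_right sg_sum)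
  \<comment> \<open>The product rule inside \<open>D a (vf (S k) s)\<close> yields one
    \<open>Q\<close> and one \<open>R\<close> term per index; the rest is reordering of
    factors.\<close>
  have t2: "sg (e + 1 + par k * e + par a * e) (vf (S a) g * D a (vf (S k) s)) =
      (\<Sum>b\<in>UNIV. R a b) - (\<Sum>b\<in>UNIV. \<Sum>c\<in>UNIV. Q c a b)" for a
  proof -
    have SD: "S k b * D b s \<in> A (par k + 1)" for b
      by (rule A_parity [OF A_mult [OF S_in Ds]]) auto
    have "D a (vf (S k) s) = (\<Sum>b\<in>UNIV. D a (S k b * D b s))"
      unfolding vf_def by (rule D_sum [OF SD])
    also have "\<dots> = (\<Sum>b\<in>UNIV. D a (S k b) * D b s + sg (par a * (par k + par b + 1)) (S k b * D a (D b s)))"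
      by (simp add: D_mult [OF S_in Ds])
    finally have D: "D a (vf (S k) s) = \<dots>" .
    have 1: "sg (e + 1 + par k * e + par a * e) (vf (S a) g * (D a (S k b) * D b s)) = - (\<Sum>c\<in>UNIV. Q c a b)" for b
    proof -
      have "sg (e + 1 + par k * e + par a * e) (S a c * D c g * (D a (S k b) * D b s)) = - Q c a b" for c
      proof -
        have c1: "D c g * (D a (S k b) * D b s) =
            sg ((e + par c) * (par k + par b + 1 + par a + (0 + par b))) (D a (S k b) * D b s * D c g)"
          by (rule A_commute [OF Dg A_mult [OF D_in [OF S_in] Ds]])
        have c2: "S c a * D a (S k b) * D b s =
            sg ((par c + par a + 1 + (par k + par b + 1 + par a)) * (0 + par b)) (D b s * (S c a * D a (S k b)))"
          by (rule A_commute [OF A_mult [OF S_in D_in [OF S_in]] Ds])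
        have "S a c * D c g * (D a (S k b) * D b s) = sg (par a * par c) (S c a * (D c g * (D a (S k b) * D b s)))"
          by (simp add: S_sym [of a c] mult.assoc)
        also have "\<dots> = sg (par a * par c + (e + par c) * (par k + par b + 1 + par a + (0 + par b)))
            (S c a * D a (S k b) * D b s * D c g)"
          unfolding c1 by (simp add: mult.assoc)
        also have "\<dots> = sg (par a * par c + (e + par c) * (par k + par b + 1 + par a + (0 + par b)) +
            (par c + par a + 1 + (par k + par b + 1 + par a)) * (0 + par b))
            (D b s * (S c a * (D a (S k b) * D c g)))"
          unfolding c2 by (simp add: mult.assoc)
        finally show ?thesis
          unfolding Q_def by (simp only: sg_simps) (rule sg_cong_minus, auto)
      qed
      then show ?thesis
        by (simp add: vf_def [of "S a"] sum_distrib_right sg_sum sum_negf)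
    qed
    have 2: "sg (e + 1 + par k * e + par a * e)
        (vf (S a) g * sg (par a * (par k + par b + 1)) (S k b * D a (D b s))) = R a b" for b
    proof -
      have "vf (S a) g * (S k b * D a (D b s)) = sg ((par a + 1 + e) * (par k + par b + 1 + (0 + par b + par a)))
          (S k b * D a (D b s) * vf (S a) g)"
        by (rule A_commute [OF P_in [OF g] A_mult [OF S_in D_in [OF Ds]]])
      then have "sg (e + 1 + par k * e + par a * e)
          (vf (S a) g * sg (par a * (par k + par b + 1)) (S k b * D a (D b s))) =
          sg (e + 1 + par k * e + par a * e + par a * (par k + par b + 1) +
            (par a + 1 + e) * (par k + par b + 1 + (0 + par b + par a)))
          (S k b * D a (D b s) * vf (S a) g)"
        by (simp only: sg_simps sg_mult add.assoc)
      also have "\<dots> = R a b"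
        unfolding R_def D_commute [OF s, of a b] sg_mult sg_simps by (rule sg_cong) auto
      finally show ?thesis .
    qed
    have "sg (e + 1 + par k * e + par a * e) (vf (S a) g * D a (vf (S k) s)) =
        (\<Sum>b\<in>UNIV. sg (e + 1 + par k * e + par a * e) (vf (S a) g * (D a (S k b) * D b s))) +
        (\<Sum>b\<in>UNIV. sg (e + 1 + par k * e + par a * e)
          (vf (S a) g * sg (par a * (par k + par b + 1)) (S k b * D a (D b s))))"
      unfolding D by (simp only: sum_distrib_left distrib_left sum.distrib sg_sum sg_add)
    then show ?thesis unfolding 1 2 by (simp add: sum_negf)
  qed
  have PPg: "D a s * vf (S a) g \<in> A (e + 1)" for a
    by (rule A_parity [OF A_mult [OF Ds P_in [OF g]]]) auto
  \<comment> \<open>The prefactor removes the sign in the k-th component of \<open>ham e g\<close>;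
    it is applied once more at the end to restore that sign.\<close>
  have "sg (par k * e) (commutator 1 (e + 1) (ham 0 s) (ham e g) k) =
     (\<Sum>a\<in>UNIV. D a s * vf (S a) (vf (S k) g)) -
     (\<Sum>a\<in>UNIV. sg (e + 1 + par k * e + par a * e) (vf (S a) g * D a (vf (S k) s)))"
  proof -
    have "sg (par k * e) (vf (ham 0 s) (ham e g k)) = (\<Sum>a\<in>UNIV. D a s * vf (S a) (vf (S k) g))"
      unfolding ham_def [of e g] vf_sg [OF P_in [OF g]] vf_ham_even [OF s P_in [OF g]]
      by (simp, subst sg_cong [of _ 0]) auto
    moreover have "sg (par k * e) (sg (1 * (e + 1)) (vf (ham e g) (ham 0 s k))) =
        (\<Sum>a\<in>UNIV. sg (e + 1 + par k * e + par a * e) (vf (S a) g * D a (vf (S k) s)))"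
      unfolding vf_def [of "ham e g"] sg_sum
      by (intro sum.cong refl) (simp add: ham_def, rule sg_cong, auto)
    ultimately show ?thesis
      unfolding commutator_def sg_diff by simp
  qed
  also have "\<dots> = (\<Sum>a\<in>UNIV. D a s * vf (S a) (vf (S k) g)) - (\<Sum>a\<in>UNIV. \<Sum>b\<in>UNIV. R a b) +
       (\<Sum>a\<in>UNIV. \<Sum>b\<in>UNIV. \<Sum>c\<in>UNIV. Q c a b)"
    unfolding t2 by (simp add: sum_subtractf)
  \<comment> \<open>Renaming the indices brings the \<open>Q\<close> terms of \<open>t2\<close> into
    the form of those in \<open>t14\<close>, so that the Jacobi contribution cancels them.\<close>
  also have "(\<Sum>a\<in>UNIV. \<Sum>b\<in>UNIV. \<Sum>c\<in>UNIV. Q c a b) = (\<Sum>a\<in>UNIV. \<Sum>c\<in>UNIV. \<Sum>b\<in>UNIV. Q c b a)"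
    by (rule trans [OF sum.swap]) (intro sum.cong refl sum.swap)
  also have "(\<Sum>a\<in>UNIV. D a s * vf (S a) (vf (S k) g)) - (\<Sum>a\<in>UNIV. \<Sum>b\<in>UNIV. R a b) + \<dots> =
      - (\<Sum>a\<in>UNIV. \<Sum>b\<in>UNIV. R a b) -
      (\<Sum>a\<in>UNIV. sg (par k + par a * (par k + 1)) (D a s * vf (S k) (vf (S a) g)))"
  proof -
    have "(\<Sum>a\<in>UNIV. D a s * vf (S a) (vf (S k) g) +
        sg (par k + par a * (par k + 1)) (D a s * vf (S k) (vf (S a) g))) =
        (\<Sum>a\<in>UNIV. - (\<Sum>c\<in>UNIV. \<Sum>b\<in>UNIV. Q c b a))"
      by (simp only: t14)
    then show ?thesis
      by (simp add: sum.distrib sum_negf eq_neg_iff_add_eq_0 algebra_simps)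
  qed
  also have "\<dots> = - sg (par k) (vf (S k) (vf (ham 0 s) g))"
  proof -
    have "vf (S k) (vf (ham 0 s) g) = (\<Sum>a\<in>UNIV. vf (S k) (D a s * vf (S a) g))"
      unfolding vf_ham_even [OF s g] by (rule vf_sum [OF PPg])
    also have "\<dots> = (\<Sum>a\<in>UNIV. vf (S k) (D a s) * vf (S a) g +
        sg ((par k + 1) * (0 + par a)) (D a s * vf (S k) (vf (S a) g)))"
      by (simp add: vf_mult [OF is_vf_S Ds P_in [OF g]])
    finally have "sg (par k) (vf (S k) (vf (ham 0 s) g)) = (\<Sum>a\<in>UNIV. \<Sum>b\<in>UNIV. R a b) +
        (\<Sum>a\<in>UNIV. sg (par k + par a * (par k + 1)) (D a s * vf (S k) (vf (S a) g)))"
      by (simp only: sum.distrib sg_sum sg_add t3 sg_simps) (simp add: ac_simps)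
    then show ?thesis by simp
  qed
  finally have "sg (par k * e) (sg (par k * e) (commutator 1 (e + 1) (ham 0 s) (ham e g) k)) =
      sg (par k * e) (- sg (par k) (vf (S k) (vf (ham 0 s) g)))" by simp
  then show ?thesis
    unfolding ham_def [of "e + 1"] sg_simps by (subst (asm) sg_cong [of _ 0]) (auto simp: ac_simps distrib_left)
qed

end

locale poisson_volume = poisson + volume
begin

text \<open>This is \<open>1/\<rho>\<close> times the derivative of \<open>\<rho> S^ab\<close>
  \<open>\<partial>_b f\<close> with the product rule already carried out. No parity of
  \<open>f\<close> occurs in it.\<close>

definition laplacian where
  "laplacian f = (\<Sum>a\<in>UNIV. D a (vf (S a) f)) + r * (\<Sum>a\<in>UNIV. D a \<rho> * vf (S a) f)"

lemma rdvg_ham: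
  assumes f: "f \<in> A e"
  shows "rdvg (e + 1) (ham e f) = laplacian f"
proof -
  have "dvg (e + 1) (ham e f) = (\<Sum>a\<in>UNIV. D a (vf (S a) f))"
    unfolding dvg_def ham_def
    by (intro sum.cong refl, subst D_sg [OF P_in [OF f]], simp, subst sg_cong [of _ 0]) auto
  moreover have "vf (ham e f) \<rho> = (\<Sum>a\<in>UNIV. D a \<rho> * vf (S a) f)"
    unfolding vf_def [of "ham e f"] ham_def
    by (intro sum.cong refl, simp, subst A_commute [OF P_in [OF f] D_in [OF rho_in]], simp,
        subst sg_cong [of _ 0]) auto
  ultimately show ?thesis
    by (simp add: rdvg_def laplacian_def)
qed

lemma laplacian_in: "f \<in> A e \<Longrightarrow> laplacian f \<in> A (e + 1)"
  using rdvg_in [OF is_vf_ham] rdvg_ham by metis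

text \<open>Take the divergence of \<open>[X\<^sub>s, X\<^sub>f]\<close>.\<close>

theorem laplacian_ham_anticommute:
  assumes s: "s \<in> A 0" and f: "f \<in> A e"
  shows "laplacian (vf (ham 0 s) f) + vf (ham 0 s) (laplacian f) = - vf (ham 1 (laplacian s)) f"
proof -
  have sv: "is_vf 1 (ham 0 s)"
    using is_vf_ham [OF s] by simp
  have X: "vf (ham 0 s) f \<in> A (e + 1)"
    using vf_in [OF sv f] by (simp add: add.commute)
  have "rdvg w (\<lambda>a. - W a) = - rdvg w W" if "\<And>a. W a \<in> A (w + par a)" for w W
    unfolding rdvg_def dvg_def vf_def by (simp add: D_uminus [OF that] sum_negf)
  then have "- rdvg (e + 1 + 1) (ham (e + 1) (vf (ham 0 s) f)) =
      rdvg (1 + (e + 1)) (commutator 1 (e + 1) (ham 0 s) (ham e f))"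
    using is_vfD [OF is_vf_ham [OF X]] unfolding ext [OF ham_commutator [OF s f]]
    by (simp only: add.commute add.left_commute)
  also have "\<dots> = vf (ham 0 s) (laplacian f) - sg (e + 1) (vf (ham e f) (laplacian s))"
    using rdvg_commutator [OF sv is_vf_ham [OF f]] rdvg_ham [OF f] rdvg_ham [OF s] by simp
  \<comment> \<open>\<open>laplacian s\<close> is odd because \<open>s\<close> is even, so
    \<open>vf_ham_swap\<close> applies.\<close>
  also have "sg (e + 1) (vf (ham e f) (laplacian s)) = - vf (ham 1 (laplacian s)) f"
    using vf_ham_swap [OF _ f, of "laplacian s"] laplacian_in [OF s] by (simp add: sg_def)
  finally have "laplacian (vf (ham 0 s) f) = - (vf (ham 0 s) (laplacian f) + vf (ham 1 (laplacian s)) f)"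
    unfolding rdvg_ham [OF X] by (simp add: minus_equation_iff [of "laplacian _"])
  then show ?thesis by simp
qed

end

context poisson
begin

theorem ham_square:
  assumes s: "s \<in> A 0" and f: "f \<in> A e"
  shows "vf (ham 0 s) (vf (ham 0 s) f) + vf (ham 0 s) (vf (ham 0 s) f) = - vf (ham 1 (vf (ham 0 s) s)) f"
proof -
  have sv: "is_vf 1 (ham 0 s)"
    using is_vf_ham [OF s] by simp
  have "commutator 1 1 (ham 0 s) (ham 0 s) = (\<lambda>k. - ham 1 (vf (ham 0 s) s) k)"
    using ham_commutator [OF s s] by (intro ext) simp
  then have "vf (commutator 1 1 (ham 0 s) (ham 0 s)) f = - vf (ham 1 (vf (ham 0 s) s)) f"
    unfolding vf_def by (simp add: sum_negf)
  then show ?thesis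
    using vf_commutator [OF sv sv f] by simp
qed

end

section \<open>The Jacobi identity from the canonical bracket\<close>

lemma cotangent_par_simps [simp]:
  "cotangent_par par (Pos a) = par a" "cotangent_par par (Mom a) = par a"
  by (simp_all add: cotangent_par_def)

text \<open>An abstract cotangent bundle: \<open>p\<close> are the momenta, \<open>u\<close> acts as
  the unit, and \<open>T\<close> are the components pulled back from the base, hence constant along
  the momenta. \<open>two_cancel\<close> takes the place of division by 2.\<close>

locale phase_superdiff = superdiff "cotangent_par par" A D
  for par :: "'i::finite \<Rightarrow> nat" and A :: "nat \<Rightarrow> 'a::ring set" and D +
  fixes u :: 'a and p :: "'i \<Rightarrow> 'a" and T :: "'i \<Rightarrow> 'i \<Rightarrow> 'a"
  assumes unit_right: "f \<in> A n \<Longrightarrow> f * u = f"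
    and unit_left: "f \<in> A n \<Longrightarrow> u * f = f"
    and p_in: "p a \<in> A (par a)"
    and D_Mom_p: "D (Mom a) (p b) = (if a = b then u else 0)"
    and D_Pos_p: "D (Pos a) (p b) = 0"
    and T_in: "T a b \<in> A (par a + par b + 1)"
    and T_sym: "T a b = sg (par a * par b) (T b a)"
    and D_Mom_T: "D (Mom c) (T a b) = 0"
    and two_cancel: "x + x = 0 \<Longrightarrow> x = (0::'a)"
begin

text \<open>Twice the Schouten function, to avoid the factor 1/2 in the ring.\<close>

definition hamiltonian :: 'a where
  "hamiltonian = (\<Sum>a\<in>UNIV. \<Sum>b\<in>UNIV. T a b * (p b * p a))"

lemma pp_in: "p a * p b \<in> A (par a + par b)"
  by (rule A_mult [OF p_in p_in])

lemma D_Mom_pp: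
  assumes "w \<in> A j" "D (Mom m) w = 0"
  shows "D (Mom m) (w * (p x * p y)) =
    sg (par m * j) (w * ((if m = x then p y else 0) + sg (par m * par x) (if m = y then p x else 0)))"
  using D_mult [OF assms(1) pp_in, of "Mom m" x y] D_mult [OF p_in p_in, of "Mom m" x y] assms(2)
  by (simp add: D_Mom_p unit_left [OF p_in] unit_right [OF p_in])

lemma D_Mom_ppp:
  assumes "w \<in> A j" "D (Mom m) w = 0"
  shows "D (Mom m) (w * (p x * (p y * p z))) =
    sg (par m * j) (w * ((if m = x then p y * p z else 0) +
      sg (par m * par x) (if m = y then p x * p z else 0) +
      sg (par m * par x + par m * par y) (if m = z then p x * p y else 0)))"
  using D_mult [OF assms(1) A_mult [OF p_in pp_in], of "Mom m" x y z]
    D_mult [OF p_in pp_in, of "Mom m" x y z] D_mult [OF p_in p_in, of "Mom m" y z] assms(2)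
  by (simp add: D_Mom_p unit_left [OF pp_in] unit_left [OF p_in] unit_right [OF p_in] distrib_left sg_add add.assoc
      if_distrib [of "\<lambda>x. _ * x"] if_distrib [of "sg _"])

lemma T_pp_in: "T a b * (p b * p a) \<in> A 1"
  by (rule A_parity [OF A_mult [OF T_in pp_in]]) auto

lemma hamiltonian_in: "hamiltonian \<in> A 1"
  unfolding hamiltonian_def by (intro A_sum T_pp_in)

text \<open>Either of the two momenta can be differentiated away; by graded symmetry of
  \<open>T\<close> both choices give the same sum.\<close>

lemma D_Mom_hamiltonian:
  "D (Mom a) hamiltonian = (\<Sum>b\<in>UNIV. T a b * p b) + (\<Sum>b\<in>UNIV. T a b * p b)"
proof -
  have "D (Mom a) hamiltonian = (\<Sum>c\<in>UNIV. \<Sum>d\<in>UNIV. D (Mom a) (T c d * (p d * p c)))"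
    unfolding hamiltonian_def D_sum [OF A_sum [OF T_pp_in]] D_sum [OF T_pp_in] ..
  also have "\<dots> = (\<Sum>c\<in>UNIV. \<Sum>d\<in>UNIV. if a = d then sg (par a * (par c + par d + 1)) (T c d * p c) else 0) +
      (\<Sum>c\<in>UNIV. \<Sum>d\<in>UNIV. if a = c then sg (par a * (par c + par d + 1) + par a * par d) (T c d * p d) else 0)"
    unfolding D_Mom_pp [OF T_in D_Mom_T] sum.distrib [symmetric]
    by (intro sum.cong refl) (auto simp: distrib_left sg_add)
  also have "(\<Sum>c\<in>UNIV. \<Sum>d\<in>UNIV. if a = d then sg (par a * (par c + par d + 1)) (T c d * p c) else 0) =
      (\<Sum>b\<in>UNIV. T a b * p b)"
    unfolding T_sym [of a] by (simp, intro sum.cong refl sg_cong) auto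
  also have "(\<Sum>c\<in>UNIV. \<Sum>d\<in>UNIV. if a = c then sg (par a * (par c + par d + 1) + par a * par d) (T c d * p d) else 0) =
      (\<Sum>d\<in>UNIV. \<Sum>c\<in>UNIV. if a = c then sg (par a * (par c + par d + 1) + par a * par d) (T c d * p d) else 0)"
    by (rule sum.swap)
  also have "\<dots> = (\<Sum>b\<in>UNIV. T a b * p b)"
    by (simp, intro sum.cong refl, subst sg_cong [of _ 0]) auto
  finally show ?thesis .
qed

text \<open>
  If \<open>\<Sum> W b d c * p\<^sub>b * p\<^sub>d * p\<^sub>c\<close> vanishes, then so do its third derivatives along the momenta,
  which are the graded symmetrizations of the coefficients.
\<close>

lemma cubic_coefficients:
  assumes W: "\<And>b c d. W b c d \<in> A (par b + par c + par d)"
    and DW: "\<And>a b c d. D (Mom a) (W b c d) = 0"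
    and zero: "(\<Sum>b\<in>UNIV. \<Sum>c\<in>UNIV. \<Sum>d\<in>UNIV. W b c d * (p b * (p c * p d))) = 0"
    and sym: "\<And>b c d. W b c d = sg (par c * par d) (W b d c)"
  shows "W m n x + sg (par m * par n) (W n m x) + sg (par m * par x + par n * par x) (W x m n) = 0"
proof -
  \<comment> \<open>The coefficient of \<open>p x * p y\<close> after one derivative along
    \<open>Mom m\<close>. The leading sign comes from passing the coefficient \<open>W\<close>, the
    inner signs from passing the momenta to the left of \<open>p m\<close>.\<close>
  define W2 where "W2 m x y = sg (par m * (par m + par x + par y)) (W m x y +
      sg (par m * par x) (W x m y) + sg (par m * par x + par m * par y) (W x y m))" for m x y
  have W2_in: "W2 m x y \<in> A (par m + par x + par y)" for m x y
    unfolding W2_def by (intro A_sg A_add A_parity [OF W]) auto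
  have DW2: "D (Mom a) (W2 m x y) = 0" for a m x y
  proof -
    have *: "W m x y \<in> A (par m + par x + par y)" "sg k (W x m y) \<in> A (par m + par x + par y)"
      "sg k (W x y m) \<in> A (par m + par x + par y)" for k
      by (auto intro!: A_sg A_parity [OF W])
    show ?thesis
      unfolding W2_def
      by (subst D_sg [OF A_add [OF A_add]], rule * *, rule *, rule *)
        (simp add: D_add [OF A_add [OF *(1,2)] *(3)] D_add [OF *(1,2)] D_sg [OF W] DW)
  qed
  have "0 = D (Mom m) (\<Sum>b\<in>UNIV. \<Sum>c\<in>UNIV. \<Sum>d\<in>UNIV. W b c d * (p b * (p c * p d)))" for m
    unfolding zero by simp
  also have "\<dots> m = (\<Sum>b\<in>UNIV. \<Sum>c\<in>UNIV. \<Sum>d\<in>UNIV. D (Mom m) (W b c d * (p b * (p c * p d))))" for m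
  proof -
    have "W b c d * (p b * (p c * p d)) \<in> A 0" for b c d
      by (rule A_parity [OF A_mult [OF W A_mult [OF p_in pp_in]]]) auto
    then show ?thesis by (simp add: D_sum [where n = 0] A_sum)
  qed
  also have "\<dots> m = (\<Sum>b\<in>UNIV. \<Sum>c\<in>UNIV. \<Sum>d\<in>UNIV. if m = b then sg (par m * (par b + par c + par d)) (W b c d * (p c * p d)) else 0) +
      (\<Sum>b\<in>UNIV. \<Sum>c\<in>UNIV. \<Sum>d\<in>UNIV. if m = c then sg (par m * (par b + par c + par d) + par m * par b) (W b c d * (p b * p d)) else 0) +
      (\<Sum>b\<in>UNIV. \<Sum>c\<in>UNIV. \<Sum>d\<in>UNIV. if m = d then sg (par m * (par b + par c + par d) + (par m * par b + par m * par c)) (W b c d * (p b * p c)) else 0)" for m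
    unfolding D_Mom_ppp [OF W DW] sum.distrib [symmetric]
    by (intro sum.cong refl) (simp add: distrib_left sg_add)
  also have "\<dots> m = (\<Sum>x\<in>UNIV. \<Sum>y\<in>UNIV. W2 m x y * (p x * p y))" for m
  proof -
    have 1: "(\<Sum>b\<in>UNIV. \<Sum>c\<in>UNIV. \<Sum>d\<in>UNIV. if m = b then F b c d else 0) = (\<Sum>c\<in>UNIV. \<Sum>d\<in>UNIV. F m c d)"
      for F :: "'i \<Rightarrow> 'i \<Rightarrow> 'i \<Rightarrow> 'a"
    proof -
      have "(\<Sum>c\<in>UNIV. \<Sum>d\<in>UNIV. if m = b then F b c d else 0) = (if m = b then \<Sum>c\<in>UNIV. \<Sum>d\<in>UNIV. F b c d else 0)" for b
        by simp
      then show ?thesis by simp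
    qed
    have 2: "(\<Sum>b\<in>UNIV. \<Sum>c\<in>UNIV. \<Sum>d\<in>UNIV. if m = c then F b c d else 0) = (\<Sum>b\<in>UNIV. \<Sum>d\<in>UNIV. F b m d)"
      for F :: "'i \<Rightarrow> 'i \<Rightarrow> 'i \<Rightarrow> 'a"
    proof -
      have "(\<Sum>d\<in>UNIV. if m = c then F b c d else 0) = (if m = c then \<Sum>d\<in>UNIV. F b c d else 0)" for b c
        by simp
      then show ?thesis by simp
    qed
    show ?thesis
      unfolding 1 2
      by (simp add: sum.distrib [symmetric] W2_def sg_add distrib_right, intro sum.cong refl arg_cong2 [of _ _ _ _ "(+)"] sg_cong) auto
  qed
  finally have zero2: "(\<Sum>x\<in>UNIV. \<Sum>y\<in>UNIV. W2 m x y * (p x * p y)) = 0" for m by simp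
  \<comment> \<open>The coefficient of \<open>p x\<close> after a further derivative along
    \<open>Mom n\<close>; the third derivative then isolates it.\<close>
  define W3 where "W3 m n x = sg (par n * (par m + par n + par x)) (W2 m n x + sg (par n * par x) (W2 m x n))" for m n x
  have W3_in: "W3 m n x \<in> A (par m + par n + par x)" for m n x
    unfolding W3_def by (intro A_sg A_add A_parity [OF W2_in]) auto
  have DW3: "D (Mom a) (W3 m n x) = 0" for a m n x
  proof -
    have *: "W2 m n x \<in> A (par m + par n + par x)" "sg k (W2 m x n) \<in> A (par m + par n + par x)" for k
      by (auto intro!: A_sg A_parity [OF W2_in])
    show ?thesis
      unfolding W3_def
      by (subst D_sg [OF A_add], rule *, rule *)
        (simp add: D_add [OF *] D_sg [OF W2_in] DW2)
  qed
  have "0 = D (Mom n) (\<Sum>x\<in>UNIV. \<Sum>y\<in>UNIV. W2 m x y * (p x * p y))" for m n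
    unfolding zero2 by simp
  also have "\<dots> m n = (\<Sum>x\<in>UNIV. \<Sum>y\<in>UNIV. D (Mom n) (W2 m x y * (p x * p y)))" for m n
  proof -
    have "W2 m x y * (p x * p y) \<in> A (par m)" for x y
      by (rule A_parity [OF A_mult [OF W2_in pp_in]]) auto
    then show ?thesis by (simp add: D_sum [where n = "par m"] A_sum)
  qed
  also have "\<dots> m n = (\<Sum>x\<in>UNIV. \<Sum>y\<in>UNIV. if n = x then sg (par n * (par m + par x + par y)) (W2 m x y * p y) else 0) +
      (\<Sum>x\<in>UNIV. \<Sum>y\<in>UNIV. if n = y then sg (par n * (par m + par x + par y) + par n * par x) (W2 m x y * p x) else 0)" for m n
    unfolding D_Mom_pp [OF W2_in DW2] sum.distrib [symmetric]
    by (intro sum.cong refl) (simp add: distrib_left sg_add)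
  also have "\<dots> m n = (\<Sum>x\<in>UNIV. W3 m n x * p x)" for m n
  proof -
    have 1: "(\<Sum>x\<in>UNIV. \<Sum>y\<in>UNIV. if n = x then F x y else 0) = (\<Sum>y\<in>UNIV. F n y)" for F :: "'i \<Rightarrow> 'i \<Rightarrow> 'a"
    proof -
      have "(\<Sum>y\<in>UNIV. if n = x then F x y else 0) = (if n = x then \<Sum>y\<in>UNIV. F x y else 0)" for x
        by simp
      then show ?thesis by simp
    qed
    show ?thesis
      unfolding 1
      by (simp add: sum.distrib [symmetric] W3_def sg_add distrib_right, intro sum.cong refl arg_cong2 [of _ _ _ _ "(+)"] sg_cong) auto
  qed
  finally have zero3: "(\<Sum>x\<in>UNIV. W3 m n x * p x) = 0" for m n by simp
  have "0 = D (Mom x) (\<Sum>x\<in>UNIV. W3 m n x * p x)"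
    unfolding zero3 by simp
  also have "\<dots> = (\<Sum>y\<in>UNIV. D (Mom x) (W3 m n y * p y))"
    by (rule D_sum [where n = "par m + par n"]) (rule A_parity [OF A_mult [OF W3_in p_in]], auto)
  also have "\<dots> = (\<Sum>y\<in>UNIV. if x = y then sg (par x * (par m + par n + par y)) (W3 m n y) else 0)"
    using D_mult [OF W3_in p_in] by (intro sum.cong refl) (simp add: D_Mom_p DW3 unit_right [OF W3_in])
  finally have "W3 m n x = 0"
    by simp
  then have W2_zero: "W2 m n x + sg (par n * par x) (W2 m x n) = 0"
    by (simp add: W3_def)
  \<comment> \<open>All six orders of the indices occur in \<open>W3\<close>. The symmetry of
    \<open>W\<close> in its last two indices identifies them in pairs, which leaves \<open>J\<close>
    twice.\<close>
  define J where "J = W m n x + sg (par m * par n) (W n m x) + sg (par m * par x + par n * par x) (W x m n)"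
  have "W m x n = sg (par n * par x) (W m n x)" "W n x m = sg (par m * par x) (W n m x)"
    "W x n m = sg (par m * par n) (W x m n)"
    using sym [of m x n] sym [of n x m] sym [of x n m] by (simp_all add: mult.commute)
  then have "W2 m n x + sg (par n * par x) (W2 m x n) = sg (par m * (par m + par n + par x)) (J + J)"
    unfolding W2_def J_def
    by (cases "even (par m)"; cases "even (par n)"; cases "even (par x)") (simp_all add: sg_def)
  then have "J + J = 0"
    unfolding W2_zero by (metis sg_eq_0_iff)
  then show ?thesis
    unfolding J_def by (rule two_cancel)
qed

text \<open>By graded commutativity the two halves of the bracket coincide, and each momentum
  derivative is \<open>M a + M a\<close>. The bracket is therefore four times a cubic polynomial in
  the momenta, whose symmetrized coefficients are the left side of the Jacobi identity.\<close>

theorem jacobi_of_canonical_bracket: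
  assumes "(\<Sum>a\<in>UNIV. D (Mom a) hamiltonian * D (Pos a) hamiltonian -
    sg (par a) (D (Pos a) hamiltonian * D (Mom a) hamiltonian)) = 0"
  defines "P \<equiv> \<lambda>a f. \<Sum>b\<in>UNIV. T a b * D (Pos b) f"
  shows "sg (par a * par k + par a * par c + par a + par c * par k) (P a (T k c)) +
      sg (par k * par c + par k + par a * par c) (P k (T a c)) + sg (par c) (P c (T k a)) = 0"
proof -
  define M where "M a = (\<Sum>b\<in>UNIV. T a b * p b)" for a
  have DM: "D (Mom a) hamiltonian = M a + M a" for a
    unfolding M_def by (rule D_Mom_hamiltonian)
  have "D (Mom a) hamiltonian * D (Pos a) hamiltonian -
      sg (par a) (D (Pos a) hamiltonian * D (Mom a) hamiltonian) =
      (M a * D (Pos a) hamiltonian + M a * D (Pos a) hamiltonian) +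
      (M a * D (Pos a) hamiltonian + M a * D (Pos a) hamiltonian)" for a
  proof -
    have "D (Pos a) hamiltonian * D (Mom a) hamiltonian = - sg (par a) (D (Mom a) hamiltonian * D (Pos a) hamiltonian)"
      unfolding A_commute [OF D_in [OF hamiltonian_in] D_in [OF hamiltonian_in], of "Pos a" "Mom a"]
      by (rule sg_cong_minus) auto
    then have "D (Mom a) hamiltonian * D (Pos a) hamiltonian -
        sg (par a) (D (Pos a) hamiltonian * D (Mom a) hamiltonian) =
        D (Mom a) hamiltonian * D (Pos a) hamiltonian + D (Mom a) hamiltonian * D (Pos a) hamiltonian"
      by (simp add: sg_def)
    then show ?thesis
      unfolding DM by (simp add: distrib_right)
  qed
  then have MD: "(\<Sum>a\<in>UNIV. M a * D (Pos a) hamiltonian) = 0"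
    using assms(1) by - (rule two_cancel [OF two_cancel], simp only: sum.distrib)
  \<comment> \<open>The sign arises when \<open>p b\<close> passes \<open>D (Pos a) (T c d)\<close>;
    its part depending on \<open>a\<close> is used up in turning \<open>T a b\<close> into
    \<open>T b a\<close>. The order of the indices is that of the momenta
    \<open>p b * (p d * p c)\<close>.\<close>
  define W where "W b d c = sg (par b * (par c + par d + 1)) (P b (T c d))" for b d c
  have TT: "T b a * D (Pos a) (T c d) \<in> A (par b + par c + par d)" for a b c d
    by (rule A_parity [OF A_mult [OF T_in D_in [OF T_in]]]) auto
  have W_in: "W b d c \<in> A (par b + par d + par c)" for b c d
    unfolding W_def P_def by (rule A_sg, rule A_sum, rule A_parity [OF TT]) auto
  have DT: "D (Mom e) (D (Pos a) (T c d)) = 0" for a c d e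
    using D_commute [OF T_in, of "Mom e" "Pos a" c d] by (simp add: D_Mom_T)
  have "D (Mom e) (T b a * D (Pos a) (T c d)) = 0" for a b c d e
    by (simp add: D_mult [OF T_in D_in [OF T_in]] D_Mom_T DT)
  then have DW: "D (Mom e) (W b d c) = 0" for b c d e
    unfolding W_def P_def by (simp add: D_sg [OF A_sum [OF TT]] D_sum [OF TT])
  have W_sym: "W b d c = sg (par d * par c) (W b c d)" for b c d
  proof -
    have "P b (T c d) = sg (par c * par d) (P b (T d c))"
      unfolding P_def by (subst T_sym [of c d]) (simp add: D_sg [OF T_in] sg_sum)
    then show ?thesis
      unfolding W_def by simp (rule sg_cong, auto)
  qed
  have "M a * D (Pos a) hamiltonian = (\<Sum>b\<in>UNIV. \<Sum>c\<in>UNIV. \<Sum>d\<in>UNIV.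
      sg (par b * (par c + par d + 1)) (T b a * D (Pos a) (T c d)) * (p b * (p d * p c)))" for a
  proof -
    have DH: "D (Pos a) hamiltonian = (\<Sum>c\<in>UNIV. \<Sum>d\<in>UNIV. D (Pos a) (T c d) * (p d * p c))"
      unfolding hamiltonian_def D_sum [OF A_sum [OF T_pp_in]] D_sum [OF T_pp_in]
      by (simp only: D_mult [OF T_in pp_in] D_mult [OF p_in p_in] D_Pos_p mult_zero_left mult_zero_right sg_simps add_0_right)
    have eq: "T a b * p b * (D (Pos a) (T c d) * (p d * p c)) =
        sg (par b * (par c + par d + 1)) (T b a * D (Pos a) (T c d)) * (p b * (p d * p c))" for b c d
    proof -
      have "p b * D (Pos a) (T c d) = sg (par b * (par c + par d + 1 + par a)) (D (Pos a) (T c d) * p b)"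
        using A_commute [OF p_in D_in [OF T_in], of b "Pos a" c d] by simp
      then have "T a b * (p b * D (Pos a) (T c d)) * (p d * p c) =
          T a b * sg (par b * (par c + par d + 1 + par a)) (D (Pos a) (T c d) * p b) * (p d * p c)"
        by (rule arg_cong)
      then have "T a b * p b * (D (Pos a) (T c d) * (p d * p c)) =
          sg (par a * par b + par b * (par c + par d + 1 + par a)) (T b a * D (Pos a) (T c d) * (p b * (p d * p c)))"
        unfolding T_sym [of a b] by (simp only: mult.assoc sg_mult sg_simps add.commute)
      also have "\<dots> = sg (par b * (par c + par d + 1)) (T b a * D (Pos a) (T c d) * (p b * (p d * p c)))"
        by (rule sg_cong) auto
      finally show ?thesis by simp
    qed
    have "M a * D (Pos a) hamiltonian =
        (\<Sum>b\<in>UNIV. T a b * p b * (\<Sum>c\<in>UNIV. \<Sum>d\<in>UNIV. D (Pos a) (T c d) * (p d * p c)))"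
      by (simp only: M_def sum_distrib_right DH)
    then show ?thesis
      by (simp only: sum_distrib_left eq)
  qed
  then have "0 = (\<Sum>a\<in>UNIV. \<Sum>b\<in>UNIV. \<Sum>c\<in>UNIV. \<Sum>d\<in>UNIV.
      sg (par b * (par c + par d + 1)) (T b a * D (Pos a) (T c d)) * (p b * (p d * p c)))"
    using MD by simp
  also have "\<dots> = (\<Sum>b\<in>UNIV. \<Sum>a\<in>UNIV. \<Sum>c\<in>UNIV. \<Sum>d\<in>UNIV.
      sg (par b * (par c + par d + 1)) (T b a * D (Pos a) (T c d)) * (p b * (p d * p c)))"
    by (rule sum.swap)
  also have "\<dots> = (\<Sum>b\<in>UNIV. \<Sum>c\<in>UNIV. \<Sum>d\<in>UNIV. W b d c * (p b * (p d * p c)))"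
    unfolding W_def P_def sg_sum sum_distrib_right
    by (rule sum.cong [OF refl], rule trans [OF sum.swap], rule sum.cong [OF refl], rule sum.swap)
  also have "\<dots> = (\<Sum>b\<in>UNIV. \<Sum>d\<in>UNIV. \<Sum>c\<in>UNIV. W b d c * (p b * (p d * p c)))"
    by (intro sum.cong refl sum.swap)
  finally have "W a k c + sg (par a * par k) (W k a c) + sg (par a * par c + par k * par c) (W c a k) = 0"
    by (intro cubic_coefficients [OF W_in DW _ W_sym]) simp
  moreover have "P a (T c k) = sg (par c * par k) (P a (T k c))"
      "P k (T c a) = sg (par c * par a) (P k (T a c))"
    unfolding P_def by (subst T_sym [of c]; simp add: D_sg [OF T_in] sg_sum)+
  ultimately show ?thesis
    unfolding W_def
    by (cases "even (par a)"; cases "even (par k)"; cases "even (par c)") (simp_all add: sg_def)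
qed

end

section \<open>Grassmann algebras\<close>

lemma coeff_sg [simp]: "coeff (sg n g) A = sg n (coeff g A)"
  by (simp add: sg_def)

lemma coeff_sum: "coeff (sum f I) A = (\<Sum>i\<in>I. coeff (f i) A)"
  by (induction I rule: infinite_finite_induct) auto

lemma coeff_mult: "coeff (g * h) C = (\<Sum>A\<in>Pow C. shuffle_sign A (C - A) * coeff g A * coeff h (C - A))"
  by (simp add: times_grass_def)

lemma coeff_one: "coeff 1 A = of_bool (A = {})"
  by (simp add: one_grass_def)

text \<open>Every pair in \<open>A \<times> B\<close> is an inversion for exactly one of the two
  orders of the factors, so the two inversion counts add up to
  \<open>card A * card B\<close>.\<close>

lemma shuffle_sign_swap:
  fixes A B :: "'i::{finite,linorder} set"
  assumes "A \<inter> B = {}"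
  shows "shuffle_sign B A = (-1) ^ (card A * card B) * shuffle_sign A B"
proof -
  let ?X = "{(a, b). a \<in> A \<and> b \<in> B \<and> b < a}" and ?Y = "{(b, a). b \<in> B \<and> a \<in> A \<and> a < b}"
  have "A \<times> B = ?X \<union> prod.swap ` ?Y"
    using assms by (auto simp: image_iff dest: linorder_cases)
  then have "card A * card B = card (?X \<union> prod.swap ` ?Y)"
    by (metis card_cartesian_product)
  also have "\<dots> = card ?X + card (prod.swap ` ?Y)"
    by (intro card_Un_disjoint) auto
  also have "card (prod.swap ` ?Y) = card ?Y"
    by (intro card_image) auto
  finally show ?thesis
    by (simp add: shuffle_sign_def flip: power_add)
      (simp add: power_add flip: power_mult_distrib mult.assoc)
qed

lemma homogeneous_0 [simp]: "homogeneous n 0"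
  by (simp add: homogeneous_def)

lemma homogeneous_1: "homogeneous 0 1"
  by (simp add: homogeneous_def coeff_one)

lemma homogeneous_add: "homogeneous n g \<Longrightarrow> homogeneous n h \<Longrightarrow> homogeneous n (g + h)"
  unfolding homogeneous_def by (metis add.right_neutral coeff_linear(2) add_0)

lemma homogeneous_uminus: "homogeneous n g \<Longrightarrow> homogeneous n (- g)"
  by (simp add: homogeneous_def)

lemma homogeneous_scaleR: "homogeneous n g \<Longrightarrow> homogeneous n (r *\<^sub>R g)"
  by (simp add: homogeneous_def)

lemma homogeneous_parity: "homogeneous m g \<Longrightarrow> even (m + n) \<Longrightarrow> homogeneous n g"
  by (auto simp: homogeneous_def)

lemma homogeneous_mult:
  assumes "homogeneous m g" "homogeneous n h"
  shows "homogeneous (m + n) (g * h)"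
  unfolding homogeneous_def
proof (intro allI impI)
  fix C
  assume "coeff (g * h) C \<noteq> 0"
  then obtain A where A: "A \<subseteq> C" "coeff g A \<noteq> 0" "coeff h (C - A) \<noteq> 0"
    unfolding coeff_mult by (metis (no_types, lifting) PowD mult_zero_left mult_zero_right sum.neutral)
  then have "even (card A + m)" "even (card (C - A) + n)"
    using assms by (auto simp: homogeneous_def)
  moreover have "card C = card A + card (C - A)"
    using A(1) by (metis card_Diff_subset card_mono finite le_add_diff_inverse)
  ultimately show "even (card C + (m + n))" by auto
qed

text \<open>Exchange each subset of \<open>C\<close> with its complement and apply
  \<open>shuffle_sign_swap\<close>. Where both coefficients are nonzero, \<open>m\<close> and
  \<open>n\<close> have the parities of the two cardinalities.\<close>

theorem homogeneous_commute:
  assumes "homogeneous m g" "homogeneous n h"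
  shows "g * h = sg (m * n) (h * g)"
proof (rule grass_eqI)
  fix C
  have "coeff (h * g) C = (\<Sum>A\<in>Pow C. shuffle_sign (C - A) A * coeff h (C - A) * coeff g A)"
    unfolding coeff_mult
    by (rule sum.reindex_bij_witness [where i = "\<lambda>A. C - A" and j = "\<lambda>A. C - A"])
      (auto simp: double_diff)
  then have "coeff (sg (m * n) (h * g)) C =
      (\<Sum>A\<in>Pow C. sg (m * n) (shuffle_sign (C - A) A * coeff h (C - A) * coeff g A))"
    by (simp add: sg_sum)
  also have "\<dots> = (\<Sum>A\<in>Pow C. shuffle_sign A (C - A) * coeff g A * coeff h (C - A))"
  proof (intro sum.cong refl)
    fix A
    assume "A \<in> Pow C"
    show "sg (m * n) (shuffle_sign (C - A) A * coeff h (C - A) * coeff g A) =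
        shuffle_sign A (C - A) * coeff g A * coeff h (C - A)"
    proof (cases "coeff g A = 0 \<or> coeff h (C - A) = 0")
      case False
      then have "even (card A + m)" "even (card (C - A) + n)"
        using assms by (auto simp: homogeneous_def)
      then have "even (m * n) = even (card A * card (C - A))" by auto
      then show ?thesis
        using shuffle_sign_swap [of A "C - A"] by (auto simp: sg_def minus_one_power_iff)
    qed auto
  qed
  finally show "coeff (g * h) C = coeff (sg (m * n) (h * g)) C"
    by (simp add: coeff_mult)
qed

lemma coeff_dtheta: "coeff (dtheta a g) A =
    (if a \<in> A then 0 else (-1) ^ card {b\<in>A. b < a} * coeff g (insert a A))"
  by (simp add: dtheta_def)

lemma dtheta_add: "dtheta a (g + h) = dtheta a g + dtheta a h"
  by (rule grass_eqI) (simp add: coeff_dtheta distrib_left)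

lemma dtheta_scaleR: "dtheta a (r *\<^sub>R g) = r *\<^sub>R dtheta a g"
  by (rule grass_eqI) (simp add: coeff_dtheta)

lemma homogeneous_dtheta:
  fixes a :: "'i::{finite,linorder}"
  assumes "homogeneous n g"
  shows "homogeneous (n + 1) (dtheta a g)"
  using assms unfolding homogeneous_def coeff_dtheta by (auto split: if_splits)

text \<open>For \<open>a < b\<close>, removing \<open>a\<close> changes the number of generators to
  the left of \<open>b\<close> by one, whereas removing \<open>b\<close> does not affect
  \<open>a\<close>.\<close>

lemma dtheta_anticommute:
  fixes a b :: "'i::{finite,linorder}"
  shows "dtheta a (dtheta b g) = - dtheta b (dtheta a g)"
proof -
  have *: "dtheta a (dtheta b g) = - dtheta b (dtheta a g)" if "a < b" for a b :: 'i
  proof (rule grass_eqI)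
    fix A
    have "{c. (c = a \<or> c \<in> A) \<and> c < b} = insert a {c \<in> A. c < b}"
      "{c. (c = b \<or> c \<in> A) \<and> c < a} = {c \<in> A. c < a}"
      using that by auto
    then show "coeff (dtheta a (dtheta b g)) A = coeff (- dtheta b (dtheta a g)) A"
      using that by (simp add: coeff_dtheta insert_commute)
  qed
  show ?thesis
  proof (cases a b rule: linorder_cases)
    case less
    then show ?thesis by (rule *)
  next
    case equal
    then show ?thesis by (auto intro!: grass_eqI simp: coeff_dtheta)
  next
    case greater
    then show ?thesis using * [of b a] by simp
  qed
qed

text \<open>Compare coefficients at \<open>C\<close>. If \<open>a\<close> is not in
  \<open>C\<close>, the subsets of \<open>insert a C\<close> that contain \<open>a\<close> give the
  first term and the others the second. If \<open>a\<close> is in \<open>C\<close>, the left side is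
  zero and the summands on the right cancel in pairs that differ by \<open>a\<close>.\<close>

theorem dtheta_mult:
  fixes a :: "'i::{finite,linorder}"
  assumes "homogeneous m g"
  shows "dtheta a (g * h) = dtheta a g * h + sg m (g * dtheta a h)"
proof (rule grass_eqI)
  fix C :: "'i set"
  define L where "L A = {b\<in>A. b < a}" for A
  have cd: "coeff (dtheta a f) A = (if a \<in> A then 0 else (-1) ^ card (L A) * coeff f (insert a A))" for f A
    by (simp add: coeff_dtheta L_def)
  have gr: "shuffle_sign {a} A = (-1) ^ card (L A)" for A
  proof -
    have "{(x, b). x = a \<and> b \<in> A \<and> b < x} = Pair a ` L A" by (auto simp: L_def)
    then show ?thesis by (simp add: shuffle_sign_def card_image inj_on_def)
  qed
  have gl: "shuffle_sign A {a} = (-1) ^ (card A + card (L A))" if "a \<notin> A" for A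
    using shuffle_sign_swap [of "{a}" A] that by (simp add: gr power_add)
  \<comment> \<open>Homogeneity turns the global sign into the sign of moving the generator past
    each monomial of \<open>g\<close>.\<close>
  have sgm: "sg m (coeff g A * x) = (-1) ^ card A * (coeff g A * x)" for A x
  proof (cases "coeff g A = 0")
    case False
    then have "even (card A + m)" using assms by (simp add: homogeneous_def)
    then show ?thesis by (auto simp: sg_def minus_one_power_iff)
  qed simp
  define lhs rhs1 rhs2 where
    "lhs = coeff (dtheta a (g * h)) C" and
    "rhs1 = (\<Sum>A\<in>Pow C. shuffle_sign A (C - A) * coeff (dtheta a g) A * coeff h (C - A))" and
    "rhs2 = (\<Sum>A\<in>Pow C. (-1) ^ card A * (shuffle_sign A (C - A) * coeff g A * coeff (dtheta a h) (C - A)))"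
  have rhs: "coeff (dtheta a g * h + sg m (g * dtheta a h)) C = rhs1 + rhs2"
  proof -
    have "sg m (shuffle_sign A (C - A) * coeff g A * coeff (dtheta a h) (C - A)) =
        (-1) ^ card A * (shuffle_sign A (C - A) * coeff g A * coeff (dtheta a h) (C - A))" for A
      using sgm [of A "shuffle_sign A (C - A) * coeff (dtheta a h) (C - A)"] by (simp add: mult_ac)
    then show ?thesis
      unfolding rhs1_def rhs2_def coeff_linear coeff_sg coeff_mult sg_sum by simp
  qed
  have "lhs = rhs1 + rhs2"
  proof (cases "a \<in> C")
    case False
    have Pow: "Pow (insert a C) = Pow C \<union> insert a ` Pow C"
      by (auto simp: Pow_insert)
    have "lhs = (-1) ^ card (L C) * (\<Sum>A\<in>Pow (insert a C).
        shuffle_sign A (insert a C - A) * coeff g A * coeff h (insert a C - A))"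
      using False by (simp add: lhs_def cd coeff_mult L_def)
    also have "\<dots> = (-1) ^ card (L C) * (\<Sum>A\<in>Pow C.
          shuffle_sign A (insert a C - A) * coeff g A * coeff h (insert a C - A)) +
        (-1) ^ card (L C) * (\<Sum>A\<in>insert a ` Pow C.
          shuffle_sign A (insert a C - A) * coeff g A * coeff h (insert a C - A))"
      unfolding Pow by (subst sum.union_disjoint) (use False in \<open>auto simp: distrib_left\<close>)
    also have "(-1) ^ card (L C) * (\<Sum>A\<in>insert a ` Pow C.
        shuffle_sign A (insert a C - A) * coeff g A * coeff h (insert a C - A)) = rhs1"
    proof -
      have inj: "inj_on (insert a) (Pow C)"
        using False by (auto intro!: inj_onI)
      show ?thesis
        unfolding rhs1_def sum_distrib_left sum.reindex [OF inj] comp_def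
      proof (intro sum.cong refl)
        fix A
        assume "A \<in> Pow C"
        then have A: "A \<subseteq> C" "a \<notin> A" "insert a C - insert a A = C - A" using False by auto
        then have "shuffle_sign (insert a A) (C - A) = shuffle_sign {a} (C - A) * shuffle_sign A (C - A)"
          using shuffle_sign_Un_left [of "{a}" A "C - A"] by simp
        moreover have "L C = L A \<union> L (C - A)" "L A \<inter> L (C - A) = {}"
          using A by (auto simp: L_def)
        then have "card (L C) = card (L A) + card (L (C - A))"
          by (simp add: card_Un_disjoint)
        ultimately show "(-1) ^ card (L C) * (shuffle_sign (insert a A) (insert a C - insert a A) * coeff g (insert a A) *
              coeff h (insert a C - insert a A)) =
            shuffle_sign A (C - A) * coeff (dtheta a g) A * coeff h (C - A)"
          using A by (simp add: cd gr power_add)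
      qed
    qed
    also have "(-1) ^ card (L C) * (\<Sum>A\<in>Pow C.
        shuffle_sign A (insert a C - A) * coeff g A * coeff h (insert a C - A)) = rhs2"
      unfolding rhs2_def sum_distrib_left
    proof (intro sum.cong refl)
      fix A
      assume "A \<in> Pow C"
      then have A: "A \<subseteq> C" "a \<notin> A" "insert a C - A = insert a (C - A)" "a \<notin> C - A" using False by auto
      then have "shuffle_sign A (insert a (C - A)) = shuffle_sign A {a} * shuffle_sign A (C - A)"
        using shuffle_sign_Un_right [of "{a}" "C - A" A] by simp
      moreover have "L C = L A \<union> L (C - A)" "L A \<inter> L (C - A) = {}"
        using A by (auto simp: L_def)
      then have "card (L C) = card (L A) + card (L (C - A))"
        by (simp add: card_Un_disjoint)
      ultimately show "(-1) ^ card (L C) * (shuffle_sign A (insert a C - A) * coeff g A * coeff h (insert a C - A)) =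
          (-1) ^ card A * (shuffle_sign A (C - A) * coeff g A * coeff (dtheta a h) (C - A))"
        using A by (simp add: cd gl power_add)
    qed
    finally show ?thesis by simp
  next
    case True
    define E where "E = C - {a}"
    have C: "C = insert a E" "a \<notin> E" using True by (auto simp: E_def)
    have Pow: "Pow C = Pow E \<union> insert a ` Pow E"
      unfolding C by (auto simp: Pow_insert)
    have disj: "Pow E \<inter> insert a ` Pow E = {}" using C(2) by auto
    have inj: "inj_on (insert a) (Pow E)"
      using C(2) by (auto intro!: inj_onI)
    have "rhs1 = (\<Sum>A\<in>Pow E. shuffle_sign A (C - A) * coeff (dtheta a g) A * coeff h (C - A))"
      unfolding rhs1_def Pow by (subst sum.union_disjoint [OF _ _ disj]) (auto simp: cd intro!: sum.neutral)
    moreover have "rhs2 = (\<Sum>A\<in>Pow E. (-1) ^ card (insert a A) *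
        (shuffle_sign (insert a A) (C - insert a A) * coeff g (insert a A) * coeff (dtheta a h) (C - insert a A)))"
    proof -
      have "(\<Sum>A\<in>Pow E. (-1) ^ card A * (shuffle_sign A (C - A) * coeff g A * coeff (dtheta a h) (C - A))) = 0"
        using C(2) by (intro sum.neutral) (auto simp: cd C(1))
      then show ?thesis
        unfolding rhs2_def Pow by (subst sum.union_disjoint [OF _ _ disj]) (auto simp: sum.reindex [OF inj])
    qed
    moreover have "(-1) ^ card (insert a A) *
        (shuffle_sign (insert a A) (C - insert a A) * coeff g (insert a A) * coeff (dtheta a h) (C - insert a A)) =
        - (shuffle_sign A (C - A) * coeff (dtheta a g) A * coeff h (C - A))" if "A \<in> Pow E" for A
    proof -
      have A: "a \<notin> A" "a \<notin> E - A" "C - insert a A = E - A" "C - A = insert a (E - A)"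
        using that C by auto
      have "shuffle_sign A (C - A) = shuffle_sign A {a} * shuffle_sign A (E - A)"
        using shuffle_sign_Un_right [of "{a}" "E - A" A] A by simp
      moreover have "shuffle_sign (insert a A) (E - A) = shuffle_sign {a} (E - A) * shuffle_sign A (E - A)"
        using shuffle_sign_Un_left [of "{a}" A "E - A"] A by simp
      ultimately show ?thesis
        using A by (simp add: cd gr gl power_add)
    qed
    ultimately have "rhs1 + rhs2 = 0" by (simp add: sum_negf)
    then show ?thesis using True by (simp add: lhs_def cd)
  qed
  then show "coeff (dtheta a (g * h)) C = coeff (dtheta a g * h + sg m (g * dtheta a h)) C"
    unfolding rhs by (simp add: lhs_def)
qed

lemma body_mult: "body (g * h) = body g * body h"
  by (simp add: body_def coeff_mult)

lemma bounded_linear_coeff: "bounded_linear (\<lambda>g :: 'i::{finite,linorder} grass. coeff g A)"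
  by (rule bounded_linear_intro [where K = 1]) (simp_all add: abs_coeff_le_norm)

lemma bounded_linear_grass:
  fixes T :: "'i::{finite,linorder} grass \<Rightarrow> 'b::real_normed_vector"
  assumes "linear T"
  shows "bounded_linear T"
proof (rule bounded_linear_intro)
  interpret linear T by fact
  show "T (x + y) = T x + T y" "T (r *\<^sub>R x) = r *\<^sub>R T x" for x y r by (simp_all add: add scale)
  let ?e = "\<lambda>A. Grass (\<lambda>B. of_bool (B = A)) :: 'i grass"
  show "norm (T x) \<le> norm x * (\<Sum>A\<in>UNIV. norm (T (?e A)))" for x
  proof -
    have "x = (\<Sum>A\<in>UNIV. coeff x A *\<^sub>R ?e A)"
    proof (rule grass_eqI)
      fix B
      show "coeff x B = coeff (\<Sum>A\<in>UNIV. coeff x A *\<^sub>R ?e A) B"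
        unfolding coeff_sum coeff_linear coeff_Grass by (simp add: of_bool_def if_distrib cong: if_cong)
    qed
    then have "T x = (\<Sum>A\<in>UNIV. coeff x A *\<^sub>R T (?e A))"
      by (metis (no_types, lifting) scale sum sum.cong)
    also have "norm \<dots> \<le> (\<Sum>A\<in>UNIV. norm (coeff x A *\<^sub>R T (?e A)))"
      by (rule norm_sum)
    also have "\<dots> \<le> (\<Sum>A\<in>UNIV. norm x * norm (T (?e A)))"
      by (intro sum_mono) (simp add: abs_coeff_le_norm mult_right_mono)
    finally show ?thesis by (simp add: sum_distrib_left)
  qed
qed

lemma linear_dtheta: "linear (dtheta a)"
  by (rule linearI) (simp_all add: dtheta_add dtheta_scaleR)

text \<open>A lowest-degree argument: at a set \<open>A\<close> of least cardinality in the support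
  of \<open>h\<close> only the body of \<open>g\<close> contributes to the product, since any other
  factor would need a smaller set in the support.\<close>

lemma grass_mult_left_cancel:
  fixes g h :: "'i::{finite,linorder} grass"
  assumes "body g \<noteq> 0" "g * h = 0"
  shows "h = 0"
proof (rule ccontr)
  assume "h \<noteq> 0"
  then have "\<exists>A. coeff h A \<noteq> 0"
    by (metis coeff_linear(1) grass_eqI)
  then obtain A where A: "coeff h A \<noteq> 0" "\<And>B. coeff h B \<noteq> 0 \<Longrightarrow> card A \<le> card B"
    using ex_min_if_finite [of "{A. coeff h A \<noteq> 0}"] 
    by (metis (mono_tags) exists_least_iff [of "\<lambda>n. \<exists>A. coeff h A \<noteq> 0 \<and> card A = n"] linorder_not_less)
  have "coeff (g * h) A = (\<Sum>B\<in>Pow A. if B = {} then coeff g {} * coeff h A else 0)"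
    unfolding coeff_mult
  proof (intro sum.cong refl)
    fix B
    assume "B \<in> Pow A"
    then have "coeff h (A - B) = 0" if "B \<noteq> {}"
      using A(2) [of "A - B"] that by (metis Diff_disjoint Diff_subset Int_absorb1 PowD card_mono card_seteq double_diff finite Diff_cancel)
    then show "shuffle_sign B (A - B) * coeff g B * coeff h (A - B) = (if B = {} then coeff g {} * coeff h A else 0)"
      by auto
  qed
  also have "\<dots> = body g * coeff h A"
    by (simp add: body_def)
  finally show False using A(1) assms by simp
qed

section \<open>The exponential and mixed partial derivatives\<close>

text \<open>The quadratic bound makes \<open>exp\<close> differentiable at 0 in a Banach algebra
  that need not be commutative.\<close>

lemma norm_exp_remainder_le:
  fixes z :: "'a::{real_normed_algebra_1,banach}"
  shows "norm (exp z - 1 - z) \<le> (norm z)\<^sup>2 * exp (norm z)"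
proof -
  have s: "summable (\<lambda>n. norm z ^ n /\<^sub>R fact n)"
    using exp_converges [of "norm z"] by (simp add: sums_iff)
  have le: "norm (inverse (fact (n + 2)) *\<^sub>R z ^ (n + 2)) \<le> (norm z)\<^sup>2 * (norm z ^ n /\<^sub>R fact n)" for n
  proof -
    have "norm (inverse (fact (n + 2)) *\<^sub>R z ^ (n + 2)) \<le> inverse (fact (n + 2)) * norm z ^ (n + 2)"
      unfolding norm_scaleR by (intro mult_mono norm_power_ineq) auto
    also have "\<dots> \<le> inverse (fact n) * norm z ^ (n + 2)"
      by (intro mult_right_mono le_imp_inverse_le fact_mono) auto
    also have "\<dots> = (norm z)\<^sup>2 * (norm z ^ n /\<^sub>R fact n)"
      by (simp add: power_add power2_eq_square mult_ac)
    finally show ?thesis .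
  qed
  have "norm (exp z - 1 - z) = norm (\<Sum>n. inverse (fact (n + 2)) *\<^sub>R z ^ (n + 2))"
    by (subst exp_first_two_terms) simp
  also have "\<dots> \<le> (\<Sum>n. (norm z)\<^sup>2 * (norm z ^ n /\<^sub>R fact n))"
    by (rule norm_suminf_le [OF le]) (intro summable_mult s)
  also have "\<dots> = (norm z)\<^sup>2 * exp (norm z)"
    using suminf_mult [OF s] by (simp add: exp_def)
  finally show ?thesis .
qed

lemma has_derivative_exp_0: "(exp has_derivative (\<lambda>h :: 'a::{real_normed_algebra_1,banach}. h)) (at 0)"
proof (rule has_derivativeI_sandwich [where e = 1])
  show "((\<lambda>y :: 'a. norm y * exp (norm y)) \<longlongrightarrow> 0) (at 0)"
    by (rule tendsto_eq_intros | simp)+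
  show "norm (exp y - exp 0 - (y - 0)) / norm (y - 0) \<le> norm y * exp (norm y)"
    if "y \<noteq> 0" for y :: 'a
    using norm_exp_remainder_le [of y] that by (simp add: divide_simps power2_eq_square mult_ac)
qed auto

text \<open>This carries statements about \<open>exp\<close> near 0 to any other point, provided the
  values involved commute; even superfunctions satisfy this.\<close>

lemma exp_split_commuting:
  fixes a b :: "'a::{real_normed_algebra_1,banach}"
  assumes "a * b = b * a"
  shows "exp a = exp (a - b) * exp b"
  using exp_add_commuting [of "a - b" b] assms by (simp add: algebra_simps)

lemma has_vector_derivative_exp_commuting:
  fixes g :: "real \<Rightarrow> 'a::{real_normed_algebra_1,banach}"
  assumes g: "(g has_vector_derivative d) (at t)"
    and comm: "eventually (\<lambda>s. g s * g t = g t * g s) (nhds t)"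
  shows "((\<lambda>s. exp (g s)) has_vector_derivative d * exp (g t)) (at t)"
proof -
  have "((\<lambda>s. g s - g t) has_vector_derivative d) (at t)"
    using has_vector_derivative_diff [OF g has_vector_derivative_const] by simp
  then have "((\<lambda>s. g s - g t) has_derivative (\<lambda>h. h *\<^sub>R d)) (at t)"
    by (simp add: has_vector_derivative_def)
  moreover have "(exp has_derivative (\<lambda>h. h)) (at (g t - g t))"
    using has_derivative_exp_0 by simp
  ultimately have "((\<lambda>s. exp (g s - g t)) has_derivative (\<lambda>h. h *\<^sub>R d)) (at t)"
    by (rule has_derivative_compose [where g = exp])
  then have "((\<lambda>s. exp (g s - g t)) has_vector_derivative d) (at t)"
    by (simp add: has_vector_derivative_def)
  then have "((\<lambda>s. exp (g s - g t) * exp (g t)) has_vector_derivative d * exp (g t)) (at t)"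
    using has_vector_derivative_mult [OF _ has_vector_derivative_const, of _ d t UNIV "exp (g t)"] by simp
  moreover have "eventually (\<lambda>s. exp (g s - g t) * exp (g t) = exp (g s)) (nhds t)"
    using comm by eventually_elim (simp add: exp_split_commuting [symmetric])
  ultimately show ?thesis
    using has_vector_derivative_cong_ev [where S = UNIV and x = t and f = "\<lambda>s. exp (g s - g t) * exp (g t)" and g = "\<lambda>s. exp (g s)"]
    by (simp add: eventually_nhds_x_imp_x)
qed

lemma continuous_on_exp_commuting:
  fixes g :: "'b::topological_space \<Rightarrow> 'a::{real_normed_algebra_1,banach}"
  assumes "continuous_on V g" "\<And>x y. x \<in> V \<Longrightarrow> y \<in> V \<Longrightarrow> g x * g y = g y * g x"
  shows "continuous_on V (\<lambda>x. exp (g x))"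
  unfolding continuous_on_def
proof
  fix x
  assume x: "x \<in> V"
  have "((\<lambda>y. g y - g x) \<longlongrightarrow> 0) (at x within V)"
    using assms(1) x by (simp add: continuous_on_def LIM_zero_iff)
  moreover have "isCont exp (0 :: 'a)"
    using has_derivative_continuous [OF has_derivative_exp_0] by simp
  ultimately have "((\<lambda>y. exp (g y - g x)) \<longlongrightarrow> exp 0) (at x within V)"
    by (rule isCont_tendsto_compose [rotated])
  then have "((\<lambda>y. exp (g y - g x) * exp (g x)) \<longlongrightarrow> exp 0 * exp (g x)) (at x within V)"
    by (intro tendsto_intros)
  moreover have "exp (g y - g x) * exp (g x) = exp (g y)" if "y \<in> V" for y
    using exp_split_commuting [OF assms(2) [OF that x]] by simp
  then have "eventually (\<lambda>y. exp (g y - g x) * exp (g x) = exp (g y)) (at x within V)"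
    by (auto simp: eventually_at_filter)
  ultimately show "((\<lambda>y. exp (g y)) \<longlongrightarrow> exp (g x)) (at x within V)"
    by (simp add: Lim_transform_eventually)
qed

lemma coeff_exp_sums: "(\<lambda>n. coeff (z ^ n) A / fact n) sums coeff (exp z) A"
  using bounded_linear.sums [OF bounded_linear_coeff exp_converges [of z], of A] by (simp add: divide_inverse mult.commute)

lemma coeff_exp_eq_0: "(\<And>n. coeff (z ^ n) A = 0) \<Longrightarrow> coeff (exp z) A = 0"
  using coeff_exp_sums [of z A] sums_unique2 [OF _ sums_zero] by auto

lemma body_power: "body (z ^ n) = body z ^ n"
  by (induction n) (simp_all add: body_mult, simp add: body_def coeff_one)

lemma body_exp: "body (exp z) = exp (body z)"
proof -
  have "(\<lambda>n. body (z ^ n) / fact n) sums body (exp z)"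
    unfolding body_def by (rule coeff_exp_sums)
  moreover have "(\<lambda>n. body (z ^ n) / fact n) sums exp (body z)"
    using exp_converges [of "body z"] by (simp add: body_power divide_inverse mult.commute)
  ultimately show ?thesis by (rule sums_unique2)
qed

lemma homogeneous_power: "homogeneous 0 g \<Longrightarrow> homogeneous 0 (g ^ n)"
  by (induction n) (use homogeneous_1 homogeneous_mult [of 0 _ 0] in auto)

lemma homogeneous_exp:
  assumes "homogeneous 0 g"
  shows "homogeneous 0 (exp g)"
proof -
  have "coeff (exp g) A = 0" if "odd (card A)" for A
    by (rule coeff_exp_eq_0) (use homogeneous_power [OF assms] that in \<open>auto simp: homogeneous_def\<close>)
  then show ?thesis by (auto simp: homogeneous_def)
qed

lemma even_commute: "homogeneous 0 g \<Longrightarrow> homogeneous n h \<Longrightarrow> g * h = h * g"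
  using homogeneous_commute [of 0 g n h] by simp

lemma exp_inverse_left: "exp (- g) * exp g = (1 :: 'a::{real_normed_algebra_1,banach})"
  using exp_add_commuting [of "- g" g] by simp

text \<open>Factor \<open>exp z - 1\<close> as \<open>q * z\<close>. The body of \<open>z\<close> is
  zero because the real exponential is injective, so \<open>q\<close> has body 1 and can be
  cancelled.\<close>

lemma exp_eq_1_grass:
  fixes z :: "'i::{finite,linorder} grass"
  assumes "exp z = 1"
  shows "z = 0"
proof -
  define q where "q = (\<Sum>n. inverse (fact (Suc n)) *\<^sub>R z ^ n)"
  have b0: "body z = 0"
    using arg_cong [OF assms, of body] by (simp add: body_exp) (simp add: body_def coeff_one)
  have s: "summable (\<lambda>n. inverse (fact (Suc n)) *\<^sub>R z ^ n)"
  proof (rule summable_comparison_test' [where N = 0])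
    show "summable (\<lambda>n. norm (z ^ n /\<^sub>R fact n))"
      by (rule summable_norm_exp)
    show "norm (inverse (fact (Suc n)) *\<^sub>R z ^ n) \<le> norm (z ^ n /\<^sub>R fact n)" for n
    proof -
      have "inverse (fact (Suc n)) \<le> (inverse (fact n) :: real)"
        by (intro le_imp_inverse_le fact_mono) auto
      then show ?thesis
        unfolding norm_scaleR by (intro mult_right_mono) (auto simp del: fact_Suc)
    qed
  qed
  have "exp z = 1 + q * z"
    unfolding exp_first_term [of z] q_def suminf_mult2 [OF s] by (simp add: power_commutes mult.commute)
  then have "q * z = 0"
    using assms by simp
  moreover have "body q = (\<Sum>n. inverse (fact (Suc n)) * body z ^ n)"
    using bounded_linear.suminf [OF bounded_linear_coeff s, of "{}"]
    using body_power [of z] by (simp add: q_def body_def)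
  then have "body q = 1"
    using powser_zero [of "\<lambda>n. inverse (fact (Suc n)) :: real"] by (simp add: b0)
  ultimately show ?thesis
    by (intro grass_mult_left_cancel [of q z]) auto
qed

text \<open>Evenness makes \<open>g\<close> and \<open>h\<close> commute, so
  \<open>exp (g - h) = 1\<close>. This makes the logarithm of a ratio of volume forms
  unique.\<close>

theorem exp_inject_even:
  fixes g h :: "'i::{finite,linorder} grass"
  assumes "homogeneous 0 g" "homogeneous 0 h" "exp g = exp h"
  shows "g = h"
proof -
  have "g * - h = - h * g"
    using even_commute [OF assms(1,2)] by simp
  then have "exp (g + - h) = exp g * exp (- h)"
    by (rule exp_add_commuting)
  also have "\<dots> = 1"
    using exp_inverse_left [of "- h"] by (simp add: assms(3))
  finally show ?thesis
    using exp_eq_1_grass [of "g - h"] by simp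
qed

lemma dtheta_1: "dtheta a 1 = 0"
  by (rule grass_eqI) (simp add: coeff_dtheta coeff_one)

lemma dtheta_power_Suc:
  fixes a :: "'i::{finite,linorder}"
  assumes g: "homogeneous 0 g"
  shows "dtheta a (g ^ Suc n) = real (Suc n) *\<^sub>R (dtheta a g * g ^ n)"
proof (induction n)
  case (Suc n)
  have "g * dtheta a g = dtheta a g * g"
    by (rule even_commute [OF g homogeneous_dtheta [OF g]])
  then have "g * (dtheta a g * g ^ n) = dtheta a g * g ^ Suc n"
    by (simp flip: mult.assoc)
  then have "dtheta a (g ^ Suc (Suc n)) = dtheta a g * g ^ Suc n + real (Suc n) *\<^sub>R (dtheta a g * g ^ Suc n)"
    using Suc by (simp only: power_Suc [of g "Suc n"] dtheta_mult [OF g] sg_simps mult_scaleR_right)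
  then show ?case
    by (simp only: of_nat_Suc scaleR_add_left scaleR_one add.commute)
qed (use dtheta_mult [OF g, of a 1] in \<open>simp add: dtheta_1\<close>)

text \<open>Differentiate the exponential series term by term. The constant term vanishes, so the
  index shifts by one and turns \<open>n / n!\<close> into \<open>1 / (n - 1)!\<close>.\<close>

theorem dtheta_exp:
  fixes a :: "'i::{finite,linorder}"
  assumes g: "homogeneous 0 g"
  shows "dtheta a (exp g) = dtheta a g * exp g"
proof -
  have "(\<lambda>n. dtheta a (g ^ n /\<^sub>R fact n)) sums dtheta a (exp g)"
    by (rule bounded_linear.sums [OF bounded_linear_grass [OF linear_dtheta] exp_converges])
  moreover have "dtheta a (g ^ 0 /\<^sub>R fact 0) = 0"
    by (simp add: dtheta_1)
  ultimately have "(\<lambda>n. dtheta a (g ^ Suc n /\<^sub>R fact (Suc n))) sums dtheta a (exp g)"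
    by (subst sums_Suc_iff) (simp del: power_0 fact_0)
  moreover have "dtheta a (g ^ Suc n /\<^sub>R fact (Suc n)) = dtheta a g * (g ^ n /\<^sub>R fact n)" for n
  proof -
    have "inverse (fact (Suc n)) * real (Suc n) = inverse (fact n)"
      by (simp add: divide_simps)
    then show ?thesis
      unfolding dtheta_scaleR dtheta_power_Suc [OF g] scaleR_scaleR by (simp only: mult_scaleR_right)
  qed
  moreover have "(\<lambda>n. dtheta a g * (g ^ n /\<^sub>R fact n)) sums (dtheta a g * exp g)"
    by (intro sums_mult exp_converges)
  ultimately show ?thesis
    by (simp only: sums_unique2)
qed

text \<open>Schwarz's theorem through the second difference over a small square: two mean value
  steps, taken in either order, express it by one or the other mixed derivative at a point of the
  square, and continuity at the origin compares them there.\<close>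

lemma mixed_partials_commute:
  fixes \<phi> \<phi>1 \<phi>2 \<phi>12 \<phi>21 :: "real \<Rightarrow> real \<Rightarrow> real"
  assumes e: "e > 0"
    and d1: "\<And>s t. \<bar>s\<bar> < e \<Longrightarrow> \<bar>t\<bar> < e \<Longrightarrow> ((\<lambda>s. \<phi> s t) has_real_derivative \<phi>1 s t) (at s)"
    and d2: "\<And>s t. \<bar>s\<bar> < e \<Longrightarrow> \<bar>t\<bar> < e \<Longrightarrow> ((\<lambda>t. \<phi> s t) has_real_derivative \<phi>2 s t) (at t)"
    and d12: "\<And>s t. \<bar>s\<bar> < e \<Longrightarrow> \<bar>t\<bar> < e \<Longrightarrow> ((\<lambda>t. \<phi>1 s t) has_real_derivative \<phi>12 s t) (at t)"
    and d21: "\<And>s t. \<bar>s\<bar> < e \<Longrightarrow> \<bar>t\<bar> < e \<Longrightarrow> ((\<lambda>s. \<phi>2 s t) has_real_derivative \<phi>21 s t) (at s)"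
    and c12: "isCont (\<lambda>(s, t). \<phi>12 s t) (0, 0)"
    and c21: "isCont (\<lambda>(s, t). \<phi>21 s t) (0, 0)"
  shows "\<phi>12 0 0 = \<phi>21 0 0"
proof (rule ccontr)
  have second_difference: "\<exists>\<xi> \<eta>. 0 < \<xi> \<and> \<xi> < h \<and> 0 < \<eta> \<and> \<eta> < h \<and>
      \<psi> h h - \<psi> 0 h - (\<psi> h 0 - \<psi> 0 0) = h * (h * \<psi>12 \<xi> \<eta>)"
    if h: "0 < h" "h < e"
      and d1: "\<And>s t. \<bar>s\<bar> < e \<Longrightarrow> \<bar>t\<bar> < e \<Longrightarrow> ((\<lambda>s. \<psi> s t) has_real_derivative \<psi>1 s t) (at s)"
      and d12: "\<And>s t. \<bar>s\<bar> < e \<Longrightarrow> \<bar>t\<bar> < e \<Longrightarrow> ((\<lambda>t. \<psi>1 s t) has_real_derivative \<psi>12 s t) (at t)"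
    for h and \<psi> \<psi>1 \<psi>12 :: "real \<Rightarrow> real \<Rightarrow> real"
  proof -
    have "((\<lambda>s. \<psi> s h - \<psi> s 0) has_real_derivative \<psi>1 s h - \<psi>1 s 0) (at s)" if "0 \<le> s" "s \<le> h" for s
      using that h by (intro DERIV_diff d1) auto
    from MVT2 [OF h(1) this] obtain \<xi> where \<xi>: "0 < \<xi>" "\<xi> < h"
      "\<psi> h h - \<psi> h 0 - (\<psi> 0 h - \<psi> 0 0) = h * (\<psi>1 \<xi> h - \<psi>1 \<xi> 0)" by auto
    have "((\<lambda>t. \<psi>1 \<xi> t) has_real_derivative \<psi>12 \<xi> t) (at t)" if "0 \<le> t" "t \<le> h" for t
      using that h \<xi> by (intro d12) auto
    from MVT2 [OF h(1) this] obtain \<eta> where "0 < \<eta>" "\<eta> < h" "\<psi>1 \<xi> h - \<psi>1 \<xi> 0 = h * \<psi>12 \<xi> \<eta>" by auto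
    then show ?thesis using \<xi> by (intro exI [of _ \<xi>] exI [of _ \<eta>]) auto
  qed
  assume neq: "\<phi>12 0 0 \<noteq> \<phi>21 0 0"
  \<comment> \<open>Half the supposed gap, so that two equal numbers cannot lie within
    \<open>r\<close> of the two values.\<close>
  define r where "r = \<bar>\<phi>12 0 0 - \<phi>21 0 0\<bar> / 2"
  have r: "r > 0" using neq by (simp add: r_def)
  obtain d where d: "d > 0" "\<And>s t. dist (s, t) (0, 0) < d \<Longrightarrow> \<bar>\<phi>12 s t - \<phi>12 0 0\<bar> < r"
    using c12 r unfolding continuous_at_eps_delta by (fastforce simp: dist_real_def)
  obtain d' where d': "d' > 0" "\<And>s t. dist (s, t) (0, 0) < d' \<Longrightarrow> \<bar>\<phi>21 s t - \<phi>21 0 0\<bar> < r"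
    using c21 r unfolding continuous_at_eps_delta by (fastforce simp: dist_real_def)
  \<comment> \<open>With this side length all points of the open square have distance less than
    \<open>2 * h\<close> from the origin, within both continuity radii.\<close>
  define h where "h = min e (min d d') / 2"
  have h: "0 < h" "h < e" "2 * h \<le> d" "2 * h \<le> d'"
    using e d d' by (auto simp: h_def)
  have small: "dist (s, t) (0, 0) < 2 * h" if "0 < s" "s < h" "0 < t" "t < h" for s t :: real
    using that sqrt_sum_squares_le_sum_abs [of s t] by (simp add: dist_prod_def dist_real_def)
  obtain \<xi> \<eta> where 1: "0 < \<xi>" "\<xi> < h" "0 < \<eta>" "\<eta> < h"
    "\<phi> h h - \<phi> 0 h - (\<phi> h 0 - \<phi> 0 0) = h * (h * \<phi>12 \<xi> \<eta>)"
    using second_difference [OF h(1,2) d1 d12] by blast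
  obtain \<eta>' \<xi>' where 2: "0 < \<eta>'" "\<eta>' < h" "0 < \<xi>'" "\<xi>' < h"
    "\<phi> h h - \<phi> h 0 - (\<phi> 0 h - \<phi> 0 0) = h * (h * \<phi>21 \<xi>' \<eta>')"
    using second_difference [OF h(1,2), of "\<lambda>t s. \<phi> s t" "\<lambda>t s. \<phi>2 s t" "\<lambda>t s. \<phi>21 s t"] d2 d21 by blast
  have "h * (h * \<phi>12 \<xi> \<eta>) = h * (h * \<phi>21 \<xi>' \<eta>')"
    using 1(5) 2(5) by linarith
  then have "\<phi>12 \<xi> \<eta> = \<phi>21 \<xi>' \<eta>'"
    using h(1) by simp
  moreover have "\<bar>\<phi>12 \<xi> \<eta> - \<phi>12 0 0\<bar> < r"
    by (rule d(2)) (use small [OF 1(1-4)] h in linarith)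
  moreover have "\<bar>\<phi>21 \<xi>' \<eta>' - \<phi>21 0 0\<bar> < r"
    by (rule d'(2)) (use small [OF 2(3,4,1,2)] h in linarith)
  ultimately show False unfolding r_def by (auto simp: abs_if split: if_splits)
qed

section \<open>Superfunctions on a superdomain\<close>

text \<open>The Grassmann algebra has a generator for every index; this excludes the generators of
  even index, as \<open>superfun_on\<close> does pointwise.\<close>

definition supported :: "('i \<Rightarrow> nat) \<Rightarrow> 'i grass \<Rightarrow> bool" where
  "supported par g \<longleftrightarrow> (\<forall>A. coeff g A \<noteq> 0 \<longrightarrow> (\<forall>a\<in>A. odd (par a)))"

lemma supported_iff: "supported par g \<longleftrightarrow> (\<forall>A. (\<exists>a\<in>A. even (par a)) \<longrightarrow> coeff g A = 0)"
  by (auto simp: supported_def)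

lemma supported_0: "supported par 0"
  by (simp add: supported_def)

lemma supported_1: "supported par 1"
  by (simp add: supported_def coeff_one)

lemma supported_add: "supported par g \<Longrightarrow> supported par h \<Longrightarrow> supported par (g + h)"
  by (simp add: supported_iff)

lemma supported_mult:
  assumes "supported par g" "supported par h"
  shows "supported par (g * h)"
  unfolding supported_iff
proof (intro allI impI)
  fix C
  assume "\<exists>a\<in>C. even (par a)"
  then have "coeff g A = 0 \<or> coeff h (C - A) = 0" for A
    using assms unfolding supported_def by (metis DiffI)
  then show "coeff (g * h) C = 0"
    by (auto simp: coeff_mult intro!: sum.neutral)
qed

lemma supported_power: "supported par g \<Longrightarrow> supported par (g ^ n)"
  by (induction n) (auto intro: supported_mult supported_1)

lemma supported_exp: "supported par g \<Longrightarrow> supported par (exp g)"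
  unfolding supported_iff by (auto intro!: coeff_exp_eq_0 supported_power [unfolded supported_iff, rule_format])

lemma supported_dtheta:
  fixes a :: "'i::{finite,linorder}"
  shows "supported par g \<Longrightarrow> supported par (dtheta a g)"
  unfolding supported_iff by (auto simp: coeff_dtheta)

lemma has_vector_derivative_coeff:
  assumes "(f has_vector_derivative d) F"
  shows "((\<lambda>t. coeff (f t) A) has_vector_derivative coeff d A) F"
  by (rule bounded_linear.has_vector_derivative [OF bounded_linear_coeff assms])

definition line_differentiable :: "'i \<Rightarrow> 'i::{finite,linorder} superfun \<Rightarrow> 'i point \<Rightarrow> bool" where
  "line_differentiable a f x \<longleftrightarrow> (\<lambda>t. f (x + t *\<^sub>R axis a 1)) differentiable at 0"

lemma has_vector_derivative_line:
  assumes "even (par a)" "line_differentiable a f x"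
  shows "((\<lambda>t. f (x + t *\<^sub>R axis a 1)) has_vector_derivative pd par a f x) (at 0)"
  using assms by (simp add: pd_def line_differentiable_def vector_derivative_works)

lemma pd_eqI:
  assumes "even (par a)" "((\<lambda>t. f (x + t *\<^sub>R axis a 1)) has_vector_derivative d) (at 0)"
  shows "pd par a f x = d" "line_differentiable a f x"
  using assms by (auto simp: pd_def vector_derivative_at line_differentiable_def differentiableI_vector)

lemma pd_odd: "odd (par a) \<Longrightarrow> pd par a f x = dtheta a (f x)"
  by (simp add: pd_def)

text \<open>Smoothness up to a finite order, with the innermost derivative split off first. Closure
  under products and exponentials then follows by induction on the order, without formulas for
  iterated derivatives.\<close>

fun smooth_on :: "('i \<Rightarrow> nat) \<Rightarrow> 'i point set \<Rightarrow> nat \<Rightarrow> 'i::{finite,linorder} superfun \<Rightarrow> bool" where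
  "smooth_on par V 0 f \<longleftrightarrow> (\<forall>x\<in>V. supported par (f x)) \<and> continuous_on V f"
| "smooth_on par V (Suc k) f \<longleftrightarrow> (\<forall>x\<in>V. supported par (f x)) \<and> continuous_on V f \<and>
     (\<forall>a. even (par a) \<longrightarrow> (\<forall>x\<in>V. line_differentiable a f x) \<and> smooth_on par V k (pd par a f))"

locale superdomain =
  fixes par :: "'i::{finite,linorder} \<Rightarrow> nat" and V :: "'i point set"
  assumes openin_V: "openin (top_of_set (even_space par)) V"
begin

lemma eventually_line:
  assumes "x \<in> V" "even (par a)"
  shows "eventually (\<lambda>t. x + t *\<^sub>R axis a 1 \<in> V) (nhds 0)"
proof -
  obtain U where U: "open U" "V = even_space par \<inter> U"
    using openin_V by (auto simp: openin_open)
  have "((\<lambda>t. x + t *\<^sub>R axis a 1) \<longlongrightarrow> x + 0 *\<^sub>R axis a (1 :: real)) (nhds 0)"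
    by (intro tendsto_intros filterlim_ident)
  then have "eventually (\<lambda>t. x + t *\<^sub>R axis a 1 \<in> U) (nhds 0)"
    using U assms(1) by (intro topological_tendstoD) auto
  moreover have "x + t *\<^sub>R axis a 1 \<in> even_space par" for t
    using U assms by (auto simp: even_space_def axis_def)
  ultimately show ?thesis
    by (simp add: U(2))
qed

text \<open>Even coordinate lines stay in the relatively open set \<open>V\<close> for small times,
  and odd derivatives are pointwise; hence the values outside \<open>V\<close> do not
  matter.\<close>

lemma pd_cong:
  assumes "\<And>y. y \<in> V \<Longrightarrow> f y = g y" "x \<in> V"
  shows "pd par a f x = pd par a g x"
proof (cases "even (par a)")
  case True
  have "eventually (\<lambda>t. f (x + t *\<^sub>R axis a 1) = g (x + t *\<^sub>R axis a 1)) (nhds 0)"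
    using eventually_line [OF assms(2) True] by eventually_elim (rule assms(1))
  then show ?thesis
    using True unfolding pd_def by (auto intro!: vector_derivative_cong_eq)
qed (use assms in \<open>simp add: pd_def\<close>)

lemma line_differentiable_cong:
  assumes "\<And>y. y \<in> V \<Longrightarrow> f y = g y" "x \<in> V" "even (par a)" "line_differentiable a f x"
  shows "line_differentiable a g x"
proof -
  have "eventually (\<lambda>t. f (x + t *\<^sub>R axis a 1) = g (x + t *\<^sub>R axis a 1)) (nhds 0)"
    using eventually_line [OF assms(2,3)] by eventually_elim (rule assms(1))
  then show ?thesis
    using has_vector_derivative_line [of par a f x, OF assms(3,4)] eventually_nhds_x_imp_x
      has_vector_derivative_cong_ev [where S = UNIV and x = 0 and f = "\<lambda>t. f (x + t *\<^sub>R axis a 1)"]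
    by (intro pd_eqI(2) [of par a g x "pd par a f x"] assms(3)) fastforce
qed

lemma smooth_on_cong:
  assumes "\<And>y. y \<in> V \<Longrightarrow> f y = g y" "smooth_on par V k f"
  shows "smooth_on par V k g"
  using assms
proof (induction k arbitrary: f g)
  case 0
  have "supported par (g x)" if "x \<in> V" for x
    using 0 that by (metis smooth_on.simps(1))
  moreover have "continuous_on V g"
    using continuous_on_eq [of V f g] 0 by auto
  ultimately show ?case by simp
next
  case (Suc k)
  have "supported par (g x)" if "x \<in> V" for x
    using Suc.prems that by (metis smooth_on.simps(2))
  moreover have "continuous_on V g"
    using continuous_on_eq [of V f g] Suc.prems by auto
  moreover have "line_differentiable a g x" if "even (par a)" "x \<in> V" for a x
    by (rule line_differentiable_cong [OF Suc.prems(1) that(2,1)]) (use Suc.prems(2) that in auto)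
  moreover have "smooth_on par V k (pd par a g)" if "even (par a)" for a
    by (rule Suc.IH [of "pd par a f"], rule pd_cong [OF Suc.prems(1)]) (use Suc.prems(2) that in auto)
  ultimately show ?case by simp
qed

lemma smooth_on_SucI:
  assumes "\<And>x. x \<in> V \<Longrightarrow> supported par (f x)" "continuous_on V f"
    and "\<And>a x. even (par a) \<Longrightarrow> x \<in> V \<Longrightarrow> line_differentiable a f x"
    and "\<And>a. even (par a) \<Longrightarrow> smooth_on par V k (pd par a f)"
  shows "smooth_on par V (Suc k) f"
  using assms by simp

lemma smooth_on_supported: "smooth_on par V k f \<Longrightarrow> x \<in> V \<Longrightarrow> supported par (f x)"
  by (cases k) auto

lemma smooth_on_continuous: "smooth_on par V k f \<Longrightarrow> continuous_on V f"
  by (cases k) auto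

lemma smooth_on_SucD:
  assumes "smooth_on par V (Suc k) f" "even (par a)"
  shows "smooth_on par V k (pd par a f)" "x \<in> V \<Longrightarrow> line_differentiable a f x"
  using assms by simp_all

lemma smooth_on_Suc: "smooth_on par V (Suc k) f \<Longrightarrow> smooth_on par V k f"
proof (induction k arbitrary: f)
  case (Suc k)
  show ?case
    using Suc.IH [OF smooth_on_SucD(1) [OF Suc.prems]] smooth_on_SucD(2) [OF Suc.prems]
      smooth_on_supported [OF Suc.prems] smooth_on_continuous [OF Suc.prems] by simp
qed simp

text \<open>\<open>superfun_on\<close> restricts the generators only for \<open>f\<close> itself.
  Derivatives inherit the restriction, because a coefficient that vanishes on \<open>V\<close>
  vanishes along short even coordinate lines.\<close>

lemma superfun_on_foldr:
  assumes "superfun_on par V f" "\<forall>a\<in>set w. even (par a)"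
  shows "\<forall>x\<in>V. supported par (foldr (pd par) w f x)"
  using assms(2)
proof (induction w)
  case Nil
  then show ?case using assms(1) by (auto simp: superfun_on_def supported_def)
next
  case (Cons a w)
  let ?g = "foldr (pd par) w f"
  show ?case
  proof
    fix x
    assume x: "x \<in> V"
    have "line_differentiable a ?g x"
      using Cons.prems assms(1) x by (simp add: superfun_on_def line_differentiable_def)
    then have d: "((\<lambda>t. ?g (x + t *\<^sub>R axis a 1)) has_vector_derivative pd par a ?g x) (at 0)"
      using Cons.prems by (intro has_vector_derivative_line) auto
    have "coeff (pd par a ?g x) A = 0" if A: "\<exists>b\<in>A. even (par b)" for A
    proof -
      have "eventually (\<lambda>t. coeff (?g (x + t *\<^sub>R axis a 1)) A = 0) (nhds 0)"
        using eventually_line [OF x, of a] Cons.prems Cons.IH A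
        by (auto elim!: eventually_mono simp: supported_iff)
      then have "((\<lambda>t. coeff (?g (x + t *\<^sub>R axis a 1)) A) has_vector_derivative 0) (at 0)"
        using has_vector_derivative_const [of "0 :: real" "at 0"] eventually_nhds_x_imp_x
          has_vector_derivative_cong_ev [where S = UNIV and x = 0 and g = "\<lambda>_. 0" and f = "\<lambda>t. coeff (?g (x + t *\<^sub>R axis a 1)) A"]
        by fastforce
      then show ?thesis
        using has_vector_derivative_coeff [OF d, of A] vector_derivative_unique_at by blast
    qed
    then show "supported par (foldr (pd par) (a # w) f x)"
      by (simp add: supported_iff)
  qed
qed

lemma superfun_on_pd_even:
  assumes "superfun_on par V f" "even (par a)"
  shows "superfun_on par V (pd par a f)"
proof -
  have *: "foldr (pd par) w (pd par a f) = foldr (pd par) (w @ [a]) f" for w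
    by simp
  have "continuous_on V (foldr (pd par) w (pd par a f)) \<and>
      (\<forall>x\<in>V. \<forall>b. even (par b) \<longrightarrow>
        (\<lambda>t. foldr (pd par) w (pd par a f) (x + t *\<^sub>R axis b 1)) differentiable at 0)"
    if "\<forall>b\<in>set w. even (par b)" for w
  proof -
    have "\<forall>b\<in>set (w @ [a]). even (par b)"
      using that assms(2) by auto
    then show ?thesis
      unfolding * using assms(1) unfolding superfun_on_def by blast
  qed
  moreover have "\<forall>x\<in>V. supported par (pd par a f x)"
    using superfun_on_foldr [OF assms(1), of "[a]"] assms(2) by simp
  ultimately show ?thesis
    by (simp add: superfun_on_def supported_def)
qed

theorem superfun_on_iff_smooth_on: "superfun_on par V f \<longleftrightarrow> (\<forall>k. smooth_on par V k f)"
proof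
  have sc: "(\<forall>x\<in>V. supported par (f x)) \<and> continuous_on V f \<and>
      (\<forall>a. even (par a) \<longrightarrow> (\<forall>x\<in>V. line_differentiable a f x))" if f: "superfun_on par V f" for f
  proof -
    have "\<forall>w. (\<forall>a\<in>set w. even (par a)) \<longrightarrow> continuous_on V (foldr (pd par) w f) \<and>
        (\<forall>x\<in>V. \<forall>a. even (par a) \<longrightarrow> line_differentiable a (foldr (pd par) w f) x)"
      using f by (simp add: superfun_on_def line_differentiable_def)
    from this [rule_format, of "[]"] show ?thesis
      using superfun_on_foldr [OF f, of "[]"] by simp
  qed
  have "smooth_on par V k f" if "superfun_on par V f" for k f
    using that
  proof (induction k arbitrary: f)
    case 0
    then show ?case using sc [OF 0] by simp
  next
    case (Suc k)
    then show ?case using sc [OF Suc.prems] superfun_on_pd_even by simp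
  qed
  then show "superfun_on par V f \<Longrightarrow> \<forall>k. smooth_on par V k f" by blast
next
  assume f: "\<forall>k. smooth_on par V k f"
  have *: "\<forall>k. smooth_on par V k (foldr (pd par) w f)" if "\<forall>a\<in>set w. even (par a)" for w
    using that
  proof (induction w)
    case (Cons a w)
    then show ?case using smooth_on_SucD(1) by (simp del: smooth_on.simps)
  qed (use f in simp)
  have S: "smooth_on par V (Suc 0) (foldr (pd par) w f)" if "\<forall>a\<in>set w. even (par a)" for w
    using * [OF that] by (rule spec)
  show "superfun_on par V f"
    unfolding superfun_on_def line_differentiable_def [symmetric]
    using smooth_on_supported [OF f [rule_format, of 0], unfolded supported_def]
      smooth_on_continuous [OF S] smooth_on_SucD(2) [OF S] by blast
qed

lemma superfun_on_cong:
  assumes "\<And>y. y \<in> V \<Longrightarrow> f y = g y" "superfun_on par V f"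
  shows "superfun_on par V g"
  using assms smooth_on_cong unfolding superfun_on_iff_smooth_on by blast

lemma superfun_on_line_differentiable:
  assumes "superfun_on par V f" "x \<in> V" "even (par a)"
  shows "line_differentiable a f x"
  using assms unfolding superfun_on_iff_smooth_on by (auto dest: spec [of _ "Suc 0"])

lemma superfun_on_continuous: "superfun_on par V f \<Longrightarrow> continuous_on V f"
  unfolding superfun_on_iff_smooth_on using smooth_on_continuous by blast

lemma pd_add:
  assumes "even (par a) \<Longrightarrow> line_differentiable a f x" "even (par a) \<Longrightarrow> line_differentiable a g x"
  shows "pd par a (\<lambda>x. f x + g x) x = pd par a f x + pd par a g x"
    and "even (par a) \<Longrightarrow> line_differentiable a (\<lambda>x. f x + g x) x"
proof -
  have *: "((\<lambda>t. f (x + t *\<^sub>R axis a 1) + g (x + t *\<^sub>R axis a 1)) has_vector_derivative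
      pd par a f x + pd par a g x) (at 0)" if "even (par a)"
    using assms that by (intro has_vector_derivative_add has_vector_derivative_line) auto
  show "pd par a (\<lambda>x. f x + g x) x = pd par a f x + pd par a g x"
  proof (cases "even (par a)")
    case True
    show ?thesis by (rule pd_eqI(1) [of par a "\<lambda>x. f x + g x" x, OF True * [OF True]])
  qed (simp add: pd_odd dtheta_add)
  show "line_differentiable a (\<lambda>x. f x + g x) x" if "even (par a)"
    by (rule pd_eqI(2) [of par a "\<lambda>x. f x + g x" x, OF that * [OF that]])
qed

lemma pd_mult_even:
  assumes "even (par a)" "line_differentiable a f x" "line_differentiable a g x"
  shows "pd par a (\<lambda>x. f x * g x) x = pd par a f x * g x + f x * pd par a g x"
    and "line_differentiable a (\<lambda>x. f x * g x) x"
proof -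
  have *: "((\<lambda>t. f (x + t *\<^sub>R axis a 1) * g (x + t *\<^sub>R axis a 1)) has_vector_derivative
      pd par a f x * g x + f x * pd par a g x) (at 0)"
    using has_vector_derivative_mult [OF has_vector_derivative_line [of par a f x, OF assms(1,2)] has_vector_derivative_line [of par a g x, OF assms(1,3)]]
    by (simp add: add.commute)
  show "pd par a (\<lambda>x. f x * g x) x = pd par a f x * g x + f x * pd par a g x"
    "line_differentiable a (\<lambda>x. f x * g x) x"
    by (rule pd_eqI [of par a "\<lambda>x. f x * g x" x, OF assms(1) *])+
qed

lemma pd_mult:
  assumes "even (par a) \<Longrightarrow> line_differentiable a f x" "even (par a) \<Longrightarrow> line_differentiable a g x"
    and "homogeneous m (f x)"
  shows "pd par a (\<lambda>x. f x * g x) x = pd par a f x * g x + sg (par a * m) (f x * pd par a g x)"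
proof (cases "even (par a)")
  case True
  then show ?thesis using pd_mult_even(1) [OF True] assms(1,2) by (simp add: sg_def)
next
  case False
  then show ?thesis
    using dtheta_mult [OF assms(3)] by (simp add: pd_odd sg_def)
qed

lemma pd_linear:
  assumes "linear T" "even (par a)" "line_differentiable a f x"
  shows "pd par a (\<lambda>x. T (f x)) x = T (pd par a f x)" "line_differentiable a (\<lambda>x. T (f x)) x"
proof -
  have *: "((\<lambda>t. T (f (x + t *\<^sub>R axis a 1))) has_vector_derivative T (pd par a f x)) (at 0)"
    by (rule bounded_linear.has_vector_derivative [OF bounded_linear_grass [OF assms(1)] has_vector_derivative_line [of par a f x, OF assms(2,3)]])
  show "pd par a (\<lambda>x. T (f x)) x = T (pd par a f x)" "line_differentiable a (\<lambda>x. T (f x)) x"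
    by (rule pd_eqI [of par a "\<lambda>x. T (f x)" x, OF assms(2) *])+
qed

lemma pd_exp:
  assumes "x \<in> V" "\<And>y. y \<in> V \<Longrightarrow> homogeneous 0 (f y)" "even (par a) \<Longrightarrow> line_differentiable a f x"
  shows "pd par a (\<lambda>x. exp (f x)) x = pd par a f x * exp (f x)"
    and "even (par a) \<Longrightarrow> line_differentiable a (\<lambda>x. exp (f x)) x"
proof -
  have *: "((\<lambda>t. exp (f (x + t *\<^sub>R axis a 1))) has_vector_derivative pd par a f x * exp (f x)) (at 0)"
    if even: "even (par a)"
  proof -
    have "eventually (\<lambda>t. f (x + t *\<^sub>R axis a 1) * f (x + 0 *\<^sub>R axis a 1) = f (x + 0 *\<^sub>R axis a 1) * f (x + t *\<^sub>R axis a 1)) (nhds 0)"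
      using eventually_line [OF assms(1) even]
      by eventually_elim (use even_commute [OF assms(2) assms(2)] assms(1) in simp)
    from has_vector_derivative_exp_commuting [OF has_vector_derivative_line [of par a f x, OF even assms(3) [OF even]] this]
    show ?thesis by simp
  qed
  show "pd par a (\<lambda>x. exp (f x)) x = pd par a f x * exp (f x)"
  proof (cases "even (par a)")
    case True
    show ?thesis by (rule pd_eqI(1) [of par a "\<lambda>x. exp (f x)" x, OF True * [OF True]])
  qed (use assms in \<open>simp add: pd_odd dtheta_exp\<close>)
  show "line_differentiable a (\<lambda>x. exp (f x)) x" if "even (par a)"
    by (rule pd_eqI(2) [of par a "\<lambda>x. exp (f x)" x, OF that * [OF that]])
qed

lemma smooth_on_linear:
  assumes T: "linear T" "\<And>g. supported par g \<Longrightarrow> supported par (T g)" and f: "smooth_on par V k f"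
  shows "smooth_on par V k (\<lambda>x. T (f x))"
  using f
proof (induction k arbitrary: f)
  case 0
  then show ?case
    using T(2) bounded_linear.continuous_on [OF bounded_linear_grass [OF T(1)], of V f] by simp
next
  case (Suc k)
  note smooth_on_SucD = smooth_on_SucD [OF Suc.prems]
  show ?case
  proof (rule smooth_on_SucI)
    show "supported par (T (f x))" if "x \<in> V" for x
      by (intro T(2) smooth_on_supported [OF Suc.prems] that)
    show "continuous_on V (\<lambda>x. T (f x))"
      by (intro bounded_linear.continuous_on [OF bounded_linear_grass [OF T(1)]] smooth_on_continuous [OF Suc.prems])
    show "line_differentiable a (\<lambda>x. T (f x)) x" if "even (par a)" "x \<in> V" for a x
      by (intro pd_linear(2) [OF T(1)] smooth_on_SucD that)
    show "smooth_on par V k (pd par a (\<lambda>x. T (f x)))" if a: "even (par a)" for a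
    proof (rule smooth_on_cong)
      show "smooth_on par V k (\<lambda>x. T (pd par a f x))"
        by (intro Suc.IH smooth_on_SucD a)
      show "T (pd par a f x) = pd par a (\<lambda>x. T (f x)) x" if "x \<in> V" for x
        by (intro pd_linear(1) [symmetric, OF T(1) a] smooth_on_SucD a that)
    qed
  qed
qed

lemma smooth_on_add:
  assumes "smooth_on par V k f" "smooth_on par V k g"
  shows "smooth_on par V k (\<lambda>x. f x + g x)"
  using assms
proof (induction k arbitrary: f g)
  case 0
  then show ?case by (auto intro: supported_add continuous_intros)
next
  case (Suc k)
  note f = Suc.prems(1) and g = Suc.prems(2)
  note D = smooth_on_SucD [OF f] smooth_on_SucD [OF g]
  show ?case
  proof (rule smooth_on_SucI)
    show "supported par (f x + g x)" if "x \<in> V" for x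
      by (intro supported_add smooth_on_supported [OF f] smooth_on_supported [OF g] that)
    show "continuous_on V (\<lambda>x. f x + g x)"
      by (intro continuous_intros smooth_on_continuous [OF f] smooth_on_continuous [OF g])
    show "line_differentiable a (\<lambda>x. f x + g x) x" if "even (par a)" "x \<in> V" for a x
      by (intro pd_add(2) D that)
    show "smooth_on par V k (pd par a (\<lambda>x. f x + g x))" if a: "even (par a)" for a
    proof (rule smooth_on_cong)
      show "smooth_on par V k (\<lambda>x. pd par a f x + pd par a g x)"
        by (intro Suc.IH D a)
      show "pd par a f x + pd par a g x = pd par a (\<lambda>x. f x + g x) x" if "x \<in> V" for x
        by (intro pd_add(1) [symmetric] D a that)
    qed
  qed
qed

lemma smooth_on_mult:
  assumes "smooth_on par V k f" "smooth_on par V k g"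
  shows "smooth_on par V k (\<lambda>x. f x * g x)"
  using assms
proof (induction k arbitrary: f g)
  case 0
  then show ?case by (auto intro: supported_mult continuous_intros)
next
  case (Suc k)
  note f = Suc.prems(1) and g = Suc.prems(2)
  note D = smooth_on_SucD [OF f] smooth_on_SucD [OF g]
  show ?case
  proof (rule smooth_on_SucI)
    show "supported par (f x * g x)" if "x \<in> V" for x
      by (intro supported_mult smooth_on_supported [OF f] smooth_on_supported [OF g] that)
    show "continuous_on V (\<lambda>x. f x * g x)"
      by (intro continuous_intros smooth_on_continuous [OF f] smooth_on_continuous [OF g])
    show "line_differentiable a (\<lambda>x. f x * g x) x" if "even (par a)" "x \<in> V" for a x
      by (intro pd_mult_even(2) D that)
    show "smooth_on par V k (pd par a (\<lambda>x. f x * g x))" if a: "even (par a)" for a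
    proof (rule smooth_on_cong)
      show "smooth_on par V k (\<lambda>x. pd par a f x * g x + f x * pd par a g x)"
        by (intro smooth_on_add Suc.IH smooth_on_Suc [OF f] smooth_on_Suc [OF g] D a)
      show "pd par a f x * g x + f x * pd par a g x = pd par a (\<lambda>x. f x * g x) x" if "x \<in> V" for x
        by (intro pd_mult_even(1) [symmetric] D a that)
    qed
  qed
qed

text \<open>The derivative is \<open>pd par a f x * exp (f x)\<close>, a product of functions of one
  order less, where the order of the exponential comes from the induction hypothesis.\<close>

lemma smooth_on_exp:
  assumes "smooth_on par V k f" and even: "\<And>x. x \<in> V \<Longrightarrow> homogeneous 0 (f x)"
  shows "smooth_on par V k (\<lambda>x. exp (f x))"
  using assms(1)
proof (induction k)
  case 0
  then have "continuous_on V (\<lambda>x. exp (f x))"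
    by (intro continuous_on_exp_commuting even_commute [OF even even]) auto
  then show ?case using 0 by (auto intro: supported_exp)
next
  case (Suc k)
  note D = smooth_on_SucD [OF Suc.prems]
  show ?case
  proof (rule smooth_on_SucI)
    show "supported par (exp (f x))" if "x \<in> V" for x
      by (intro supported_exp smooth_on_supported [OF Suc.prems] that)
    show "continuous_on V (\<lambda>x. exp (f x))"
      by (intro continuous_on_exp_commuting even_commute [OF even even] smooth_on_continuous [OF Suc.prems])
    show "line_differentiable a (\<lambda>x. exp (f x)) x" if "even (par a)" "x \<in> V" for a x
      by (rule pd_exp(2) [OF that(2) even D(2) that(1)]) (use that in auto)
    show "smooth_on par V k (pd par a (\<lambda>x. exp (f x)))" if a: "even (par a)" for a
    proof (rule smooth_on_cong)
      show "smooth_on par V k (\<lambda>x. pd par a f x * exp (f x))"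
        by (intro smooth_on_mult Suc.IH smooth_on_Suc [OF Suc.prems] D a)
      show "pd par a f x * exp (f x) = pd par a (\<lambda>x. exp (f x)) x" if "x \<in> V" for x
        by (rule pd_exp(1) [symmetric, OF that even D(2)]) (use a that in auto)
    qed
  qed
qed

lemma pd_const: "even (par a) \<Longrightarrow> pd par a (\<lambda>x. c) x = 0" "even (par a) \<Longrightarrow> line_differentiable a (\<lambda>x. c) x"
  by (rule pd_eqI [of par a "\<lambda>x. c"], assumption, rule has_vector_derivative_const)+

lemma smooth_on_const: "supported par c \<Longrightarrow> smooth_on par V k (\<lambda>x. c)"
proof (induction k arbitrary: c)
  case (Suc k)
  show ?case
  proof (rule smooth_on_SucI)
    show "smooth_on par V k (pd par a (\<lambda>x. c))" if a: "even (par a)" for a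
      by (rule smooth_on_cong [OF _ Suc.IH [OF supported_0]]) (simp add: pd_const(1) [OF a])
  qed (use Suc.prems pd_const(2) in auto)
qed simp

lemma superfun_on_linear:
  "linear T \<Longrightarrow> (\<And>g. supported par g \<Longrightarrow> supported par (T g)) \<Longrightarrow> superfun_on par V f \<Longrightarrow>
    superfun_on par V (\<lambda>x. T (f x))"
  by (simp add: superfun_on_iff_smooth_on smooth_on_linear)

lemma superfun_on_uminus: "superfun_on par V f \<Longrightarrow> superfun_on par V (\<lambda>x. - f x)"
  by (rule superfun_on_linear [where T = uminus]) (auto intro: linearI simp: supported_def)

lemma superfun_on_scaleR: "superfun_on par V f \<Longrightarrow> superfun_on par V (\<lambda>x. r *\<^sub>R f x)"
  by (rule superfun_on_linear [where T = "(*\<^sub>R) r"]) (auto intro: linearI simp: supported_def scaleR_add_right)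

lemma superfun_on_add: "superfun_on par V f \<Longrightarrow> superfun_on par V g \<Longrightarrow> superfun_on par V (\<lambda>x. f x + g x)"
  by (simp add: superfun_on_iff_smooth_on smooth_on_add)

lemma superfun_on_mult: "superfun_on par V f \<Longrightarrow> superfun_on par V g \<Longrightarrow> superfun_on par V (\<lambda>x. f x * g x)"
  by (simp add: superfun_on_iff_smooth_on smooth_on_mult)

lemma superfun_on_exp:
  "superfun_on par V f \<Longrightarrow> (\<And>x. x \<in> V \<Longrightarrow> homogeneous 0 (f x)) \<Longrightarrow> superfun_on par V (\<lambda>x. exp (f x))"
  by (simp add: superfun_on_iff_smooth_on smooth_on_exp)

lemma superfun_on_const: "supported par c \<Longrightarrow> superfun_on par V (\<lambda>x. c)"
  by (simp add: superfun_on_iff_smooth_on smooth_on_const)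

lemma superfun_on_pd:
  assumes "superfun_on par V f"
  shows "superfun_on par V (pd par a f)"
proof (cases "even (par a)")
  case False
  then show ?thesis
    using superfun_on_linear [OF linear_dtheta supported_dtheta assms, of a] by (simp add: pd_def)
qed (use superfun_on_pd_even [OF assms] in auto)

lemma homogeneous_pd:
  assumes "superfun_on par V f" "\<And>y. y \<in> V \<Longrightarrow> homogeneous n (f y)" "x \<in> V"
  shows "homogeneous (n + par a) (pd par a f x)"
proof (cases "even (par a)")
  case True
  have d: "((\<lambda>t. f (x + t *\<^sub>R axis a 1)) has_vector_derivative pd par a f x) (at 0)"
    using superfun_on_line_differentiable [OF assms(1,3) True] by (rule has_vector_derivative_line [of par a f x, OF True])
  have "coeff (pd par a f x) A = 0" if A: "odd (card A + n)" for A
  proof -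
    have "eventually (\<lambda>t. coeff (f (x + t *\<^sub>R axis a 1)) A = 0) (nhds 0)"
      using eventually_line [OF assms(3) True] 
      by eventually_elim (use assms(2) A in \<open>auto simp: homogeneous_def\<close>)
    then have "((\<lambda>t. coeff (f (x + t *\<^sub>R axis a 1)) A) has_vector_derivative 0) (at 0)"
      using has_vector_derivative_const [of "0 :: real" "at 0"] eventually_nhds_x_imp_x
        has_vector_derivative_cong_ev [where S = UNIV and x = 0 and g = "\<lambda>_. 0" and f = "\<lambda>t. coeff (f (x + t *\<^sub>R axis a 1)) A"]
      by fastforce
    then show ?thesis
      using has_vector_derivative_coeff [OF d, of A] vector_derivative_unique_at by blast
  qed
  then show ?thesis
    using True by (fastforce simp: homogeneous_def)
next
  case False
  then show ?thesis
    using homogeneous_parity [OF homogeneous_dtheta [OF assms(2) [OF assms(3)]], of "n + par a" a] by (simp add: pd_odd)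
qed

end

section \<open>Commuting partial derivatives and the graded ring of sections\<close>

context superdomain
begin

lemma pd_commute_even:
  assumes f: "superfun_on par V f" and x: "x \<in> V" and a: "even (par a)" and b: "even (par b)"
  shows "pd par a (pd par b f) x = pd par b (pd par a f) x"
proof (rule grass_eqI)
  fix C
  define g where "g s t = x + s *\<^sub>R axis a 1 + t *\<^sub>R axis b 1" for s t :: real
  obtain U where U: "open U" "V = even_space par \<inter> U"
    using openin_V by (auto simp: openin_open)
  then obtain r where r: "r > 0" "ball x r \<subseteq> U"
    using x open_contains_ball by blast
  \<comment> \<open>The displacement has norm at most the sum of the two moduli, hence half the
    radius for each parameter; even directions do not leave \<open>even_space par\<close>.\<close>
  have gV: "g s t \<in> V" if "\<bar>s\<bar> < r / 2" "\<bar>t\<bar> < r / 2" for s t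
  proof -
    have "dist x (g s t) = norm (s *\<^sub>R axis a (1::real) + t *\<^sub>R axis b 1)"
      by (simp add: g_def dist_norm norm_minus_commute algebra_simps)
    also have "\<dots> \<le> \<bar>s\<bar> + \<bar>t\<bar>"
      by (rule order.trans [OF norm_triangle_ineq]) (simp add: norm_axis_1)
    finally have "g s t \<in> U"
      using that r by (intro subsetD [OF r(2)]) auto
    moreover have "g s t \<in> even_space par"
      using x U a b by (auto simp: g_def even_space_def axis_def)
    ultimately show ?thesis by (simp add: U(2))
  qed
  have cont: "isCont (\<lambda>(s, t). coeff (F (g s t)) C) (0, 0)" if F: "superfun_on par V F" for F
  proof -
    define W where "W = {p :: real \<times> real. \<bar>fst p\<bar> < r / 2 \<and> \<bar>snd p\<bar> < r / 2}"
    have "open W"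
      unfolding W_def by (intro open_Collect_conj open_Collect_less continuous_intros)
    moreover have "continuous_on W (\<lambda>p. coeff (F (g (fst p) (snd p))) C)"
    proof (rule bounded_linear.continuous_on [OF bounded_linear_coeff], rule continuous_on_compose2 [OF superfun_on_continuous [OF F]])
      show "continuous_on W (\<lambda>p. g (fst p) (snd p))"
        unfolding g_def by (intro continuous_intros)
      show "(\<lambda>p. g (fst p) (snd p)) ` W \<subseteq> V"
        using gV by (auto simp: W_def)
    qed
    ultimately show ?thesis
      using r(1) by (auto simp: continuous_on_eq_continuous_at W_def case_prod_beta')
  qed
  have D1: "((\<lambda>s. coeff (F (g s t)) C) has_real_derivative coeff (pd par a F (g s t)) C) (at s)"
    if F: "superfun_on par V F" and st: "\<bar>s\<bar> < r / 2" "\<bar>t\<bar> < r / 2" for F s t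
  proof -
    have "((\<lambda>h. coeff (F (g s t + h *\<^sub>R axis a 1)) C) has_vector_derivative coeff (pd par a F (g s t)) C) (at 0)"
      by (intro has_vector_derivative_coeff has_vector_derivative_line a superfun_on_line_differentiable [OF F] gV st)
    moreover have "g s t + h *\<^sub>R axis a 1 = g (h + s) t" for h
      by (simp add: g_def algebra_simps)
    ultimately show ?thesis
      using DERIV_shift [of "\<lambda>s. coeff (F (g s t)) C" _ 0 s]
      by (simp add: has_real_derivative_iff_has_vector_derivative)
  qed
  have D2: "((\<lambda>t. coeff (F (g s t)) C) has_real_derivative coeff (pd par b F (g s t)) C) (at t)"
    if F: "superfun_on par V F" and st: "\<bar>s\<bar> < r / 2" "\<bar>t\<bar> < r / 2" for F s t
  proof -
    have "((\<lambda>h. coeff (F (g s t + h *\<^sub>R axis b 1)) C) has_vector_derivative coeff (pd par b F (g s t)) C) (at 0)"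
      by (intro has_vector_derivative_coeff has_vector_derivative_line b superfun_on_line_differentiable [OF F] gV st)
    moreover have "g s t + h *\<^sub>R axis b 1 = g s (h + t)" for h
      by (simp add: g_def algebra_simps)
    ultimately show ?thesis
      using DERIV_shift [of "\<lambda>t. coeff (F (g s t)) C" _ 0 t]
      by (simp add: has_real_derivative_iff_has_vector_derivative)
  qed
  note fa = superfun_on_pd [OF f, of a] and fb = superfun_on_pd [OF f, of b]
  have "coeff (pd par b (pd par a f) (g 0 0)) C = coeff (pd par a (pd par b f) (g 0 0)) C"
    by (rule mixed_partials_commute [where e = "r / 2" and \<phi> = "\<lambda>s t. coeff (f (g s t)) C"
          and ?\<phi>1.0 = "\<lambda>s t. coeff (pd par a f (g s t)) C" and ?\<phi>2.0 = "\<lambda>s t. coeff (pd par b f (g s t)) C"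
          and ?\<phi>12.0 = "\<lambda>s t. coeff (pd par b (pd par a f) (g s t)) C" and ?\<phi>21.0 = "\<lambda>s t. coeff (pd par a (pd par b f) (g s t)) C"])
      (use r in \<open>auto intro: D1 [OF f] D2 [OF f] D2 [OF fa] D1 [OF fb] cont superfun_on_pd fa fb\<close>)
  then show "coeff (pd par a (pd par b f) x) C = coeff (pd par b (pd par a f) x) C"
    by (simp add: g_def)
qed

text \<open>Two even indices are Schwarz's theorem for each coefficient. In the mixed case
  \<open>dtheta\<close> is a fixed linear map and passes through the derivative along a line. Two
  odd indices give the anticommutation of \<open>dtheta\<close>.\<close>

theorem pd_commute:
  assumes f: "superfun_on par V f" and x: "x \<in> V"
  shows "pd par a (pd par b f) x = sg (par a * par b) (pd par b (pd par a f) x)"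
proof -
  have mixed: "pd par a (pd par b f) x = pd par b (pd par a f) x" if "odd (par a)" "even (par b)" for a b
    using that pd_linear(1) [OF linear_dtheta that(2) superfun_on_line_differentiable [OF f x that(2)]]
    by (simp add: pd_def [of par a])
  show ?thesis
  proof (cases "even (par a)"; cases "even (par b)")
    show ?thesis if "even (par a)" "even (par b)"
      using pd_commute_even [OF f x that] that by (simp add: sg_def)
    show ?thesis if "even (par a)" "odd (par b)"
      using mixed [OF that(2,1)] that by (simp add: sg_def)
    show ?thesis if "odd (par a)" "even (par b)"
      using mixed [OF that] that by (simp add: sg_def)
    show ?thesis if "odd (par a)" "odd (par b)"
      using dtheta_anticommute [of a b "f x"] that by (simp add: pd_def sg_def)
  qed
qed

lemma hom_superfun_on_cong:
  assumes "\<And>x. x \<in> V \<Longrightarrow> f x = g x" "hom_superfun_on par V n f"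
  shows "hom_superfun_on par V n g"
  using assms superfun_on_cong [of f g] by (simp add: hom_superfun_on_def)

lemma hom_superfun_on_add:
  "hom_superfun_on par V n f \<Longrightarrow> hom_superfun_on par V n g \<Longrightarrow> hom_superfun_on par V n (\<lambda>x. f x + g x)"
  by (simp add: hom_superfun_on_def superfun_on_add homogeneous_add)

lemma hom_superfun_on_scaleR:
  "hom_superfun_on par V n f \<Longrightarrow> hom_superfun_on par V n (\<lambda>x. r *\<^sub>R f x)"
  by (simp add: hom_superfun_on_def superfun_on_scaleR homogeneous_scaleR)

text \<open>
  Cutting off superfunctions to zero outside \<open>V\<close>, where their values are junk, turns identities
  on \<open>V\<close> into equations in the ring of functions.
\<close>

definition cut :: "'i superfun \<Rightarrow> 'i superfun" where
  "cut f = (\<lambda>x. if x \<in> V then f x else 0)"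

definition sections :: "nat \<Rightarrow> 'i superfun set" where
  "sections n = {f. hom_superfun_on par V n f \<and> cut f = f}"

definition D :: "'i \<Rightarrow> 'i superfun \<Rightarrow> 'i superfun" where
  "D a f = cut (pd par a f)"

lemma cut_apply [simp]: "x \<in> V \<Longrightarrow> cut f x = f x" "x \<notin> V \<Longrightarrow> cut f x = 0"
  by (simp_all add: cut_def)

lemma D_apply: "x \<in> V \<Longrightarrow> D a f x = pd par a f x"
  by (simp add: D_def)

lemma cut_eqI: "(\<And>x. x \<in> V \<Longrightarrow> f x = g x) \<Longrightarrow> cut f = cut g"
  by (auto simp: cut_def)

lemma D_cut: "D a (cut f) = D a f"
  unfolding D_def by (rule cut_eqI, rule pd_cong) auto

lemma cut_in_sections: "hom_superfun_on par V n f \<Longrightarrow> cut f \<in> sections n"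
  using hom_superfun_on_cong [of f "cut f" n] by (auto simp: sections_def intro: cut_eqI)

lemma sections_hom: "f \<in> sections n \<Longrightarrow> hom_superfun_on par V n f"
  by (simp add: sections_def)

lemma sections_superfun: "f \<in> sections n \<Longrightarrow> superfun_on par V f"
  by (simp add: sections_def hom_superfun_on_def)

lemma sections_cut: "f \<in> sections n \<Longrightarrow> cut f = f"
  by (simp add: sections_def)

lemma sections_0: "f \<in> sections n \<Longrightarrow> x \<notin> V \<Longrightarrow> f x = 0"
  by (metis cut_apply(2) sections_cut)

lemma sections_homogeneous: "f \<in> sections n \<Longrightarrow> homogeneous n (f x)"
  using sections_hom [of f n] sections_0 [of f n x]
  by (cases "x \<in> V") (simp_all add: hom_superfun_on_def)

lemma sectionsI:
  assumes "superfun_on par V f" "\<And>x. x \<in> V \<Longrightarrow> homogeneous n (f x)" "\<And>x. x \<notin> V \<Longrightarrow> f x = 0"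
  shows "f \<in> sections n"
proof -
  have "cut f = f"
    using assms(3) by (auto simp: cut_def)
  then show ?thesis
    using assms(1,2) by (simp add: sections_def hom_superfun_on_def)
qed

lemma sg_fun_apply: "sg n f x = sg n (f x)" for f :: "'i superfun"
  by (simp add: sg_def)

lemma sum_fun_apply: "sum F I x = (\<Sum>i\<in>I. F i x)" for F :: "'j \<Rightarrow> 'i superfun"
  by (induction I rule: infinite_finite_induct) auto

lemma line_differentiable_sections: "f \<in> sections n \<Longrightarrow> x \<in> V \<Longrightarrow> even (par a) \<Longrightarrow> line_differentiable a f x"
  by (rule superfun_on_line_differentiable [OF sections_superfun])

lemma D_in_sections:
  assumes "f \<in> sections n"
  shows "D a f \<in> sections (n + par a)"
  unfolding D_def
  by (intro cut_in_sections) (use superfun_on_pd [OF sections_superfun [OF assms]]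
    homogeneous_pd [OF sections_superfun [OF assms] sections_homogeneous [OF assms]]
    in \<open>auto simp: hom_superfun_on_def\<close>)

sublocale superdiff par sections D
proof
  fix m n :: nat and f g :: "'i superfun" and a b :: 'i
  show "0 \<in> sections n"
    using superfun_on_const [OF supported_0] by (intro sectionsI) (auto simp: zero_fun_def)
  show "f + g \<in> sections n" if fg: "f \<in> sections n" "g \<in> sections n"
    unfolding plus_fun_def
    using fg by (intro sectionsI superfun_on_add homogeneous_add)
      (auto intro: sections_superfun sections_homogeneous simp: sections_0 [OF fg(1)] sections_0 [OF fg(2)])
  show "- f \<in> sections n" if f: "f \<in> sections n"
    unfolding fun_Compl_def
    using f by (intro sectionsI superfun_on_uminus homogeneous_uminus)
      (auto intro: sections_superfun sections_homogeneous simp: sections_0 [OF f])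
  show "f \<in> sections n" if f: "f \<in> sections m" and mn: "even (m + n)"
    using homogeneous_parity [OF sections_homogeneous [OF f] mn]
    by (intro sectionsI sections_superfun [OF f] sections_0 [OF f])
  show "f * g \<in> sections (m + n)" if fg: "f \<in> sections m" "g \<in> sections n"
    unfolding times_fun_def
    using fg by (intro sectionsI superfun_on_mult homogeneous_mult)
      (auto intro: sections_superfun sections_homogeneous simp: sections_0 [OF fg(1)])
  show "f * g = sg (m * n) (g * f)" if fg: "f \<in> sections m" "g \<in> sections n"
    using homogeneous_commute [OF sections_homogeneous [OF fg(1)] sections_homogeneous [OF fg(2)]]
    by (intro ext) (simp add: sg_fun_apply)
  show "D a f \<in> sections (n + par a)" if "f \<in> sections n"
    by (rule D_in_sections [OF that])
  show "D a (f + g) = D a f + D a g" if fg: "f \<in> sections n" "g \<in> sections n"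
  proof
    fix x
    have "pd par a (f + g) x = pd par a f x + pd par a g x" if "x \<in> V"
      unfolding plus_fun_def
      by (rule pd_add(1)) (use line_differentiable_sections fg that in blast)+
    then show "D a (f + g) x = (D a f + D a g) x"
      by (cases "x \<in> V") (simp_all add: D_def)
  qed
  show "D a (f * g) = D a f * g + sg (par a * m) (f * D a g)" if fg: "f \<in> sections m" "g \<in> sections n"
  proof
    fix x
    have "pd par a (f * g) x = pd par a f x * g x + sg (par a * m) (f x * pd par a g x)" if "x \<in> V"
      unfolding times_fun_def
      by (rule pd_mult) (use line_differentiable_sections fg that sections_homogeneous in blast)+
    then show "D a (f * g) x = (D a f * g + sg (par a * m) (f * D a g)) x"
      by (cases "x \<in> V") (simp_all add: D_def sg_fun_apply)
  qed
  show "D a (D b f) = sg (par a * par b) (D b (D a f))" if f: "f \<in> sections n"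
  proof
    fix x
    \<comment> \<open>The inner cut-off disappears under the outer derivative by
      \<open>D_cut\<close>.\<close>
    have "D a (D b f) = cut (pd par a (pd par b f))" "D b (D a f) = cut (pd par b (pd par a f))"
      unfolding D_def [of _ f] D_cut unfolding D_def by simp_all
    then show "D a (D b f) x = sg (par a * par b) (D b (D a f)) x"
      using pd_commute [OF sections_superfun [OF f], of x a b]
      by (cases "x \<in> V") (simp_all add: sg_fun_apply)
  qed
qed

end

section \<open>The cotangent superdomain\<close>

lemma less_phase_simps [simp]:
  "Pos a < Pos b \<longleftrightarrow> a < b" "Mom a < Mom b \<longleftrightarrow> a < b" "Pos a < Mom b" "\<not> Mom a < Pos b"
  by (auto simp: less_phase_def)

lemma coeff_theta: "coeff (theta a) A = of_bool (A = {a})"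
  by (simp add: theta_def)

lemma theta_mult_monomial:
  fixes a :: "'i::{finite,linorder}"
  assumes "\<And>b. b \<in> B \<Longrightarrow> a < b"
  shows "theta a * Grass (\<lambda>C. of_bool (C = B)) = Grass (\<lambda>C. of_bool (C = insert a B))"
proof (rule grass_eqI)
  fix C
  have a: "a \<notin> B" using assms by blast
  have "{(x, b). x \<in> {a} \<and> b \<in> B \<and> b < x} = {}"
    using assms by (auto dest: order.asym)
  then have sh: "shuffle_sign {a} B = 1"
    unfolding shuffle_sign_def by (simp only: card.empty power_0)
  have "coeff (theta a * Grass (\<lambda>C. of_bool (C = B))) C =
      (\<Sum>A\<in>Pow C. if A = {a} then shuffle_sign {a} (C - {a}) * of_bool (C - {a} = B) else 0)"
    unfolding coeff_mult by (intro sum.cong refl) (auto simp: coeff_theta)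
  also have "\<dots> = of_bool (C = insert a B)"
    using a sh by (auto simp: sum.delta)
  finally show "coeff (theta a * Grass (\<lambda>C. of_bool (C = B))) C = coeff (Grass (\<lambda>C. of_bool (C = insert a B))) C"
    by simp
qed

lemma prod_list_theta:
  fixes xs :: "'i::{finite,linorder} list"
  shows "sorted_wrt (<) xs \<Longrightarrow> prod_list (map theta xs) = Grass (\<lambda>C. of_bool (C = set xs))"
proof (induction xs)
  case Nil
  show ?case by (rule grass_eqI) (simp add: coeff_one)
qed (simp add: theta_mult_monomial)

text \<open>The algebra embedding underlying \<open>lift\<close>: superfunctions of the base are
  composed with \<open>proj\<close> and with this map.\<close>

definition phase_embed :: "'i::{finite,linorder} grass \<Rightarrow> 'i phase grass" where
  "phase_embed = grass_subst (\<lambda>a. theta (Pos a))"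

lemma lift_eq_phase_embed: "lift f z = phase_embed (f (proj z))"
  by (simp add: lift_def phase_embed_def)

text \<open>\<open>Pos\<close> is increasing, so an ordered monomial goes to an ordered monomial and
  no sign arises.\<close>

lemma coeff_phase_embed: "coeff (phase_embed g) B = (if B \<subseteq> range Pos then coeff g (Pos -` B) else 0)"
proof -
  have "prod_list (map (\<lambda>a. theta (Pos a)) (sorted_list_of_set A)) = Grass (\<lambda>C. of_bool (C = Pos ` A))"
    for A :: "'a set"
    using prod_list_theta [of "map Pos (sorted_list_of_set A)"]
    by (simp add: sorted_wrt_map comp_def)
  then have "coeff (phase_embed g) B = (\<Sum>A\<in>UNIV. coeff g A * of_bool (B = Pos ` A))"
    by (simp add: phase_embed_def grass_subst_def coeff_sum)
  also have "\<dots> = (\<Sum>A\<in>UNIV. if A = Pos -` B then (if B \<subseteq> range Pos then coeff g (Pos -` B) else 0) else 0)"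
  proof (intro sum.cong refl)
    fix A :: "'a set"
    have "B = Pos ` A \<longleftrightarrow> A = Pos -` B \<and> B \<subseteq> range Pos"
      by (auto simp: inj_vimage_image_eq inj_def)
    then show "coeff g A * of_bool (B = Pos ` A) =
        (if A = Pos -` B then (if B \<subseteq> range Pos then coeff g (Pos -` B) else 0) else 0)"
      by auto
  qed
  finally show ?thesis by simp
qed

lemma linear_phase_embed: "linear phase_embed"
  by (rule linearI; rule grass_eqI) (auto simp: coeff_phase_embed)

lemma inj_Pos: "inj Pos"
  by (simp add: inj_def)

lemma coeff_phase_embed_Pos [simp]: "coeff (phase_embed g) (Pos ` A) = coeff g A"
  by (simp add: coeff_phase_embed image_mono inj_vimage_image_eq inj_Pos)

lemma phase_embed_injective: "phase_embed g = phase_embed h \<Longrightarrow> g = h"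
proof (rule grass_eqI)
  fix A
  assume "phase_embed g = phase_embed h"
  then have "coeff (phase_embed g) (Pos ` A) = coeff (phase_embed h) (Pos ` A)" by simp
  then show "coeff g A = coeff h A"
    by simp
qed

lemma shuffle_sign_Pos: "shuffle_sign (Pos ` A) (Pos ` B) = shuffle_sign A B"
proof -
  have "{(a, b). a \<in> Pos ` A \<and> b \<in> Pos ` B \<and> b < a} =
      map_prod Pos Pos ` {(a, b). a \<in> A \<and> b \<in> B \<and> b < a}"
    by force
  moreover have "inj_on (map_prod Pos Pos) X" for X :: "('a \<times> 'a) set"
    by (intro inj_on_subset [OF prod.inj_map]) (auto simp: inj_Pos)
  ultimately show ?thesis
    by (simp add: shuffle_sign_def card_image)
qed

lemma phase_embed_mult:
  fixes g h :: "'i::{finite,linorder} grass"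
  shows "phase_embed (g * h) = phase_embed g * phase_embed h"
proof (rule grass_eqI)
  fix C :: "'i phase set"
  show "coeff (phase_embed (g * h)) C = coeff (phase_embed g * phase_embed h) C"
  proof (cases "C \<subseteq> range Pos")
    case True
    then obtain C' where C: "C = Pos ` C'" by (auto simp: subset_image_iff)
    have d: "Pos ` C' - Pos ` A = Pos ` (C' - A)" for A
      by (simp add: image_set_diff [OF inj_Pos])
    have "Pow (Pos ` C') = (`) Pos ` Pow C'"
      by (simp add: image_Pow_surj)
    moreover have "inj_on ((`) Pos) (Pow C')"
      by (simp add: inj_on_def inj_image_eq_iff [OF inj_Pos])
    ultimately have "coeff (phase_embed g * phase_embed h) C = (\<Sum>A\<in>Pow C'. shuffle_sign A (C' - A) * coeff g A * coeff h (C' - A))"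
      unfolding coeff_mult C by (simp add: sum.reindex d shuffle_sign_Pos)
    then show ?thesis
      by (simp add: C coeff_mult)
  next
    case False
    then have "\<not> A \<subseteq> range Pos \<or> \<not> C - A \<subseteq> range Pos" for A by blast
    then have "coeff (phase_embed g) A = 0 \<or> coeff (phase_embed h) (C - A) = 0" for A
      by (auto simp: coeff_phase_embed)
    then have "coeff (phase_embed g * phase_embed h) C = 0"
      unfolding coeff_mult by (intro sum.neutral) auto
    then show ?thesis using False by (simp add: coeff_phase_embed)
  qed
qed

lemma homogeneous_phase_embed: "homogeneous n g \<Longrightarrow> homogeneous n (phase_embed g)"
  by (auto simp: homogeneous_def coeff_phase_embed subset_image_iff inj_vimage_image_eq inj_Pos card_image
      inj_on_subset [OF inj_Pos] split: if_splits)

lemma supported_phase_embed: "supported par g \<Longrightarrow> supported (cotangent_par par) (phase_embed g)"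
  by (auto simp: supported_def coeff_phase_embed split: if_splits)

lemma dtheta_Pos_phase_embed: "dtheta (Pos a) (phase_embed g) = phase_embed (dtheta a g)"
proof (rule grass_eqI)
  fix A :: "'a phase set"
  show "coeff (dtheta (Pos a) (phase_embed g)) A = coeff (phase_embed (dtheta a g)) A"
  proof (cases "A \<subseteq> range Pos")
    case True
    then obtain B where A: "A = Pos ` B" by (auto simp: subset_image_iff)
    have L: "{b \<in> Pos ` B. b < Pos a} = Pos ` {b \<in> B. b < a}"
      and I: "insert (Pos a) (Pos ` B) = Pos ` insert a B"
      by auto
    show ?thesis
      unfolding A coeff_dtheta coeff_phase_embed_Pos I L
      by (simp add: card_image inj_on_subset [OF inj_Pos] inj_image_mem_iff [OF inj_Pos])
  qed (simp add: coeff_phase_embed coeff_dtheta)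
qed

lemma dtheta_Mom_phase_embed: "dtheta (Mom a) (phase_embed g) = 0"
  by (rule grass_eqI) (auto simp: coeff_phase_embed coeff_dtheta)

context superdomain
begin

lemma coord_line: "coord par b (x + t *\<^sub>R axis a 1) =
    coord par b x + t *\<^sub>R (if a = b \<and> even (par b) then 1 else 0)"
  by (auto simp: coord_def axis_def of_real_def scaleR_add_left)

lemma pd_coord_even:
  assumes "even (par a)"
  shows "pd par a (coord par b) x = (if a = b then 1 else 0)" "line_differentiable a (coord par b) x"
proof -
  have "((\<lambda>t. coord par b (x + t *\<^sub>R axis a 1)) has_vector_derivative (if a = b then 1 else 0)) (at 0)"
    unfolding coord_line using assms by (auto intro!: derivative_eq_intros)
  then show "pd par a (coord par b) x = (if a = b then 1 else 0)" "line_differentiable a (coord par b) x"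
    by (rule pd_eqI [of par a "coord par b" x, OF assms])+
qed

lemma pd_coord: "pd par a (coord par b) x = (if a = b then 1 else 0)"
proof (cases "even (par a)")
  case False
  have "dtheta a (theta b) = (if a = b then 1 else 0 :: 'i grass)"
    by (rule grass_eqI) (auto simp: coeff_dtheta coeff_theta coeff_one)
  moreover have "dtheta a (of_real r) = 0" for r
    by (simp add: of_real_def dtheta_scaleR dtheta_1)
  ultimately show ?thesis
    using False by (auto simp: pd_odd coord_def)
qed (rule pd_coord_even)

lemma homogeneous_coord: "homogeneous (par b) (coord par b x)"
  by (auto simp: coord_def homogeneous_def of_real_def coeff_one coeff_theta)

lemma superfun_on_coord: "superfun_on par V (coord par b)"
  unfolding superfun_on_iff_smooth_on
proof
  have s: "supported par (coord par b x)" for x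
    by (auto simp: coord_def supported_def of_real_def coeff_one coeff_theta)
  have c: "continuous_on V (coord par b)"
    by (cases "even (par b)") (simp_all add: coord_def, intro continuous_intros)
  show "smooth_on par V k (coord par b)" for k
  proof (cases k)
    case 0
    then show ?thesis using s c by simp
  next
    case (Suc k)
    have "smooth_on par V k (pd par a (coord par b))" if "even (par a)" for a
      by (rule smooth_on_cong [OF _ smooth_on_const [of "if a = b then 1 else 0"]])
        (simp_all add: pd_coord supported_0 supported_1)
    then show ?thesis
      unfolding Suc by (intro smooth_on_SucI s c pd_coord_even(2))
  qed
qed

lemma pd_scaleR:
  assumes "superfun_on par V f" "x \<in> V"
  shows "pd par a (\<lambda>x. r *\<^sub>R f x) x = r *\<^sub>R pd par a f x"
proof (cases "even (par a)")
  case True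
  show ?thesis
    by (rule pd_linear(1) [OF _ True superfun_on_line_differentiable [OF assms True]])
      (auto intro: linearI simp: scaleR_add_right)
qed (simp add: pd_odd dtheta_scaleR)

lemma superdomain_cotangent: "superdomain (cotangent_par par) (cotangent par V)"
proof
  obtain U where U: "open U" "V = even_space par \<inter> U"
    using openin_V by (auto simp: openin_open)
  have "open (proj -` U :: 'i phase point set)"
    unfolding proj_def by (intro open_vimage U(1)) (intro continuous_intros)
  moreover have "proj z \<in> even_space par" if "z \<in> even_space (cotangent_par par)" for z :: "'i phase point"
    using that by (simp add: even_space_def proj_def)
  then have "cotangent par V = even_space (cotangent_par par) \<inter> proj -` U"
    using U(2) by (auto simp: cotangent_def)
  ultimately show "openin (top_of_set (even_space (cotangent_par par))) (cotangent par V)"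
    by (auto simp: openin_open)
qed

lemma proj_line:
  "proj (z + t *\<^sub>R axis (Pos a) 1) = proj z + t *\<^sub>R axis a 1" "proj (z + t *\<^sub>R axis (Mom a) 1) = proj z"
  by (simp_all add: proj_def vec_eq_iff axis_def)

lemma pd_lift_even:
  fixes a :: 'i
  assumes "even (par a)"
  shows "line_differentiable a f (proj z) \<Longrightarrow> pd (cotangent_par par) (Pos a) (lift f) z = lift (pd par a f) z"
    and "line_differentiable a f (proj z) \<Longrightarrow> line_differentiable (Pos a) (lift f) z"
    and "pd (cotangent_par par) (Mom a) (lift f) z = 0" "line_differentiable (Mom a) (lift f) z"
proof -
  have "((\<lambda>t. lift f (z + t *\<^sub>R axis (Pos a) 1)) has_vector_derivative lift (pd par a f) z) (at 0)"
    if "line_differentiable a f (proj z)"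
    unfolding lift_eq_phase_embed proj_line
    by (intro bounded_linear.has_vector_derivative [OF bounded_linear_grass [OF linear_phase_embed]] has_vector_derivative_line assms that)
  from pd_eqI [of "cotangent_par par" "Pos a", OF _ this] show
    "line_differentiable a f (proj z) \<Longrightarrow> pd (cotangent_par par) (Pos a) (lift f) z = lift (pd par a f) z"
    "line_differentiable a f (proj z) \<Longrightarrow> line_differentiable (Pos a) (lift f) z"
    using assms by simp_all
  have "((\<lambda>t. lift f (z + t *\<^sub>R axis (Mom a) 1)) has_vector_derivative 0) (at 0)"
    unfolding lift_eq_phase_embed proj_line by (rule has_vector_derivative_const)
  from pd_eqI [of "cotangent_par par" "Mom a", OF _ this] show
    "pd (cotangent_par par) (Mom a) (lift f) z = 0" "line_differentiable (Mom a) (lift f) z"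
    using assms by simp_all
qed

lemma pd_lift:
  assumes "superfun_on par V f" "z \<in> cotangent par V"
  shows "pd (cotangent_par par) (Pos a) (lift f) z = lift (pd par a f) z"
    and "pd (cotangent_par par) (Mom a) (lift f) z = 0"
proof -
  have "proj z \<in> V" using assms(2) by (simp add: cotangent_def)
  then have "even (par a) \<Longrightarrow> line_differentiable a f (proj z)"
    using superfun_on_line_differentiable [OF assms(1)] by blast
  then show "pd (cotangent_par par) (Pos a) (lift f) z = lift (pd par a f) z"
    using pd_lift_even(1) [of a f z] dtheta_Pos_phase_embed [of a "f (proj z)"]
    by (cases "even (par a)") (simp_all add: pd_def lift_eq_phase_embed)
  show "pd (cotangent_par par) (Mom a) (lift f) z = 0"
    using pd_lift_even(3) [of a f z] dtheta_Mom_phase_embed [of a "f (proj z)"]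
    by (cases "even (par a)") (simp_all add: pd_def lift_eq_phase_embed)
qed

text \<open>Induction on the order of smoothness: position derivatives of a lift are lifts of
  derivatives, and momentum derivatives vanish because \<open>proj\<close> ignores the
  momenta.\<close>

lemma superfun_on_lift:
  assumes "superfun_on par V f"
  shows "superfun_on (cotangent_par par) (cotangent par V) (lift f)"
proof -
  interpret P: superdomain "cotangent_par par" "cotangent par V"
    by (rule superdomain_cotangent)
  have VI: "proj z \<in> V" if "z \<in> cotangent par V" for z
    using that by (simp add: cotangent_def)
  have s: "supported (cotangent_par par) (lift f z)"
    if "smooth_on par V k f" "z \<in> cotangent par V" for f z k
    unfolding lift_eq_phase_embed by (intro supported_phase_embed smooth_on_supported [OF that(1)] VI that)
  have c: "continuous_on (cotangent par V) (lift f)" if "smooth_on par V k f" for f k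
    unfolding lift_eq_phase_embed
  proof (rule bounded_linear.continuous_on [OF bounded_linear_grass [OF linear_phase_embed]],
      rule continuous_on_compose2 [OF smooth_on_continuous [OF that]])
    show "continuous_on (cotangent par V) proj"
      unfolding proj_def by (intro continuous_intros)
  qed (use VI in auto)
  have "smooth_on (cotangent_par par) (cotangent par V) k (lift f)" if "smooth_on par V k f" for k f
    using that
  proof (induction k arbitrary: f)
    case 0
    then show ?case using s [OF 0] c [OF 0] by simp
  next
    case (Suc k)
    note D = smooth_on_SucD [OF Suc.prems]
    show ?case
    proof (rule P.smooth_on_SucI [OF s [OF Suc.prems] c [OF Suc.prems]])
      fix u :: "'i phase"
      assume u: "even (cotangent_par par u)"
      show "line_differentiable u (lift f) z" if "z \<in> cotangent par V" for z
        using pd_lift_even(2,4) D(2) [of _ "proj z"] u VI [OF that] by (cases u) auto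
      show "smooth_on (cotangent_par par) (cotangent par V) k (pd (cotangent_par par) u (lift f))"
      proof (cases u)
        case (Pos a)
        show ?thesis
        proof (rule P.smooth_on_cong)
          show "smooth_on (cotangent_par par) (cotangent par V) k (lift (pd par a f))"
            by (intro Suc.IH D) (use u Pos in simp)
          show "lift (pd par a f) z = pd (cotangent_par par) u (lift f) z" if "z \<in> cotangent par V" for z
            using pd_lift_even(1) [of a f z] D(2) [of a "proj z"] u VI [OF that] by (simp add: Pos)
        qed
      next
        case (Mom a)
        show ?thesis
          by (rule P.smooth_on_cong [OF _ P.smooth_on_const [OF supported_0]])
            (use pd_lift_even(3) [of a f] u in \<open>simp add: Mom\<close>)
      qed
    qed
  qed
  then show ?thesis
    using assms unfolding superfun_on_iff_smooth_on P.superfun_on_iff_smooth_on by blast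
qed

end

section \<open>Change of the volume form\<close>

context volume
begin

text \<open>Links the defining formula of the divergence, with the density inside the derivative, to
  the form with a separate logarithmic term used in the algebra.\<close>

lemma rdvg_eq:
  assumes W: "is_vf w W"
  shows "r * (\<Sum>a\<in>UNIV. sg (par a * (w + 1)) (D a (\<rho> * W a))) = rdvg w W"
proof -
  have "r * sg (par a * (w + 1)) (D a (\<rho> * W a)) =
      r * (W a * D a \<rho>) + sg (par a * (w + 1)) (D a (W a))" for a
  proof -
    have "D a \<rho> * W a = sg (par a * (w + par a)) (W a * D a \<rho>)"
      using A_commute [OF D_in [OF rho_in] is_vfD [OF W]] by simp
    then have "sg (par a * (w + 1)) (D a \<rho> * W a) = W a * D a \<rho>"
      by (simp, subst sg_cong [of _ 0]) auto
    moreover have "D a (\<rho> * W a) = D a \<rho> * W a + \<rho> * D a (W a)"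
      using D_mult [OF rho_in is_vfD [OF W]] by simp
    ultimately show ?thesis
      using r_rho [OF D_in [OF is_vfD [OF W]]]
      by (simp only: sg_add distrib_left sg_mult)
  qed
  then show ?thesis
    unfolding rdvg_def dvg_def vf_def by (simp only: sum_distrib_left sum.distrib add.commute)
qed

end

context poisson
begin

lemma ham_add:
  assumes "f \<in> A e" "g \<in> A e"
  shows "vf (ham e (f + g)) h = vf (ham e f) h + vf (ham e g) h"
proof -
  have "ham e (f + g) a = ham e f a + ham e g a" for a
    by (simp add: ham_def vf_add [OF assms] sg_add)
  then show ?thesis
    by (simp add: vf_def [of "ham _ _"] distrib_right sum.distrib)
qed

lemma ham_symmetric:
  assumes s: "s \<in> A 0" and t: "t \<in> A 0"
  shows "vf (ham 0 s) t = vf (ham 0 t) s"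
  using vf_ham_even [OF t s] A_commute [OF P_in [OF s] D_in [OF t]]
  unfolding vf_def [of "ham 0 s"]
  by (simp add: ham_def sg_def)

lemma vf_ham_in: "s \<in> A 0 \<Longrightarrow> f \<in> A e \<Longrightarrow> vf (ham 0 s) f \<in> A (e + 1)"
  using vf_in [OF is_vf_ham] by (metis add.commute add_0)

end

context poisson_volume
begin

lemma laplacian_add:
  assumes "f \<in> A e" "g \<in> A e"
  shows "laplacian (f + g) = laplacian f + laplacian g"
  unfolding laplacian_def
  by (simp add: vf_add [OF assms] D_add [OF P_in [OF assms(1)] P_in [OF assms(2)]] sum.distrib distrib_left)

text \<open>A unit \<open>u\<close> with \<open>D a u = D a t * u\<close> plays the role of the exponential of \<open>t\<close>.\<close>

lemma laplacian_exp:
  assumes t: "t \<in> A 0" and u: "u \<in> A 0" and Du: "\<And>a. D a u = D a t * u"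
  shows "laplacian u = (laplacian t + vf (ham 0 t) t) * u"
proof -
  have P: "vf (S a) u = vf (S a) t * u" for a
    by (simp add: vf_def Du sum_distrib_right mult.assoc)
  have "D a (vf (S a) u) = D a (vf (S a) t) * u + D a t * vf (S a) t * u" for a
  proof -
    have "vf (S a) t * D a t = D a t * vf (S a) t"
      using A_commute [OF P_in [OF t] D_in [OF t], of a a] by (simp add: sg_def)
    then have "sg (par a * (par a + 1 + 0)) (vf (S a) t * (D a t * u)) = D a t * vf (S a) t * u"
      by (simp add: sg_def flip: mult.assoc)
    then show ?thesis
      unfolding P D_mult [OF P_in [OF t] u] Du by simp
  qed
  then show ?thesis
    unfolding laplacian_def vf_ham_even [OF t t]
    by (simp add: P sum.distrib distrib_right sum_distrib_right sum_distrib_left mult.assoc)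
qed

text \<open>The volume form enters \<open>laplacian\<close> through its logarithmic derivative.
  Adding \<open>D a s\<close> to that derivative contributes the sum that \<open>vf_ham_even\<close>
  identifies with the Hamiltonian field of \<open>s\<close>.\<close>

lemma change_of_volume:
  assumes s: "s \<in> A 0" and f: "f \<in> A e"
    and V': "poisson_volume par A D S \<rho>' r'"
    and ratio: "\<And>a. r' * D a \<rho>' = D a s + r * D a \<rho>"
  shows "poisson_volume.laplacian D S \<rho>' r' f = laplacian f + vf (ham 0 s) f"
proof -
  have "r' * (\<Sum>a\<in>UNIV. D a \<rho>' * vf (S a) f) = (\<Sum>a\<in>UNIV. r' * D a \<rho>' * vf (S a) f)"
    by (simp add: sum_distrib_left mult.assoc)
  also have "\<dots> = vf (ham 0 s) f + r * (\<Sum>a\<in>UNIV. D a \<rho> * vf (S a) f)"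
    unfolding ratio vf_ham_even [OF s f] by (simp add: distrib_right sum.distrib sum_distrib_left mult.assoc)
  finally show ?thesis
    unfolding poisson_volume.laplacian_def [OF V'] laplacian_def by simp
qed

text \<open>
  In the application \<open>L'\<close> is the Laplacian of \<open>e\<^sup>s \<rho>\<close> and \<open>h\<close> is \<open>H\<close>; the equation for
  \<open>h\<close> is doubled because the ring need not contain \<open>1/2\<close>.
\<close>

theorem laplacian_square:
  assumes s: "s \<in> A 0" and f: "f \<in> A e" and h: "h \<in> A 1"
    and L': "\<And>g e. g \<in> A e \<Longrightarrow> L' g = laplacian g + vf (ham 0 s) g"
    and hh: "h + h = laplacian s + laplacian s + vf (ham 0 s) s"
    and two_cancel: "\<And>x y. x + x = y + y \<Longrightarrow> x = (y :: 'b)"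
  shows "L' (L' f) = laplacian (laplacian f) - vf (ham 1 h) f"
proof -
  let ?X = "vf (ham 0 s)"
  note Lf = laplacian_in [OF f] and Xf = vf_ham_in [OF s f]
  note Ls = laplacian_in [OF s, simplified, folded One_nat_def] and Xs = vf_ham_in [OF s s, simplified, folded One_nat_def]
  have "L' (L' f) = laplacian (laplacian f + ?X f) + ?X (laplacian f + ?X f)"
    unfolding L' [OF f] by (rule L' [OF A_add [OF Lf Xf]])
  also have "\<dots> = laplacian (laplacian f) + (laplacian (?X f) + ?X (laplacian f)) + ?X (?X f)"
    unfolding laplacian_add [OF Lf Xf] vf_add [OF Lf Xf] by (simp add: add_ac)
  also have "laplacian (?X f) + ?X (laplacian f) = - vf (ham 1 (laplacian s)) f"
    by (rule laplacian_ham_anticommute [OF s f])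
  finally have *: "L' (L' f) = laplacian (laplacian f) - vf (ham 1 (laplacian s)) f + ?X (?X f)"
    by simp
  \<comment> \<open>The field of \<open>h\<close> is additive in \<open>h\<close>, so the doubled
    equation \<open>hh\<close> can be inserted; \<open>ham_square\<close> supplies the matching
    doubled square.\<close>
  have "vf (ham 1 h) f + vf (ham 1 h) f =
      vf (ham 1 (laplacian s)) f + vf (ham 1 (laplacian s)) f + vf (ham 1 (?X s)) f"
    by (simp only: ham_add [OF h h, symmetric] hh ham_add [OF A_add [OF Ls Ls] Xs] ham_add [OF Ls Ls])
  moreover have "?X (?X f) + ?X (?X f) = - vf (ham 1 (?X s)) f"
    by (rule ham_square [OF s f])
  ultimately have "L' (L' f) + L' (L' f) =
      (laplacian (laplacian f) - vf (ham 1 h) f) + (laplacian (laplacian f) - vf (ham 1 h) f)"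
    unfolding * by (simp add: algebra_simps)
  then show ?thesis by (rule two_cancel)
qed

end

lemma grass_two_cancel: "x + x = y + y \<Longrightarrow> x = y" for x y :: "'i grass"
  by (metis mult_2 scaleR_2 scaleR_cancel_left zero_neq_numeral)

lemma phase_embed_sg: "phase_embed (sg n g) = sg n (phase_embed g)"
  using linear_neg [OF linear_phase_embed, of g] by (simp add: sg_def)

context superdomain
begin

text \<open>The Jacobi identity is derived among sections on the cotangent superdomain and then
  brought down to the base, by evaluating it over each point of \<open>V\<close> and using that
  \<open>phase_embed\<close> is injective.\<close>

theorem poisson_sections:
  assumes S: "\<And>a b. hom_superfun_on par V (par a + par b + 1) (S a b)"
    and sym: "\<And>a b x. x \<in> V \<Longrightarrow> S a b x = (-1) ^ (par a * par b) * S b a x"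
    and bracket: "\<And>z. z \<in> cotangent par V \<Longrightarrow> canonical_bracket par 1 (schouten_fun par S) (schouten_fun par S) z = 0"
  shows "poisson par sections D (\<lambda>a b. cut (S a b))"
proof unfold_locales
  let ?S = "\<lambda>a b. cut (S a b)" and ?W = "cotangent par V" and ?q = "cotangent_par par"
  show "?S a b \<in> sections (par a + par b + 1)" for a b
    by (rule cut_in_sections [OF S])
  show "?S a b = sg (par a * par b) (?S b a)" for a b
  proof
    show "?S a b x = sg (par a * par b) (?S b a) x" for x
      using sym [of x a b] by (cases "x \<in> V") (simp_all add: sg_fun_apply flip: sg_eq_power)
  qed
  interpret P: superdomain ?q ?W
    by (rule superdomain_cotangent)
  have Ssuper: "superfun_on par V (S a b)" for a b
    using S by (simp add: hom_superfun_on_def)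
  have VI: "proj z \<in> V" if "z \<in> ?W" for z
    using that by (simp add: cotangent_def)
  define T where "T a b = P.cut (lift (S a b))" for a b
  define p where "p a = P.cut (coord ?q (Mom a))" for a
  define u where "u = P.cut (\<lambda>z. 1)"
  interpret phase_superdiff par P.sections P.D u p T
  proof
    fix f :: "'i phase superfun" and n :: nat and a b c :: 'i
    show "f * u = f" "u * f = f" if "f \<in> P.sections n"
      using P.sections_0 [OF that] by (auto simp: u_def P.cut_def)
    show "p a \<in> P.sections (par a)"
      unfolding p_def using P.homogeneous_coord [of "Mom a"]
      by (intro P.cut_in_sections) (simp add: hom_superfun_on_def P.superfun_on_coord)
    show "P.D (Mom a) (p b) = (if a = b then u else 0)"
      unfolding p_def P.D_cut by (auto simp: P.D_def P.cut_def P.pd_coord u_def)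
    show "P.D (Pos a) (p b) = 0"
      unfolding p_def P.D_cut by (auto simp: P.D_def P.cut_def P.pd_coord)
    show "T a b \<in> P.sections (par a + par b + 1)"
      unfolding T_def using S [of a b]
      by (intro P.cut_in_sections)
        (auto simp: hom_superfun_on_def superfun_on_lift lift_eq_phase_embed VI intro: homogeneous_phase_embed)
    show "T a b = sg (par a * par b) (T b a)"
    proof
      fix z
      have "phase_embed (S a b x) = sg (par a * par b) (phase_embed (S b a x))" if "x \<in> V" for x
        unfolding sym [OF that, of a b] by (simp only: phase_embed_sg flip: sg_eq_power)
      then show "T a b z = sg (par a * par b) (T b a) z"
        using VI by (cases "z \<in> ?W") (simp_all add: T_def P.sg_fun_apply lift_eq_phase_embed)
    qed
    show "P.D (Mom c) (T a b) = 0"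
      unfolding T_def P.D_cut using pd_lift(2) [OF Ssuper]
      by (auto simp: P.D_def P.cut_def)
    show "f = 0" if "f + f = 0"
    proof
      fix z
      have "f z + f z = 0 + 0"
        using fun_cong [OF that, of z] by simp
      then show "f z = 0 z"
        using grass_two_cancel by fastforce
    qed
  qed
  have ham: "hamiltonian z = 2 *\<^sub>R schouten_fun par S z" if "z \<in> ?W" for z
    using that unfolding hamiltonian_def schouten_fun_def
    by (simp add: P.sum_fun_apply T_def p_def mult.assoc)
  have D_ham: "P.D v hamiltonian z = 2 *\<^sub>R pd ?q v (schouten_fun par S) z" if z: "z \<in> ?W" for z v
  proof -
    have "pd ?q v (schouten_fun par S) z = pd ?q v (\<lambda>z. (1/2) *\<^sub>R hamiltonian z) z"
      by (rule P.pd_cong [OF _ z]) (simp add: ham)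
    also have "\<dots> = (1/2) *\<^sub>R P.D v hamiltonian z"
      using P.pd_scaleR [OF P.sections_superfun [OF hamiltonian_in] z] z by (simp add: P.D_apply)
    finally show ?thesis by simp
  qed
  have zero: "(\<Sum>a\<in>UNIV. P.D (Mom a) hamiltonian * P.D (Pos a) hamiltonian -
      sg (par a) (P.D (Pos a) hamiltonian * P.D (Mom a) hamiltonian)) = 0" (is "?B = 0")
  proof
    fix z
    show "?B z = 0 z"
    proof (cases "z \<in> ?W")
      case True
      \<comment> \<open>Both arguments of the bracket are doubled, since \<open>hamiltonian\<close>
        is twice \<open>schouten_fun par S\<close>.\<close>
      have "?B z = 4 *\<^sub>R canonical_bracket par 1 (schouten_fun par S) (schouten_fun par S) z"
        unfolding canonical_bracket_def scaleR_sum_right P.sum_fun_apply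
        by (intro sum.cong refl) (simp add: D_ham [OF True] P.sg_fun_apply sg_eq_power [symmetric] sg_mult [symmetric] scaleR_diff_right sg_def)
      then show ?thesis using bracket [OF True] by simp
    next
      case False
      then show ?thesis by (simp add: P.sum_fun_apply P.sg_fun_apply P.D_def)
    qed
  qed
  define Q where "Q a k c x = (\<Sum>b\<in>UNIV. S a b x * pd par b (S k c) x)" for a k c x
  have vf: "vf (?S a) (?S k c) x = (if x \<in> V then Q a k c x else 0)" for a k c x
    by (simp add: vf_def sum_fun_apply Q_def D_cut D_apply)
  have phase: "(\<Sum>b\<in>UNIV. T a b * P.D (Pos b) (T k c)) z = phase_embed (Q a k c (proj z))" if "z \<in> ?W" for a k c z
    using that pd_lift(1) [OF Ssuper that]
    by (simp add: P.sum_fun_apply T_def P.D_cut P.D_apply lift_eq_phase_embed Q_def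
        linear_sum [OF linear_phase_embed] phase_embed_mult)
  show "sg (par a * par k + par a * par c + par a + par c * par k) (vf (?S a) (?S k c)) +
      sg (par k * par c + par k + par a * par c) (vf (?S k) (?S a c)) +
      sg (par c) (vf (?S c) (?S k a)) = 0" (is "?J = 0") for a k c
  proof
    fix x
    show "?J x = 0 x"
    proof (cases "x \<in> V")
      case True
      \<comment> \<open>The point over \<open>x\<close> with zero momenta. The Jacobi identity
        involves only lifted components, so any point over \<open>x\<close> carries the full
        information.\<close>
      define z :: "'i phase point" where "z = (\<chi> v. case v of Pos a \<Rightarrow> x $ a | Mom a \<Rightarrow> 0)"
      have z: "proj z = x"
        by (simp add: z_def proj_def vec_eq_iff)
      moreover have "x \<in> even_space par"
        using openin_imp_subset [OF openin_V] True by blast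
      ultimately have "z \<in> ?W"
        using True by (auto simp: cotangent_def even_space_def cotangent_par_def z_def split: phase.splits)
      from fun_cong [OF jacobi_of_canonical_bracket [OF zero, of a k c], of z]
      have "phase_embed (sg (par a * par k + par a * par c + par a + par c * par k) (Q a k c x) +
          sg (par k * par c + par k + par a * par c) (Q k a c x) + sg (par c) (Q c k a x)) = phase_embed 0"
        by (simp add: P.sg_fun_apply phase [OF \<open>z \<in> ?W\<close>] z linear_add [OF linear_phase_embed] linear_0 [OF linear_phase_embed] phase_embed_sg)
      from phase_embed_injective [OF this] show ?thesis
        using True by (simp add: sg_fun_apply vf)
    qed (simp add: sg_fun_apply vf)
  qed
qed

end

section \<open>Charts of an odd Poisson supermanifold\<close>

lemma linear_homogeneous_part: "linear (homogeneous_part e)"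
  by (rule linearI; rule grass_eqI) (auto simp: homogeneous_part_def)

lemma homogeneous_homogeneous_part: "homogeneous e (homogeneous_part e g)"
  by (simp add: homogeneous_def homogeneous_part_def)

lemma homogeneous_part_same: "homogeneous e g \<Longrightarrow> homogeneous_part e g = g"
  by (rule grass_eqI) (auto simp: homogeneous_def homogeneous_part_def)

lemma homogeneous_part_other: "homogeneous (Suc e) g \<Longrightarrow> homogeneous_part e g = 0"
  by (rule grass_eqI) (auto simp: homogeneous_def homogeneous_part_def)

lemma homogeneous_parts: "homogeneous_part 0 g + homogeneous_part 1 g = g"
  by (rule grass_eqI) (auto simp: homogeneous_part_def)

lemma inverse_grass_eq:
  fixes g h :: "'i::{finite,linorder} grass"
  assumes "g * h = 1" "h * g = 1"
  shows "inverse g = h"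
  unfolding inverse_grass_def
proof (rule the_equality)
  show "k = h" if "g * k = 1 \<and> k * g = 1" for k
    by (metis assms(2) mult.assoc mult.left_neutral mult.right_neutral that)
qed (use assms in simp)

text \<open>Take odd parts in \<open>g * h = 1\<close>: the product of \<open>g\<close> with the odd
  part of \<open>h\<close> is zero, and multiplying by \<open>h\<close> shows that this odd part
  vanishes.\<close>

lemma homogeneous_inverse:
  fixes g h :: "'i::{finite,linorder} grass"
  assumes g: "homogeneous 0 g" and gh: "g * h = 1" and hg: "h * g = 1"
  shows "homogeneous 0 h"
proof -
  let ?p = "\<lambda>e. homogeneous_part e h"
  have p: "homogeneous e (g * ?p e)" for e
    using homogeneous_mult [OF g homogeneous_homogeneous_part] by simp
  have "g * ?p 0 + g * ?p 1 = 1"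
    by (simp only: gh homogeneous_parts flip: distrib_left)
  then have "homogeneous_part 1 (g * ?p 0 + g * ?p 1) = homogeneous_part 1 1"
    by simp
  moreover have "homogeneous_part 1 (g * ?p 0) = 0" "homogeneous_part 1 (1 :: 'i grass) = 0"
    by (intro homogeneous_part_other homogeneous_parity [OF p] homogeneous_parity [OF homogeneous_1]; simp)+
  ultimately have "g * ?p 1 = 0"
    by (simp add: linear_add [OF linear_homogeneous_part] homogeneous_part_same [OF p])
  then have "h * g * ?p 1 = 0"
    by (simp add: mult.assoc)
  then have "?p 1 = 0"
    by (simp add: hg)
  then have "h = ?p 0"
    using homogeneous_parts [of h] by simp
  then show ?thesis
    using homogeneous_homogeneous_part [of 0 h] by simp
qed

context superdomain
begin

definition part :: "nat \<Rightarrow> 'i superfun \<Rightarrow> 'i superfun" where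
  "part e f = cut (\<lambda>x. homogeneous_part e (f x))"

lemma part_in_sections:
  assumes "superfun_on par V f"
  shows "part e f \<in> sections e"
  unfolding part_def
proof (rule cut_in_sections)
  have "supported par (homogeneous_part e g)" if "supported par g" for g
    using that by (auto simp: supported_def homogeneous_part_def)
  then show "hom_superfun_on par V e (\<lambda>x. homogeneous_part e (f x))"
    using superfun_on_linear [OF linear_homogeneous_part _ assms]
    by (simp add: hom_superfun_on_def homogeneous_homogeneous_part)
qed

lemma part_cong: "(\<And>x. x \<in> V \<Longrightarrow> f x = g x) \<Longrightarrow> part e f = part e g"
  unfolding part_def by (rule cut_eqI) simp

lemma part_add: "part e (f + g) = part e f + part e g"
  by (auto simp: part_def cut_def linear_add [OF linear_homogeneous_part])

lemma part_same: "f \<in> sections e \<Longrightarrow> part e f = f"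
  using sections_homogeneous [of f e] sections_cut [of f e] by (simp add: part_def homogeneous_part_same)

lemma part_other: "f \<in> sections (Suc e) \<Longrightarrow> part e f = 0"
  using sections_homogeneous [of f "Suc e"] by (auto simp: part_def homogeneous_part_other cut_def)

lemma parts: "x \<in> V \<Longrightarrow> (part 0 f + part 1 f) x = f x"
  using homogeneous_parts [of "f x"] by (simp add: part_def)

lemma pd_parts:
  assumes "superfun_on par V f" "x \<in> V"
  shows "pd par a f x = D a (part 0 f) x + D a (part 1 f) x"
proof -
  have "pd par a f x = pd par a (\<lambda>x. part 0 f x + part 1 f x) x"
    by (rule pd_cong [OF _ assms(2)]) (use parts in simp)
  also have "\<dots> = pd par a (part 0 f) x + pd par a (part 1 f) x"
    by (rule pd_add(1)) (use line_differentiable_sections part_in_sections [OF assms(1)] assms(2) in blast)+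
  finally show ?thesis
    using assms(2) by (simp add: D_apply)
qed

text \<open>Pullback is a Taylor expansion in iterated even derivatives, so this is what makes
  pullback additive on smooth functions.\<close>

lemma foldr_pd_add:
  assumes "superfun_on par V f" "superfun_on par V g" "x \<in> V"
  shows "foldr (pd par) w (\<lambda>x. f x + g x) x = foldr (pd par) w f x + foldr (pd par) w g x"
  using assms(3)
proof (induction w arbitrary: x)
  case (Cons a w)
  have "superfun_on par V (foldr (pd par) w h)" if "superfun_on par V h" for h
    using that by (induction w) (simp_all add: superfun_on_pd)
  note s = this [OF assms(1)] this [OF assms(2)]
  have "pd par a (foldr (pd par) w (\<lambda>x. f x + g x)) x =
      pd par a (\<lambda>x. foldr (pd par) w f x + foldr (pd par) w g x) x"
    by (rule pd_cong [OF Cons.IH Cons.prems])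
  also have "\<dots> = pd par a (foldr (pd par) w f) x + pd par a (foldr (pd par) w g) x"
    by (rule pd_add(1)) (use s superfun_on_line_differentiable Cons.prems in blast)+
  finally show ?case by simp
qed simp

end

lemma foldr_pd_0: "foldr (pd par) w (\<lambda>x. 0) = (\<lambda>x. 0)"
proof (induction w)
  case (Cons a w)
  have "dtheta a 0 = 0"
    by (rule grass_eqI) (simp add: coeff_dtheta)
  then have "pd par a (\<lambda>x. 0) = (\<lambda>x. 0)"
    by (simp add: pd_def)
  then show ?case using Cons by simp
qed simp

lemma grass_subst_add: "grass_subst v (g + h) = grass_subst v g + grass_subst v h"
  by (simp add: grass_subst_def scaleR_add_left sum.distrib)

lemma grass_subst_0: "grass_subst v 0 = 0"
  by (simp add: grass_subst_def)

section \<open>The claims in a single chart\<close>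

locale poisson_chart =
  fixes M :: "('p, 'c, 'i::{finite,linorder}) supermanifold"
    and S :: "'c \<Rightarrow> 'i \<Rightarrow> 'i \<Rightarrow> 'i superfun"
    and c :: 'c
  assumes M: "is_supermanifold M" and S: "is_odd_poisson M S" and c: "c \<in> charts M"
begin

abbreviation "par \<equiv> parity M"
abbreviation "V \<equiv> chart_range M c"
abbreviation "cS \<equiv> \<lambda>a b. S c a b"

sublocale superdomain par V
  using M c by unfold_locales (simp add: is_supermanifold_def)

sublocale poisson par sections D "\<lambda>a b. cut (S c a b)"
  using S c unfolding is_odd_poisson_def by (intro poisson_sections) blast+

abbreviation X where "X s \<equiv> vf (ham 0 s)"

definition Lap :: "'i superfun \<Rightarrow> 'i superfun \<Rightarrow> 'i superfun" where
  "Lap \<rho> = poisson_volume.laplacian D (\<lambda>a b. cut (S c a b)) (cut \<rho>) (cut (\<lambda>x. inverse (\<rho> x)))"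

lemma volume_inverse:
  assumes "is_nondeg_volume M \<rho>" "x \<in> V"
  shows "\<rho> c x * inverse (\<rho> c x) = 1" "inverse (\<rho> c x) * \<rho> c x = 1" "homogeneous 0 (inverse (\<rho> c x))"
proof -
  obtain r where r: "\<rho> c x * r x = 1" "r x * \<rho> c x = 1"
    using assms c unfolding is_nondeg_volume_def by blast
  moreover have "homogeneous 0 (\<rho> c x)"
    using assms c unfolding is_nondeg_volume_def hom_superfun_on_def by blast
  ultimately show "\<rho> c x * inverse (\<rho> c x) = 1" "inverse (\<rho> c x) * \<rho> c x = 1"
    "homogeneous 0 (inverse (\<rho> c x))"
    using homogeneous_inverse [of "\<rho> c x" "r x"] by (simp_all add: inverse_grass_eq [OF r])
qed

lemma volume_hom: "is_nondeg_volume M \<rho> \<Longrightarrow> hom_superfun_on par V 0 (\<rho> c)"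
  using c unfolding is_nondeg_volume_def by blast

lemma poisson_volume:
  assumes "is_nondeg_volume M \<rho>"
  shows "poisson_volume par sections D (\<lambda>a b. cut (S c a b)) (cut (\<rho> c)) (cut (\<lambda>x. inverse (\<rho> c x)))"
proof unfold_locales
  show "cut (\<rho> c) \<in> sections 0"
    by (rule cut_in_sections [OF volume_hom [OF assms]])
  \<comment> \<open>The pointwise \<open>inverse\<close> is smooth because it agrees on
    \<open>V\<close> with the smooth inverse provided by non-degeneracy.\<close>
  obtain r where r: "superfun_on par V r" "\<And>x. x \<in> V \<Longrightarrow> \<rho> c x * r x = 1" "\<And>x. x \<in> V \<Longrightarrow> r x * \<rho> c x = 1"
    using assms c unfolding is_nondeg_volume_def by blast
  then have "superfun_on par V (\<lambda>x. inverse (\<rho> c x))"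
    by (intro superfun_on_cong [OF _ r(1)]) (use inverse_grass_eq [OF r(2) r(3)] in simp)
  then show "cut (\<lambda>x. inverse (\<rho> c x)) \<in> sections 0"
    using volume_inverse(3) [OF assms] by (intro cut_in_sections) (simp add: hom_superfun_on_def)
  show "cut (\<lambda>x. inverse (\<rho> c x)) * (cut (\<rho> c) * f) = f" if "f \<in> sections n" for f n
  proof
    show "(cut (\<lambda>x. inverse (\<rho> c x)) * (cut (\<rho> c) * f)) x = f x" for x
      using sections_0 [OF that, of x] volume_inverse(2) [OF assms, of x]
      by (cases "x \<in> V") (simp_all flip: mult.assoc)
  qed
qed

lemma vf_cut: "x \<in> V \<Longrightarrow> vf W f x = (\<Sum>a\<in>UNIV. W a x * pd par a f x)"
  by (simp add: vf_def sum_fun_apply D_apply)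

text \<open>\<open>laplace\<close> splits its argument by parity and takes divergences of
  Hamiltonian fields; on each part this is the algebraic Laplacian, up to values outside
  \<open>V\<close>.\<close>

theorem laplace_eq:
  assumes \<rho>: "is_nondeg_volume M \<rho>" and f: "superfun_on par V (f c)" and x: "x \<in> V"
  shows "laplace M S \<rho> f c x = (Lap (\<rho> c) (part 0 (f c)) + Lap (\<rho> c) (part 1 (f c))) x"
proof -
  interpret poisson_volume par sections D "\<lambda>a b. cut (S c a b)" "cut (\<rho> c)" "cut (\<lambda>x. inverse (\<rho> c x))"
    by (rule poisson_volume [OF \<rho>])
  have "divergence M \<rho> (e + 1) (ham_vf M S e (\<lambda>c x. homogeneous_part e (f c x))) c x = Lap (\<rho> c) (part e (f c)) x" for e
  proof -
    let ?W = "ham e (part e (f c))"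
    note g = part_in_sections [OF f, of e]
    have W: "ham_vf M S e (\<lambda>c x. homogeneous_part e (f c x)) c a y = ?W a y" if "y \<in> V" for a y
    proof -
      have "pd par b (\<lambda>x. homogeneous_part e (f c x)) y = pd par b (part e (f c)) y" for b
        by (rule pd_cong [OF _ that]) (simp add: part_def)
      then have "ham_vf M S e (\<lambda>c x. homogeneous_part e (f c x)) c a y =
          (\<Sum>b\<in>UNIV. sg (par a * e) (S c a b y * pd par b (part e (f c)) y))"
        by (simp only: ham_vf_def sg_eq_power mult.assoc)
      also have "\<dots> = ?W a y"
        using that by (simp add: ham_def vf_cut sg_fun_apply sg_sum)
      finally show ?thesis .
    qed
    have "divergence M \<rho> (e + 1) (ham_vf M S e (\<lambda>c x. homogeneous_part e (f c x))) c x =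
        inverse (\<rho> c x) * (\<Sum>a\<in>UNIV. sg (par a * (e + 1 + 1)) (D a (cut (\<rho> c) * ?W a) x))"
    proof -
      have "pd par a (\<lambda>y. \<rho> c y * ham_vf M S e (\<lambda>c x. homogeneous_part e (f c x)) c a y) x =
          D a (cut (\<rho> c) * ?W a) x" for a
        unfolding D_apply [OF x] by (rule pd_cong [OF _ x]) (simp add: W)
      then show ?thesis
        unfolding divergence_def divide_grass_def sg_eq_power by simp
    qed
    also have "\<dots> = rdvg (e + 1) ?W x"
      using x unfolding rdvg_eq [OF is_vf_ham [OF g], symmetric] by (simp add: sum_fun_apply sg_fun_apply)
    also have "\<dots> = Lap (\<rho> c) (part e (f c)) x"
      unfolding rdvg_ham [OF g] Lap_def ..
    finally show ?thesis .
  qed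
  then show ?thesis
    by (simp add: laplace_def)
qed

lemma Lap_in:
  assumes "is_nondeg_volume M \<rho>" "f \<in> sections e"
  shows "Lap (\<rho> c) f \<in> sections (e + 1)"
  unfolding Lap_def by (rule poisson_volume.laplacian_in [OF poisson_volume [OF assms(1)] assms(2)])

lemma Lap_0:
  assumes "is_nondeg_volume M \<rho>"
  shows "Lap (\<rho> c) 0 = 0"
proof -
  have "Lap (\<rho> c) (0 + 0) = Lap (\<rho> c) 0 + Lap (\<rho> c) 0"
    unfolding Lap_def by (rule poisson_volume.laplacian_add [OF poisson_volume [OF assms] A_zero A_zero])
  then show ?thesis
    unfolding add_0_left by simp
qed

lemma laplace_homogeneous:
  assumes \<rho>: "is_nondeg_volume M \<rho>" and f: "hom_superfun_on par V 0 (f c)" and x: "x \<in> V"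
  shows "laplace M S \<rho> f c x = Lap (\<rho> c) (cut (f c)) x"
proof -
  have s: "superfun_on par V (f c)"
    using f by (simp add: hom_superfun_on_def)
  have "part e (f c) = part e (cut (f c))" for e
    by (rule part_cong) simp
  moreover have "cut (f c) \<in> sections 0"
    by (rule cut_in_sections [OF f])
  ultimately have "part 0 (f c) = cut (f c)" "part 1 (f c) = 0"
    by (simp_all add: part_same part_other A_parity)
  then show ?thesis
    by (simp add: laplace_eq [where f = f, OF \<rho> s x] Lap_0 [OF \<rho>])
qed

theorem laplace_laplace:
  assumes \<rho>: "is_nondeg_volume M \<rho>" and f: "superfun_on par V (f c)" and x: "x \<in> V"
  shows "laplace M S \<rho> (laplace M S \<rho> f) c x =
    Lap (\<rho> c) (Lap (\<rho> c) (part 0 (f c))) x + Lap (\<rho> c) (Lap (\<rho> c) (part 1 (f c))) x"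
proof -
  let ?L0 = "Lap (\<rho> c) (part 0 (f c))" and ?L1 = "Lap (\<rho> c) (part 1 (f c))"
  have L0: "?L0 \<in> sections 1" and L1: "?L1 \<in> sections 0"
    using Lap_in [OF \<rho> part_in_sections [OF f, of 0]] A_parity [OF Lap_in [OF \<rho> part_in_sections [OF f, of 1]], of 0]
    by simp_all
  have eq: "laplace M S \<rho> f c y = (?L0 + ?L1) y" if "y \<in> V" for y
    by (rule laplace_eq [where f = f, OF \<rho> f that])
  have "superfun_on par V (\<lambda>y. ?L0 y + ?L1 y)"
    by (intro superfun_on_add sections_superfun [OF L0] sections_superfun [OF L1])
  then have s: "superfun_on par V (laplace M S \<rho> f c)"
    by (rule superfun_on_cong [rotated]) (simp add: eq)
  have p: "part e (laplace M S \<rho> f c) = part e ?L0 + part e ?L1" for e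
    using part_cong [of "laplace M S \<rho> f c" "?L0 + ?L1" e, OF eq] by (simp add: part_add)
  \<comment> \<open>The Laplacian is odd, so the even part of its result comes from the odd part of
    \<open>f\<close> and conversely.\<close>
  have "part 0 ?L0 = 0" "part 0 ?L1 = ?L1" "part 1 ?L0 = ?L0" "part 1 ?L1 = 0"
    using L0 L1 A_parity [OF L1, of "Suc 1"] by (auto intro: part_same part_other)
  then show ?thesis
    using laplace_eq [where f = "laplace M S \<rho> f", OF \<rho> s x] by (simp add: p)
qed

lemma bracket_eq:
  assumes "x \<in> V" "hom_superfun_on par V 0 (\<sigma> c)"
  shows "odd_bracket M S 0 \<sigma> \<sigma> c x = - X (cut (\<sigma> c)) (cut (\<sigma> c)) x"
proof -
  have "pd par a (\<sigma> c) x = pd par a (cut (\<sigma> c)) x" for a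
    by (rule pd_cong [OF _ assms(1)]) simp
  then show ?thesis
    using assms(1)
    by (simp add: odd_bracket_def vf_cut ham_def sum_negf sum_distrib_right)
qed

text \<open>By \<open>change_of_volume\<close> only the logarithmic derivative of
  \<open>exp (\<sigma> c x) * \<rho> c x\<close> has to be computed. The inverse density is even, so
  it moves past the derivative of \<open>\<sigma>\<close> and cancels the density.\<close>

lemma Lap_change_of_volume:
  assumes \<rho>: "is_nondeg_volume M \<rho>" and \<rho>': "is_nondeg_volume M \<rho>'"
    and \<sigma>: "hom_superfun_on par V 0 (\<sigma> c)"
    and ratio: "\<And>x. x \<in> V \<Longrightarrow> \<rho>' c x = exp (\<sigma> c x) * \<rho> c x"
    and f: "f \<in> sections e"
  shows "Lap (\<rho>' c) f = Lap (\<rho> c) f + X (cut (\<sigma> c)) f"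
  unfolding Lap_def
proof (rule poisson_volume.change_of_volume [OF poisson_volume [OF \<rho>] cut_in_sections [OF \<sigma>] f poisson_volume [OF \<rho>']])
  fix a
  show "cut (\<lambda>x. inverse (\<rho>' c x)) * D a (cut (\<rho>' c)) =
      D a (cut (\<sigma> c)) + cut (\<lambda>x. inverse (\<rho> c x)) * D a (cut (\<rho> c))"
  proof
    fix x
    show "(cut (\<lambda>x. inverse (\<rho>' c x)) * D a (cut (\<rho>' c))) x =
        (D a (cut (\<sigma> c)) + cut (\<lambda>x. inverse (\<rho> c x)) * D a (cut (\<rho> c))) x"
    proof (cases "x \<in> V")
      case x: True
      let ?r = "inverse (\<rho> c x)" and ?r' = "inverse (\<rho>' c x)" and ?E = "exp (\<sigma> c x)"
      have even: "homogeneous 0 (\<sigma> c y)" if "y \<in> V" for y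
        using \<sigma> that by (simp add: hom_superfun_on_def)
      have ld: "line_differentiable a (\<sigma> c) x" "line_differentiable a (\<rho> c) x" if "even (par a)"
        using \<sigma> volume_hom [OF \<rho>] superfun_on_line_differentiable [OF _ x that] by (auto simp: hom_superfun_on_def)
      have "pd par a (\<rho>' c) x = pd par a (\<lambda>x. exp (\<sigma> c x) * \<rho> c x) x"
        by (rule pd_cong [OF ratio x])
      also have "\<dots> = pd par a (\<lambda>x. exp (\<sigma> c x)) x * \<rho> c x + sg (par a * 0) (?E * pd par a (\<rho> c) x)"
        by (rule pd_mult [OF pd_exp(2) [OF x even ld(1)] ld(2) homogeneous_exp [OF even [OF x]]])
      finally have pd': "pd par a (\<rho>' c) x = pd par a (\<sigma> c) x * ?E * \<rho> c x + ?E * pd par a (\<rho> c) x"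
        using pd_exp(1) [OF x even ld(1)] by simp
      have rE: "?r' * ?E = ?r"
      proof -
        have "?r' * ?E = ?r' * ?E * (\<rho> c x * ?r)"
          using volume_inverse(1) [OF \<rho> x] by simp
        also have "\<dots> = ?r' * (?E * \<rho> c x) * ?r"
          by (simp add: mult.assoc)
        also have "\<dots> = ?r"
          using volume_inverse(2) [OF \<rho>' x] by (simp add: ratio [OF x])
        finally show ?thesis .
      qed
      have "homogeneous (0 + par a) (pd par a (\<sigma> c) x)"
        by (rule homogeneous_pd [OF _ even x]) (use \<sigma> in \<open>simp_all add: hom_superfun_on_def\<close>)
      then have "?r' * pd par a (\<sigma> c) x = pd par a (\<sigma> c) x * ?r'"
        by (rule even_commute [OF volume_inverse(3) [OF \<rho>' x]])
      then have "?r' * (pd par a (\<sigma> c) x * ?E * \<rho> c x) = pd par a (\<sigma> c) x * (?r' * (?E * \<rho> c x))"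
        by (simp flip: mult.assoc)
      also have "\<dots> = pd par a (\<sigma> c) x"
        using volume_inverse(2) [OF \<rho>' x] by (simp add: ratio [OF x])
      finally have "?r' * (pd par a (\<sigma> c) x * ?E * \<rho> c x) = pd par a (\<sigma> c) x" .
      moreover have "?r' * (?E * pd par a (\<rho> c) x) = ?r * pd par a (\<rho> c) x"
        by (simp add: rE flip: mult.assoc)
      ultimately show ?thesis
        using x by (simp add: D_cut D_apply pd' distrib_left)
    qed (simp add: D_def)
  qed
qed

text \<open>The plus sign reflects that the odd bracket of an even \<open>s\<close> with itself is
  \<open>- X s s\<close>.\<close>

definition H_local :: "'i superfun \<Rightarrow> 'i superfun \<Rightarrow> 'i superfun" where
  "H_local \<rho> s = (\<lambda>x. Lap \<rho> s x + (1/2) *\<^sub>R X s s x)"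

lemma H_local_double: "H_local \<rho> s + H_local \<rho> s = Lap \<rho> s + Lap \<rho> s + X s s"
proof
  fix x
  have "y = (1/2) *\<^sub>R y + (1/2) *\<^sub>R y" for y :: "'i grass"
    by (simp flip: scaleR_add_left)
  then show "(H_local \<rho> s + H_local \<rho> s) x = (Lap \<rho> s + Lap \<rho> s + X s s) x"
    by (simp add: H_local_def algebra_simps)
qed

lemma H_local_in:
  assumes "is_nondeg_volume M \<rho>" "s \<in> sections 0"
  shows "H_local (\<rho> c) s \<in> sections 1"
proof -
  have "Lap (\<rho> c) s \<in> sections 1" "X s s \<in> sections 1"
    using Lap_in [OF assms] vf_ham_in [OF assms(2) assms(2)] by simp_all
  then have h: "hom_superfun_on par V 1 (H_local (\<rho> c) s)"
    unfolding H_local_def by (intro hom_superfun_on_add hom_superfun_on_scaleR sections_hom)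
  moreover have "cut (H_local (\<rho> c) s) = H_local (\<rho> c) s"
    using sections_0 [OF \<open>Lap (\<rho> c) s \<in> sections 1\<close>] sections_0 [OF \<open>X s s \<in> sections 1\<close>]
    by (auto simp: H_local_def cut_def)
  ultimately show ?thesis
    by (simp add: sections_def)
qed

lemma H_eq:
  assumes \<rho>: "is_nondeg_volume M \<rho>" and \<sigma>: "hom_superfun_on par V 0 (\<sigma> c)" and x: "x \<in> V"
  shows "laplace M S \<rho> \<sigma> c x - (1/2) *\<^sub>R odd_bracket M S 0 \<sigma> \<sigma> c x = H_local (\<rho> c) (cut (\<sigma> c)) x"
  by (simp add: H_local_def laplace_homogeneous [where f = \<sigma>, OF \<rho> \<sigma> x] bracket_eq [where \<sigma> = \<sigma>, OF x \<sigma>])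

lemma fun_two_cancel: "f + f = g + g \<Longrightarrow> f = g" for f g :: "'i superfun"
  using grass_two_cancel by (metis ext plus_fun_apply)

text \<open>\<open>H\<close> stands for any family with the right values on the chart range; what
  \<open>H_fun\<close> takes outside is arbitrary, and \<open>pd_cong\<close> makes its derivatives
  on \<open>V\<close> independent of that.\<close>

theorem laplace_square_local:
  assumes \<rho>: "is_nondeg_volume M \<rho>" and \<rho>': "is_nondeg_volume M \<rho>'"
    and \<sigma>: "hom_superfun_on par V 0 (\<sigma> c)"
    and ratio: "\<And>x. x \<in> V \<Longrightarrow> \<rho>' c x = exp (\<sigma> c x) * \<rho> c x"
    and f: "superfun_on par V (f c)" and x: "x \<in> V"
    and H: "\<And>x. x \<in> V \<Longrightarrow> H c x = H_local (\<rho> c) (cut (\<sigma> c)) x"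
  shows "laplace M S \<rho>' (laplace M S \<rho>' f) c x =
    laplace M S \<rho> (laplace M S \<rho> f) c x - vf_apply M (ham_vf M S 1 H) f c x"
proof -
  let ?s = "cut (\<sigma> c)"
  let ?h = "H_local (\<rho> c) ?s"
  have s: "?s \<in> sections 0" by (rule cut_in_sections [OF \<sigma>])
  have L': "Lap (\<rho>' c) g = Lap (\<rho> c) g + X ?s g" if "g \<in> sections e" for g e
    by (rule Lap_change_of_volume [where \<sigma> = \<sigma>, OF \<rho> \<rho>' \<sigma> ratio that])
  have square: "Lap (\<rho>' c) (Lap (\<rho>' c) (part e (f c))) =
      Lap (\<rho> c) (Lap (\<rho> c) (part e (f c))) - vf (ham 1 ?h) (part e (f c))" for e
    using poisson_volume.laplacian_square [OF poisson_volume [OF \<rho>] s part_in_sections [OF f] H_local_in [OF \<rho> s],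
        folded Lap_def, OF L' H_local_double fun_two_cancel] .
  have "ham_vf M S 1 H c a x = ham 1 ?h a x" for a
  proof -
    have "pd par b (H c) x = pd par b ?h x" for b
      by (rule pd_cong [OF H x])
    then have "ham_vf M S 1 H c a x = (\<Sum>b\<in>UNIV. sg (par a * 1) (S c a b x * pd par b ?h x))"
      by (simp only: ham_vf_def sg_eq_power mult.assoc)
    then show ?thesis
      using x by (simp add: ham_def vf_cut sg_fun_apply sg_sum)
  qed
  then have "vf_apply M (ham_vf M S 1 H) f c x = vf (ham 1 ?h) (part 0 (f c)) x + vf (ham 1 ?h) (part 1 (f c)) x"
    by (simp add: vf_apply_def pd_parts [OF f x] vf_def sum_fun_apply distrib_left sum.distrib)
  then show ?thesis
    unfolding laplace_laplace [where f = f, OF \<rho> f x] laplace_laplace [where f = f, OF \<rho>' f x]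
    by (simp add: square)
qed

text \<open>Write \<open>s = t + t\<close>. The Laplacian of the exponential of \<open>t\<close> is
  \<open>?K\<close> times that exponential. The term \<open>X s s\<close> is quadratic and becomes
  four times \<open>X t t\<close>, so the factor 1/2 leaves exactly \<open>?K + ?K\<close>.\<close>

theorem H_exp_local:
  assumes \<rho>: "is_nondeg_volume M \<rho>" and \<sigma>: "hom_superfun_on par V 0 (\<sigma> c)" and x: "x \<in> V"
  shows "2 * exp (- ((1/2) *\<^sub>R \<sigma> c x)) * laplace M S \<rho> (\<lambda>c x. exp ((1/2) *\<^sub>R \<sigma> c x)) c x =
    H_local (\<rho> c) (cut (\<sigma> c)) x"
proof -
  interpret poisson_volume par sections D "\<lambda>a b. cut (S c a b)" "cut (\<rho> c)" "cut (\<lambda>x. inverse (\<rho> c x))"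
    by (rule poisson_volume [OF \<rho>])
  let ?e = "\<lambda>x. (1/2) *\<^sub>R \<sigma> c x"
  define s t u where "s = cut (\<sigma> c)" and "t = cut ?e" and "u = cut (\<lambda>x. exp (?e x))"
  have e: "hom_superfun_on par V 0 ?e"
    by (rule hom_superfun_on_scaleR [OF \<sigma>])
  then have e': "superfun_on par V ?e" "\<And>x. x \<in> V \<Longrightarrow> homogeneous 0 (?e x)"
    by (simp_all add: hom_superfun_on_def)
  have E: "hom_superfun_on par V 0 (\<lambda>x. exp (?e x))"
    using superfun_on_exp [OF e'] homogeneous_exp [OF e'(2)] by (simp add: hom_superfun_on_def)
  have t: "t \<in> sections 0" and u: "u \<in> sections 0"
    unfolding t_def u_def by (intro cut_in_sections e E)+
  have st: "s = t + t"
    by (auto simp: s_def t_def cut_def simp flip: scaleR_add_left)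
  have Du: "D a u = D a t * u" for a
  proof
    show "D a u y = (D a t * u) y" for y
      using pd_exp(1) [OF _ e'(2) superfun_on_line_differentiable [OF e'(1)], of y a]
      unfolding u_def t_def D_cut by (cases "y \<in> V") (simp_all add: D_def)
  qed
  let ?K = "Lap (\<rho> c) t + X t t"
  have K: "?K \<in> sections 1"
    using A_add [OF Lap_in [OF \<rho> t] vf_ham_in [OF t t]] by simp
  have "H_local (\<rho> c) s + H_local (\<rho> c) s = (?K + ?K) + (?K + ?K)"
  proof -
    have "X s s = X t t + X t t + (X t t + X t t)"
      unfolding st by (simp add: ham_add [OF t t] vf_add [OF t t])
    then show ?thesis
      unfolding H_local_double unfolding st
      by (simp add: Lap_def laplacian_add [OF t t] algebra_simps)
  qed
  then have H: "H_local (\<rho> c) s = ?K + ?K"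
    by (rule fun_two_cancel)
  have "laplace M S \<rho> (\<lambda>c x. exp ((1/2) *\<^sub>R \<sigma> c x)) c x = (?K * u) x"
    unfolding laplace_homogeneous [where f = "\<lambda>c x. exp ((1/2) *\<^sub>R \<sigma> c x)", OF \<rho> E x]
    unfolding u_def [symmetric] by (simp only: Lap_def laplacian_exp [OF t u Du])
  also have "\<dots> = u x * ?K x"
    using even_commute [OF sections_homogeneous [OF u] sections_homogeneous [OF K], of x x] by simp
  finally have "exp (- ?e x) * laplace M S \<rho> (\<lambda>c x. exp ((1/2) *\<^sub>R \<sigma> c x)) c x = ?K x"
    using x exp_inverse_left [of "?e x"] by (simp add: u_def flip: mult.assoc)
  then show ?thesis
    unfolding s_def [symmetric] H by (simp add: mult.assoc mult_2 distrib_right)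
qed

lemma H_local_0:
  assumes "is_nondeg_volume M \<rho>"
  shows "H_local (\<rho> c) 0 = 0"
proof -
  have "X 0 0 = 0"
    by (simp add: vf_def)
  then show ?thesis
    by (auto simp: H_local_def Lap_0 [OF assms])
qed

text \<open>Expanding the quadratic term for \<open>t + s\<close> gives the cross term
  \<open>X s t\<close> twice. Its half is precisely the difference between the Laplacians of
  \<open>\<rho>'\<close> and \<open>\<rho>\<close> on \<open>t\<close>.\<close>

lemma H_local_add:
  assumes \<rho>: "is_nondeg_volume M \<rho>" and s: "s \<in> sections 0" and t: "t \<in> sections 0"
    and L': "Lap (\<rho>' c) t = Lap (\<rho> c) t + X s t"
  shows "H_local (\<rho> c) (t + s) = H_local (\<rho>' c) t + H_local (\<rho> c) s"
proof (rule fun_two_cancel)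
  have "Lap (\<rho> c) (t + s) = Lap (\<rho> c) t + Lap (\<rho> c) s"
    by (rule poisson_volume.laplacian_add [OF poisson_volume [OF \<rho>] t s, folded Lap_def])
  moreover have "X (t + s) (t + s) = X t t + X s s + (X s t + X s t)"
    by (simp add: ham_add [OF t s] vf_add [OF t s] ham_symmetric [OF t s])
  ultimately have "H_local (\<rho> c) (t + s) + H_local (\<rho> c) (t + s) =
      (H_local (\<rho>' c) t + H_local (\<rho>' c) t) + (H_local (\<rho> c) s + H_local (\<rho> c) s)"
    unfolding H_local_double L' by (simp add: algebra_simps)
  then show "H_local (\<rho> c) (t + s) + H_local (\<rho> c) (t + s) =
      H_local (\<rho>' c) t + H_local (\<rho> c) s + (H_local (\<rho>' c) t + H_local (\<rho> c) s)"
    by (simp add: algebra_simps)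
qed

end

section \<open>Global even functions, uniqueness of the logarithm, and assembly of the
  theorem\<close>

lemma is_even_function_hom:
  "is_even_function M \<sigma> \<Longrightarrow> c \<in> charts M \<Longrightarrow> hom_superfun_on (parity M) (chart_range M c) 0 (\<sigma> c)"
  by (simp add: is_even_function_def is_function_def hom_superfun_on_def)

lemma is_even_function_0:
  assumes "is_supermanifold M"
  shows "is_even_function M (\<lambda>c x. 0)"
proof -
  have "superfun_on (parity M) (chart_range M c) (\<lambda>x. 0)" if "c \<in> charts M" for c
  proof -
    interpret superdomain "parity M" "chart_range M c"
      using assms that by unfold_locales (simp add: is_supermanifold_def)
    show ?thesis by (rule superfun_on_const [OF supported_0])
  qed
  then show ?thesis
    by (simp add: is_even_function_def is_function_def pullback_def foldr_pd_0 grass_subst_0)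
qed

text \<open>The transition map sends an overlap point to a point of the other chart range, where
  iterated derivatives of smooth functions are additive; hence so is the pullback.\<close>

lemma is_even_function_add:
  assumes M: "is_supermanifold M" and f: "is_even_function M f" and g: "is_even_function M g"
  shows "is_even_function M (\<lambda>c x. f c x + g c x)"
proof -
  have domain: "superdomain (parity M) (chart_range M c)" if "c \<in> charts M" for c
    using M that by unfold_locales (simp add: is_supermanifold_def)
  have sf: "superfun_on (parity M) (chart_range M c) (f c)" "superfun_on (parity M) (chart_range M c) (g c)"
    if "c \<in> charts M" for c
    using f g that by (auto simp: is_even_function_def is_function_def)
  have "f c x + g c x = pullback (parity M) (trans M c d) (\<lambda>x. f d x + g d x) x"
    if cd: "c \<in> charts M" "d \<in> charts M" and x: "x \<in> overlap M c d" for c d x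
  proof -
    obtain p where "p \<in> patch M c \<inter> patch M d" "x = chart M c p"
      using x by (auto simp: overlap_def)
    then have "body_map (parity M) (trans M c d) x \<in> chart_range M d"
      using M cd by (auto simp: is_supermanifold_def chart_range_def)
    from superdomain.foldr_pd_add [OF domain [OF cd(2)] sf [OF cd(2)] this]
    have "pullback (parity M) (trans M c d) (\<lambda>x. f d x + g d x) x =
        pullback (parity M) (trans M c d) (f d) x + pullback (parity M) (trans M c d) (g d) x"
      by (simp add: pullback_def grass_subst_add distrib_left scaleR_add_right sum.distrib)
    then show ?thesis
      using f g cd x by (simp add: is_even_function_def is_function_def)
  qed
  then show ?thesis
    using f g superdomain.superfun_on_add [OF domain sf]
    by (simp add: is_even_function_def is_function_def homogeneous_add)
qed

lemma is_even_function_uminus: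
  assumes M: "is_supermanifold M" and f: "is_even_function M f"
  shows "is_even_function M (\<lambda>c x. - f c x)"
proof -
  have domain: "superdomain (parity M) (chart_range M c)" if "c \<in> charts M" for c
    using M that by unfold_locales (simp add: is_supermanifold_def)
  have sf: "superfun_on (parity M) (chart_range M c) (f c)" "superfun_on (parity M) (chart_range M c) (\<lambda>x. - f c x)"
    if "c \<in> charts M" for c
    using f that superdomain.superfun_on_uminus [OF domain [OF that]]
    by (auto simp: is_even_function_def is_function_def)
  have "- f c x = pullback (parity M) (trans M c d) (\<lambda>x. - f d x) x"
    if cd: "c \<in> charts M" "d \<in> charts M" and x: "x \<in> overlap M c d" for c d x
  proof -
    obtain p where "p \<in> patch M c \<inter> patch M d" "x = chart M c p"
      using x by (auto simp: overlap_def)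
    then have "body_map (parity M) (trans M c d) x \<in> chart_range M d"
      using M cd by (auto simp: is_supermanifold_def chart_range_def)
    \<comment> \<open>Additivity applied to \<open>f\<close> and its negative: the pullback of their
      sum is zero, so the pullback of the negative is the negative of the pullback.\<close>
    from superdomain.foldr_pd_add [OF domain [OF cd(2)] sf [OF cd(2)] this]
    have "pullback (parity M) (trans M c d) (\<lambda>x. f d x + - f d x) x =
        pullback (parity M) (trans M c d) (f d) x + pullback (parity M) (trans M c d) (\<lambda>x. - f d x) x"
      by (simp only: pullback_def grass_subst_add distrib_left scaleR_add_right sum.distrib)
    then have "pullback (parity M) (trans M c d) (f d) x + pullback (parity M) (trans M c d) (\<lambda>x. - f d x) x = 0"
      by (simp add: pullback_def foldr_pd_0 grass_subst_0)
    then show ?thesis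
      using f cd x by (simp add: is_even_function_def is_function_def add_eq_0_iff)
  qed
  then show ?thesis
    using f sf by (simp add: is_even_function_def is_function_def homogeneous_uminus)
qed

lemma is_log_ratio_unique:
  assumes M: "is_supermanifold M" and \<rho>: "is_nondeg_volume M \<rho>"
    and "is_log_ratio M \<rho>' \<rho> \<sigma>" "is_log_ratio M \<rho>' \<rho> \<tau>" "c \<in> charts M" "x \<in> chart_range M c"
  shows "\<sigma> c x = \<tau> c x"
proof (rule exp_inject_even)
  obtain r where r: "\<rho> c x * r x = 1"
    using \<rho> assms(5,6) unfolding is_nondeg_volume_def by blast
  have "exp (\<sigma> c x) * \<rho> c x = exp (\<tau> c x) * \<rho> c x"
    using assms(3-6) by (simp add: is_log_ratio_def agree_on_def)
  then have "exp (\<sigma> c x) * (\<rho> c x * r x) = exp (\<tau> c x) * (\<rho> c x * r x)"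
    by (simp flip: mult.assoc)
  then show "exp (\<sigma> c x) = exp (\<tau> c x)"
    by (simp add: r)
qed (use assms in \<open>auto simp: is_log_ratio_def is_even_function_def\<close>)

text \<open>All logarithms of the same ratio agree on the chart ranges, so the one selected by
  choice in \<open>H_fun\<close> can be replaced by the given \<open>\<sigma>\<close>.\<close>

lemma H_fun_eq:
  assumes "is_supermanifold M" "is_odd_poisson M S" "is_nondeg_volume M \<rho>" "is_log_ratio M \<rho>' \<rho> \<sigma>"
    and c: "c \<in> charts M" and x: "x \<in> chart_range M c"
  shows "H_fun M S \<rho>' \<rho> c x = laplace M S \<rho> \<sigma> c x - (1/2) *\<^sub>R odd_bracket M S 0 \<sigma> \<sigma> c x"
    and "H_fun M S \<rho>' \<rho> c x = poisson_chart.H_local M S c (\<rho> c) (superdomain.cut (chart_range M c) (\<sigma> c)) x"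
proof -
  interpret poisson_chart M S c
    by unfold_locales (fact assms)+
  define \<tau> where "\<tau> = (SOME \<tau>. is_log_ratio M \<rho>' \<rho> \<tau>)"
  have \<tau>: "is_log_ratio M \<rho>' \<rho> \<tau>"
    unfolding \<tau>_def using assms(4) by (rule someI [where P = "is_log_ratio M \<rho>' \<rho>"])
  have h: "hom_superfun_on par V 0 (\<sigma> c)" "hom_superfun_on par V 0 (\<tau> c)"
    using assms(4) \<tau> is_even_function_hom [OF _ c] by (auto simp: is_log_ratio_def)
  have "cut (\<tau> c) = cut (\<sigma> c)"
    by (rule cut_eqI, rule is_log_ratio_unique [OF assms(1,3) \<tau> assms(4) c])
  then have "H_fun M S \<rho>' \<rho> c x = H_local (\<rho> c) (cut (\<sigma> c)) x"
    using H_eq [where \<sigma> = \<tau>, OF assms(3) h(2) x] by (simp add: H_fun_def \<tau>_def [symmetric])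
  then show "H_fun M S \<rho>' \<rho> c x = laplace M S \<rho> \<sigma> c x - (1/2) *\<^sub>R odd_bracket M S 0 \<sigma> \<sigma> c x"
    "H_fun M S \<rho>' \<rho> c x = H_local (\<rho> c) (cut (\<sigma> c)) x"
    using H_eq [where \<sigma> = \<sigma>, OF assms(3) h(1) x] by simp_all
qed

theorem theorem2p1:
  fixes M :: "('p, 'c, 'i::{finite,linorder}) supermanifold"
    and S :: "'c \<Rightarrow> 'i \<Rightarrow> 'i \<Rightarrow> 'i superfun"
    and \<rho> \<rho>' \<rho>'' \<sigma> \<sigma>' :: "('c, 'i) local_family"
  assumes "is_supermanifold M" and "is_odd_poisson M S"
    and "is_nondeg_volume M \<rho>" and "is_nondeg_volume M \<rho>'" and "is_nondeg_volume M \<rho>''"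
    and "is_even_function M \<sigma>" and "agree_on M \<rho>' (\<lambda>c x. exp (\<sigma> c x) * \<rho> c x)"
    and "is_even_function M \<sigma>'" and "agree_on M \<rho>'' (\<lambda>c x. exp (\<sigma>' c x) * \<rho>' c x)"
  shows "(\<forall>f. is_function M f \<longrightarrow>
            agree_on M (laplace M S \<rho>' (laplace M S \<rho>' f))
              (\<lambda>c x. laplace M S \<rho> (laplace M S \<rho> f) c x
                     - vf_apply M (ham_vf M S 1 (H_fun M S \<rho>' \<rho>)) f c x))
       \<and> agree_on M (H_fun M S \<rho>' \<rho>)
           (\<lambda>c x. laplace M S \<rho> \<sigma> c x - (1/2) *\<^sub>R odd_bracket M S 0 \<sigma> \<sigma> c x)
       \<and> agree_on M (H_fun M S \<rho>' \<rho>)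
           (\<lambda>c x. 2 * exp (- ((1/2) *\<^sub>R \<sigma> c x)) * laplace M S \<rho> (\<lambda>c x. exp ((1/2) *\<^sub>R \<sigma> c x)) c x)
       \<and> (\<forall>c\<in>charts M. hom_superfun_on (parity M) (chart_range M c) 1 (H_fun M S \<rho>' \<rho> c))
       \<and> agree_on M (H_fun M S \<rho> \<rho>) (\<lambda>c x. 0)
       \<and> agree_on M (\<lambda>c x. H_fun M S \<rho>' \<rho> c x + H_fun M S \<rho> \<rho>' c x) (\<lambda>c x. 0)
       \<and> agree_on M (H_fun M S \<rho>'' \<rho>) (\<lambda>c x. H_fun M S \<rho>'' \<rho>' c x + H_fun M S \<rho>' \<rho> c x)"
proof -
  note MS = assms(1,2)
  note \<rho> = assms(3) and \<rho>' = assms(4)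
  have even: "homogeneous 0 (\<sigma> c x)" "homogeneous 0 (\<sigma>' c x)" if "c \<in> charts M" "x \<in> chart_range M c" for c x
    using assms(6,8) that by (auto simp: is_even_function_def)
  have ratio: "\<rho>' c x = exp (\<sigma> c x) * \<rho> c x" "\<rho>'' c x = exp (\<sigma>' c x) * \<rho>' c x"
    if "c \<in> charts M" "x \<in> chart_range M c" for c x
    using assms(7,9) that by (auto simp: agree_on_def)
  have ratio_inv: "\<rho> c x = exp (- \<sigma> c x) * \<rho>' c x" if "c \<in> charts M" "x \<in> chart_range M c" for c x
    using exp_inverse_left [of "\<sigma> c x"] by (simp add: ratio(1) [OF that] flip: mult.assoc)
  have log1: "is_log_ratio M \<rho>' \<rho> \<sigma>" and log2: "is_log_ratio M \<rho>'' \<rho>' \<sigma>'"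
    using assms by (simp_all add: is_log_ratio_def)
  have log0: "is_log_ratio M \<rho> \<rho> (\<lambda>c x. 0)"
    using is_even_function_0 [OF MS(1)] by (simp add: is_log_ratio_def agree_on_def)
  have log_inv: "is_log_ratio M \<rho> \<rho>' (\<lambda>c x. - \<sigma> c x)"
    using is_even_function_uminus [OF MS(1) assms(6)] ratio_inv by (simp add: is_log_ratio_def agree_on_def)
  have log_comp: "is_log_ratio M \<rho>'' \<rho> (\<lambda>c x. \<sigma>' c x + \<sigma> c x)"
  proof -
    have "exp (\<sigma>' c x + \<sigma> c x) * \<rho> c x = \<rho>'' c x" if "c \<in> charts M" "x \<in> chart_range M c" for c x
      using exp_add_commuting [OF even_commute [OF even(2,1) [OF that]]] ratio [OF that]
      by (simp add: mult.assoc)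
    then show ?thesis
      using is_even_function_add [OF MS(1) assms(8,6)] by (simp add: is_log_ratio_def agree_on_def)
  qed
  have main: "(is_function M f \<longrightarrow> laplace M S \<rho>' (laplace M S \<rho>' f) c x =
        laplace M S \<rho> (laplace M S \<rho> f) c x - vf_apply M (ham_vf M S 1 (H_fun M S \<rho>' \<rho>)) f c x) \<and>
      H_fun M S \<rho>' \<rho> c x = 2 * exp (- ((1/2) *\<^sub>R \<sigma> c x)) * laplace M S \<rho> (\<lambda>c x. exp ((1/2) *\<^sub>R \<sigma> c x)) c x \<and>
      hom_superfun_on (parity M) (chart_range M c) 1 (H_fun M S \<rho>' \<rho> c) \<and>
      H_fun M S \<rho> \<rho> c x = 0 \<and> H_fun M S \<rho>' \<rho> c x + H_fun M S \<rho> \<rho>' c x = 0 \<and>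
      H_fun M S \<rho>'' \<rho> c x = H_fun M S \<rho>'' \<rho>' c x + H_fun M S \<rho>' \<rho> c x"
    if c: "c \<in> charts M" and x: "x \<in> chart_range M c" for f c x
  proof -
    interpret poisson_chart M S c
      by unfold_locales (fact MS c)+
    note H = H_fun_eq(2) [OF MS _ _ c]
    have hom: "hom_superfun_on par V 0 (\<sigma> c)" "hom_superfun_on par V 0 (\<sigma>' c)"
      "hom_superfun_on par V 0 (\<lambda>x. - \<sigma> c x)"
      using is_even_function_hom [OF _ c] assms(6,8) is_even_function_uminus [OF MS(1) assms(6)] by blast+
    let ?s = "cut (\<sigma> c)" and ?t = "cut (\<sigma>' c)"
    have s: "?s \<in> sections 0" and t: "?t \<in> sections 0" and ms: "cut (\<lambda>x. - \<sigma> c x) \<in> sections 0"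
      by (intro cut_in_sections hom)+
    have "laplace M S \<rho>' (laplace M S \<rho>' f) c x =
        laplace M S \<rho> (laplace M S \<rho> f) c x - vf_apply M (ham_vf M S 1 (H_fun M S \<rho>' \<rho>)) f c x"
      if "is_function M f"
      by (rule laplace_square_local [where \<sigma> = \<sigma> and \<rho> = \<rho> and \<rho>' = \<rho>' and f = f and H = "H_fun M S \<rho>' \<rho>", OF \<rho> \<rho>' hom(1) ratio(1) [OF c] _ x H [OF \<rho> log1]])
        (use that c in \<open>auto simp: is_function_def\<close>)
    moreover have "H_fun M S \<rho>' \<rho> c x =
        2 * exp (- ((1/2) *\<^sub>R \<sigma> c x)) * laplace M S \<rho> (\<lambda>c x. exp ((1/2) *\<^sub>R \<sigma> c x)) c x"
      unfolding H_exp_local [where \<sigma> = \<sigma>, OF \<rho> hom(1) x] by (rule H [OF \<rho> log1 x])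
    moreover have "hom_superfun_on par V 1 (H_fun M S \<rho>' \<rho> c)"
      by (rule hom_superfun_on_cong [OF _ sections_hom [OF H_local_in [OF \<rho> s]]])
        (rule H [OF \<rho> log1, symmetric])
    moreover have "H_fun M S \<rho> \<rho> c x = 0"
    proof -
      have "cut (\<lambda>x. 0) = 0" by (auto simp: cut_def)
      then show ?thesis
        using H [OF \<rho> log0 x] H_local_0 [OF \<rho>] by simp
    qed
    \<comment> \<open>The additivity of \<open>H_local\<close> for the round trip from
      \<open>\<rho>'\<close> to \<open>\<rho>\<close> and back: base \<open>\<rho>'\<close>,
      logarithms \<open>- \<sigma>\<close> and \<open>\<sigma>\<close> with sum zero.\<close>
    moreover have "H_fun M S \<rho>' \<rho> c x + H_fun M S \<rho> \<rho>' c x = 0"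
    proof -
      have L': "Lap (\<rho> c) ?s = Lap (\<rho>' c) ?s + X (cut (\<lambda>x. - \<sigma> c x)) ?s"
        by (rule Lap_change_of_volume [where \<sigma> = "\<lambda>c x. - \<sigma> c x", OF \<rho>' \<rho> hom(3) ratio_inv [OF c] s])
      have "?s + cut (\<lambda>x. - \<sigma> c x) = 0" by (auto simp: cut_def)
      then have "H_local (\<rho> c) ?s + H_local (\<rho>' c) (cut (\<lambda>x. - \<sigma> c x)) = 0"
        using H_local_add [where \<rho> = \<rho>' and \<rho>' = \<rho>, OF \<rho>' ms s L'] H_local_0 [OF \<rho>'] by simp
      then show ?thesis
        unfolding H [OF \<rho> log1 x] H [OF \<rho>' log_inv x] by (metis plus_fun_apply zero_fun_apply)
    qed
    moreover have "H_fun M S \<rho>'' \<rho> c x = H_fun M S \<rho>'' \<rho>' c x + H_fun M S \<rho>' \<rho> c x"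
    proof -
      have L': "Lap (\<rho>' c) ?t = Lap (\<rho> c) ?t + X ?s ?t"
        by (rule Lap_change_of_volume [where \<sigma> = \<sigma>, OF \<rho> \<rho>' hom(1) ratio(1) [OF c] t])
      have "cut (\<lambda>x. \<sigma>' c x + \<sigma> c x) = ?t + ?s" by (auto simp: cut_def)
      then show ?thesis
        using H_local_add [where \<rho> = \<rho> and \<rho>' = \<rho>', OF \<rho> s t L']
        unfolding H [OF \<rho> log_comp x] H [OF \<rho>' log2 x] H [OF \<rho> log1 x] by simp
    qed
    ultimately show ?thesis by blast
  qed
  \<comment> \<open>\<open>main\<close> is stated at a point of the chart range, so a chart with
    empty range is treated separately.\<close>
  have parity: "hom_superfun_on (parity M) (chart_range M c) 1 (H_fun M S \<rho>' \<rho> c)" if c: "c \<in> charts M" for c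
  proof (cases "chart_range M c = {}")
    case True
    then show ?thesis by (simp add: hom_superfun_on_def superfun_on_def)
  qed (use main [OF c] in blast)
  then show ?thesis
    using main H_fun_eq(1) [OF MS \<rho> log1] unfolding agree_on_def by blast
qed

end
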